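(* Let $C$ be a commutative ring with identity, $\lambda\in C$, and $A$ a $C$-algebra with identity. When $\lambda$ is not a zero divisor in $\overline A$, $(\mathfrak S(A),P'_A)$ is a free Baxter $C$-algebra (of weight $\lambda$) on $A$ in the category $\mathbf{Bax}_C$ of Baxter $C$-algebras with identity. That is, for every Baxter $C$-algebra $(R,P)$ of weight $\lambda$ with identity and every $C$-algebra homomorphism $\varphi:A\to R$ there is a unique Baxter $C$-algebra homomorphism $\tilde\varphi:(\mathfrak S(A),P'_A)\to(R,P)$ with $\tilde\varphi(t^{(a)})=\varphi(a)$ for all $a\in A$.
   Context: All rings and algebras are associative, commutative, with identity; $\otimes=\otimes_C$. A Baxter $C$-algebra (of weight $\lambda$) is a pair $(R,P)$ with $R$ a $C$-algebra and $P:R\to R$ a $C$-linear map satisfying $P(x)P(y)=P(xP(y))+P(yP(x))+\lambda P(xy)$. A homomorphism $f:(R,P)\to(S,Q)$ is a (unital) $C$-algebra homomorphism with $f\circ P=Q\circ f$. Standard Baxter algebra. $\overline A=\varinjlim A^{\otimes n}$ is the direct limit of the tensor power $C$-algebras along $A^{\otimes n}\to A^{\otimes(n+1)}$, $x\mapsto x\otimes1_A$. $\mathfrak A(A)$ is the algebra of sequences $(a_1,a_2,\dots)$ with entries in $\overline A$, with componentwise operations, and $P'_A(a_1,a_2,a_3,\dots)=\lambda(0,a_1,a_1+a_2,a_1+a_2+a_3,\dots)$; $(\mathfrak A(A),P'_A)$ is a Baxter $C$-algebra of weight $\lambda$. For $a\in A$, $t^{(a)}=(t^{(a)}_k)_{k\ge1}\in\mathfrak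 A(A)$ is given by $t^{(a)}_k=1\otimes\dots\otimes1\otimes a$ ($k$ factors, $a$ in position $k$). $\mathfrak S(A)$ is the (unital) Baxter subalgebra of $\mathfrak A(A)$ generated by the $t^{(a)}$, $a\in A$, with the restriction of $P'_A$ as Baxter operator. *)

theory Defs
  imports "HOL-Algebra.Module" "HOL-Algebra.QuotRing" "HOL-Algebra.Subrings"
begin

text \<open>Commutative unital \<open>C\<close>-algebras are those of the locale \<^locale>\<open>algebra\<close>; they are carrier-based,
  so the zero ring is allowed. Maps are only relevant on the carriers.\<close>

definition alg_hom ::
  "('c, 'k) ring_scheme \<Rightarrow> ('c, 'a, 'm) module_scheme \<Rightarrow> ('c, 'b, 'n) module_scheme \<Rightarrow> ('a \<Rightarrow> 'b) set"
  where "alg_hom C A B =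
    {h \<in> ring_hom A B. \<forall>c\<in>carrier C. \<forall>x\<in>carrier A. h (c \<odot>\<^bsub>A\<^esub> x) = c \<odot>\<^bsub>B\<^esub> h x}"

text \<open>Zero itself counts as a zero divisor of any nonzero ring.\<close>

definition zero_divisor :: "('a, 'm) ring_scheme \<Rightarrow> 'a \<Rightarrow> bool"
  where "zero_divisor R r \<longleftrightarrow>
    r \<in> carrier R \<and> (\<exists>x\<in>carrier R. x \<noteq> \<zero>\<^bsub>R\<^esub> \<and> r \<otimes>\<^bsub>R\<^esub> x = \<zero>\<^bsub>R\<^esub>)"


section \<open>Baxter algebras\<close>

locale baxter_algebra = algebra C R
  for C :: "('c, 'k) ring_scheme" and R :: "('c, 'r, 'm) module_scheme" +
  fixes lam :: 'c and P :: "'r \<Rightarrow> 'r"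
  assumes weight_closed: "lam \<in> carrier C"
    and P_closed: "x \<in> carrier R \<Longrightarrow> P x \<in> carrier R"
    and P_add: "\<lbrakk>x \<in> carrier R; y \<in> carrier R\<rbrakk> \<Longrightarrow> P (x \<oplus>\<^bsub>R\<^esub> y) = P x \<oplus>\<^bsub>R\<^esub> P y"
    and P_smult: "\<lbrakk>c \<in> carrier C; x \<in> carrier R\<rbrakk> \<Longrightarrow> P (c \<odot>\<^bsub>R\<^esub> x) = c \<odot>\<^bsub>R\<^esub> P x"
    and baxter: "\<lbrakk>x \<in> carrier R; y \<in> carrier R\<rbrakk> \<Longrightarrow>
      P x \<otimes>\<^bsub>R\<^esub> P y = P (x \<otimes>\<^bsub>R\<^esub> P y) \<oplus>\<^bsub>R\<^esub> P (y \<otimes>\<^bsub>R\<^esub> P x) \<oplus>\<^bsub>R\<^esub> lam \<odot>\<^bsub>R\<^esub> P (x \<otimes>\<^bsub>R\<^esub> y)"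

definition baxter_hom ::
  "('c, 'k) ring_scheme \<Rightarrow> ('c, 'r, 'm) module_scheme \<Rightarrow> ('r \<Rightarrow> 'r) \<Rightarrow>
    ('c, 's, 'n) module_scheme \<Rightarrow> ('s \<Rightarrow> 's) \<Rightarrow> ('r \<Rightarrow> 's) set"
  where "baxter_hom C R P S Q = {f \<in> alg_hom C R S. \<forall>x\<in>carrier R. f (P x) = Q (f x)}"

definition baxter_subalgebra ::
  "('c, 'k) ring_scheme \<Rightarrow> ('c, 'r, 'm) module_scheme \<Rightarrow> ('r \<Rightarrow> 'r) \<Rightarrow> 'r set \<Rightarrow> bool"
  where "baxter_subalgebra C R P H \<longleftrightarrow>
    subring H R \<and> (\<forall>c\<in>carrier C. \<forall>x\<in>H. c \<odot>\<^bsub>R\<^esub> x \<in> H) \<and> (\<forall>x\<in>H. P x \<in> H)"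

definition baxter_generated ::
  "('c, 'k) ring_scheme \<Rightarrow> ('c, 'r, 'm) module_scheme \<Rightarrow> ('r \<Rightarrow> 'r) \<Rightarrow> 'r set \<Rightarrow> 'r set"
  where "baxter_generated C R P X = \<Inter>{H. baxter_subalgebra C R P H \<and> X \<subseteq> H}"


section \<open>Tensor powers of an algebra\<close>

text \<open>\<open>A\<^sup>\<otimes>\<^sup>n\<close> is the free \<open>C\<close>-module on the \<open>n\<close>-tuples over \<open>A\<close>, multiplied by bilinear extension of the
  componentwise product of tuples, modulo the multilinearity relations. A tuple times a
  multilinearity relation is again one, so the ideal generated by these relations is
  just their \<open>C\<close>-span.\<close>

definition tuples :: "('c, 'a, 'm) module_scheme \<Rightarrow> nat \<Rightarrow> 'a list set"
  where "tuples A n = {xs. length xs = n \<and> set xs \<subseteq> carrier A}"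

definition supp :: "('c, 'k) ring_scheme \<Rightarrow> ('x \<Rightarrow> 'c) \<Rightarrow> 'x set"
  where "supp C f = {x. f x \<noteq> \<zero>\<^bsub>C\<^esub>}"

definition basis_elt :: "('c, 'k) ring_scheme \<Rightarrow> 'x \<Rightarrow> 'x \<Rightarrow> 'c"
  where "basis_elt C x = (\<lambda>y. if y = x then \<one>\<^bsub>C\<^esub> else \<zero>\<^bsub>C\<^esub>)"

definition free_tuple_algebra ::
  "('c, 'k) ring_scheme \<Rightarrow> ('c, 'a, 'm) module_scheme \<Rightarrow> nat \<Rightarrow> ('c, 'a list \<Rightarrow> 'c) module"
  where "free_tuple_algebra C A n =
    \<lparr>carrier = {f. range f \<subseteq> carrier C \<and> finite (supp C f) \<and> supp C f \<subseteq> tuples A n},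
     mult = (\<lambda>f g zs. \<Oplus>\<^bsub>C\<^esub>p\<in>{(xs, ys). xs \<in> supp C f \<and> ys \<in> supp C g \<and> map2 (mult A) xs ys = zs}.
                f (fst p) \<otimes>\<^bsub>C\<^esub> g (snd p)),
     one = basis_elt C (replicate n \<one>\<^bsub>A\<^esub>),
     zero = (\<lambda>_. \<zero>\<^bsub>C\<^esub>),
     add = (\<lambda>f g xs. f xs \<oplus>\<^bsub>C\<^esub> g xs),
     smult = (\<lambda>c f xs. c \<otimes>\<^bsub>C\<^esub> f xs)\<rparr>"

definition multilinear_rels ::
  "('c, 'k) ring_scheme \<Rightarrow> ('c, 'a, 'm) module_scheme \<Rightarrow> nat \<Rightarrow> ('a list \<Rightarrow> 'c) set"
  where "multilinear_rels C A n =
    (let F = free_tuple_algebra C A n; e = basis_elt C in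
      {e (xs[i := a \<oplus>\<^bsub>A\<^esub> b]) \<ominus>\<^bsub>F\<^esub> (e (xs[i := a]) \<oplus>\<^bsub>F\<^esub> e (xs[i := b])) | xs i a b.
         xs \<in> tuples A n \<and> i < n \<and> a \<in> carrier A \<and> b \<in> carrier A}
      \<union> {e (xs[i := c \<odot>\<^bsub>A\<^esub> a]) \<ominus>\<^bsub>F\<^esub> (c \<odot>\<^bsub>F\<^esub> e (xs[i := a])) | xs i c a.
         xs \<in> tuples A n \<and> i < n \<and> c \<in> carrier C \<and> a \<in> carrier A})"

definition tensor_ideal ::
  "('c, 'k) ring_scheme \<Rightarrow> ('c, 'a, 'm) module_scheme \<Rightarrow> nat \<Rightarrow> ('a list \<Rightarrow> 'c) set"
  where "tensor_ideal C A n = Idl\<^bsub>free_tuple_algebra C A n\<^esub> (multilinear_rels C A n)"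

definition quot_algebra :: "('c, 'x, 'm) module_scheme \<Rightarrow> 'x set \<Rightarrow> ('c, 'x set) module"
  where "quot_algebra F I =
    \<lparr>carrier = carrier (F Quot I), mult = mult (F Quot I), one = one (F Quot I),
     zero = zero (F Quot I), add = add (F Quot I),
     smult = (\<lambda>c X. \<Union>x\<in>X. I +>\<^bsub>F\<^esub> (c \<odot>\<^bsub>F\<^esub> x))\<rparr>"

definition tensor_power ::
  "('c, 'k) ring_scheme \<Rightarrow> ('c, 'a, 'm) module_scheme \<Rightarrow> nat \<Rightarrow> ('c, ('a list \<Rightarrow> 'c) set) module"
  where "tensor_power C A n = quot_algebra (free_tuple_algebra C A n) (tensor_ideal C A n)"

definition pure_tensor ::
  "('c, 'k) ring_scheme \<Rightarrow> ('c, 'a, 'm) module_scheme \<Rightarrow> 'a list \<Rightarrow> ('a list \<Rightarrow> 'c) set"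
  where "pure_tensor C A xs =
    tensor_ideal C A (length xs) +>\<^bsub>free_tuple_algebra C A (length xs)\<^esub> basis_elt C xs"

text \<open>The linear extension of \<open>xs \<mapsto> xs @ [\<one>]\<close> on the free modules; it induces \<open>x \<mapsto> x \<otimes> \<one>\<close>.\<close>

definition append_one ::
  "('c, 'k) ring_scheme \<Rightarrow> ('c, 'a, 'm) module_scheme \<Rightarrow> ('a list \<Rightarrow> 'c) \<Rightarrow> 'a list \<Rightarrow> 'c"
  where "append_one C A f =
    (\<lambda>ys. if ys \<noteq> [] \<and> last ys = \<one>\<^bsub>A\<^esub> then f (butlast ys) else \<zero>\<^bsub>C\<^esub>)"

definition tensor_one ::
  "('c, 'k) ring_scheme \<Rightarrow> ('c, 'a, 'm) module_scheme \<Rightarrow> nat \<Rightarrow>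
    ('a list \<Rightarrow> 'c) set \<Rightarrow> ('a list \<Rightarrow> 'c) set"
  where "tensor_one C A n X =
    (\<Union>f\<in>X. tensor_ideal C A (Suc n) +>\<^bsub>free_tuple_algebra C A (Suc n)\<^esub> append_one C A f)"


section \<open>Sequential direct limits of algebras\<close>

text \<open>For \<open>M 1 \<rightarrow> M 2 \<rightarrow> M 3 \<rightarrow> \<dots>\<close> with transition maps \<open>\<tau> n : M n \<rightarrow> M (n + 1)\<close>, the direct limit is
  the disjoint union of the carriers modulo eventual equality. Each operation returns the class
  computed from representatives, moved to a common stage in the binary case.\<close>

primrec transit :: "(nat \<Rightarrow> 'x \<Rightarrow> 'x) \<Rightarrow> nat \<Rightarrow> nat \<Rightarrow> 'x \<Rightarrow> 'x"
  where
    "transit \<tau> m 0 x = x"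
  | "transit \<tau> m (Suc d) x = \<tau> (m + d) (transit \<tau> m d x)"

definition limit_rel ::
  "(nat \<Rightarrow> ('c, 'x, 'm) module_scheme) \<Rightarrow> (nat \<Rightarrow> 'x \<Rightarrow> 'x) \<Rightarrow> ((nat \<times> 'x) \<times> (nat \<times> 'x)) set"
  where "limit_rel M \<tau> = {((m, x), (n, y)).
    m \<ge> 1 \<and> n \<ge> 1 \<and> x \<in> carrier (M m) \<and> y \<in> carrier (M n) \<and>
    (\<exists>d e. m + d = n + e \<and> transit \<tau> m d x = transit \<tau> n e y)}"

definition limit_class ::
  "(nat \<Rightarrow> ('c, 'x, 'm) module_scheme) \<Rightarrow> (nat \<Rightarrow> 'x \<Rightarrow> 'x) \<Rightarrow> nat \<Rightarrow> 'x \<Rightarrow> (nat \<times> 'x) set"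
  where "limit_class M \<tau> n x = limit_rel M \<tau> `` {(n, x)}"

definition limit_binop ::
  "(nat \<Rightarrow> ('c, 'x, 'm) module_scheme) \<Rightarrow> (nat \<Rightarrow> 'x \<Rightarrow> 'x) \<Rightarrow> (nat \<Rightarrow> 'x \<Rightarrow> 'x \<Rightarrow> 'x) \<Rightarrow>
    (nat \<times> 'x) set \<Rightarrow> (nat \<times> 'x) set \<Rightarrow> (nat \<times> 'x) set"
  where "limit_binop M \<tau> f X Y =
    \<Union>{limit_class M \<tau> (m + d) (f (m + d) (transit \<tau> m d x) (transit \<tau> n e y)) | m x n y d e.
        (m, x) \<in> X \<and> (n, y) \<in> Y \<and> m + d = n + e}"

definition direct_limit ::
  "(nat \<Rightarrow> ('c, 'x, 'm) module_scheme) \<Rightarrow> (nat \<Rightarrow> 'x \<Rightarrow> 'x) \<Rightarrow> ('c, (nat \<times> 'x) set) module"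
  where "direct_limit M \<tau> =
    \<lparr>carrier = (SIGMA n:{1..}. carrier (M n)) // limit_rel M \<tau>,
     mult = limit_binop M \<tau> (\<lambda>n. mult (M n)),
     one = limit_class M \<tau> 1 \<one>\<^bsub>M 1\<^esub>,
     zero = limit_class M \<tau> 1 \<zero>\<^bsub>M 1\<^esub>,
     add = limit_binop M \<tau> (\<lambda>n. add (M n)),
     smult = (\<lambda>c X. \<Union>(n, x)\<in>X. limit_class M \<tau> n (c \<odot>\<^bsub>M n\<^esub> x))\<rparr>"


section \<open>The standard Baxter algebra\<close>

definition Abar ::
  "('c, 'k) ring_scheme \<Rightarrow> ('c, 'a, 'm) module_scheme \<Rightarrow>
    ('c, (nat \<times> ('a list \<Rightarrow> 'c) set) set) module"
  where "Abar C A = direct_limit (tensor_power C A) (tensor_one C A)"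

text \<open>Sequences are indexed from \<open>0\<close>: the entry \<open>a\<^sub>k\<close>, \<open>k \<ge> 1\<close>, of a sequence \<open>s\<close> is \<open>s (k - 1)\<close>.\<close>

definition seq_algebra :: "('c, 'x, 'm) module_scheme \<Rightarrow> ('c, nat \<Rightarrow> 'x) module"
  where "seq_algebra B =
    \<lparr>carrier = {s. \<forall>k. s k \<in> carrier B},
     mult = (\<lambda>s t k. s k \<otimes>\<^bsub>B\<^esub> t k),
     one = (\<lambda>_. \<one>\<^bsub>B\<^esub>),
     zero = (\<lambda>_. \<zero>\<^bsub>B\<^esub>),
     add = (\<lambda>s t k. s k \<oplus>\<^bsub>B\<^esub> t k),
     smult = (\<lambda>c s k. c \<odot>\<^bsub>B\<^esub> s k)\<rparr>"

definition std_seqs ::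
  "('c, 'k) ring_scheme \<Rightarrow> ('c, 'a, 'm) module_scheme \<Rightarrow>
    ('c, nat \<Rightarrow> (nat \<times> ('a list \<Rightarrow> 'c) set) set) module"
  where "std_seqs C A = seq_algebra (Abar C A)"

definition std_P ::
  "('c, 'k) ring_scheme \<Rightarrow> ('c, 'a, 'm) module_scheme \<Rightarrow> 'c \<Rightarrow>
    (nat \<Rightarrow> (nat \<times> ('a list \<Rightarrow> 'c) set) set) \<Rightarrow> nat \<Rightarrow> (nat \<times> ('a list \<Rightarrow> 'c) set) set"
  where "std_P C A lam s = (\<lambda>k. lam \<odot>\<^bsub>Abar C A\<^esub> (\<Oplus>\<^bsub>Abar C A\<^esub>i\<in>{..<k}. s i))"

definition std_gen ::
  "('c, 'k) ring_scheme \<Rightarrow> ('c, 'a, 'm) module_scheme \<Rightarrow> 'a \<Rightarrow>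
    nat \<Rightarrow> (nat \<times> ('a list \<Rightarrow> 'c) set) set"
  where "std_gen C A a = (\<lambda>k. limit_class (tensor_power C A) (tensor_one C A) (Suc k)
    (pure_tensor C A (replicate k \<one>\<^bsub>A\<^esub> @ [a])))"

definition std_baxter ::
  "('c, 'k) ring_scheme \<Rightarrow> ('c, 'a, 'm) module_scheme \<Rightarrow> 'c \<Rightarrow>
    ('c, nat \<Rightarrow> (nat \<times> ('a list \<Rightarrow> 'c) set) set) module"
  where "std_baxter C A lam = (std_seqs C A)
    \<lparr>carrier := baxter_generated C (std_seqs C A) (std_P C A lam) (std_gen C A ` carrier A)\<rparr>"

end

theory Submission
  imports Defs
begin

text \<open>In a Baxter algebra \<open>(R, P)\<close> with an algebra homomorphism \<open>f : A \<rightarrow> R\<close>, a list \<open>a\<^sub>1, \<dots>, a\<^sub>n\<close> has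
  the value \<open>f a\<^sub>1 P (f a\<^sub>2 P (\<dots> P (f a\<^sub>n)))\<close>, called a word (\<open>word\<close>). Words are multilinear. The
  Baxter identity expresses a product of two words as a combination of words, by the mixable shuffle
  formula \<open>wd_mult\<close>, whose coefficients do not depend on \<open>(R, P)\<close>; and \<open>P\<close> of a word is the word with a
  letter \<open>1\<close> in front. So the linear combinations of words form the Baxter subalgebra generated by the
  image of \<open>A\<close>.

  Hence there is at most one Baxter homomorphism \<open>\<psi>\<close> from the standard Baxter algebra with
  \<open>\<psi> (t a) = \<phi> a\<close>. It must send each combination of words to the same combination of words in \<open>R\<close>. This
  rule is compatible with all operations, and it is well defined if a combination of words that is zero
  in the algebra of sequences is also zero in \<open>R\<close> (\<open>universal_property\<close>).

  To see the latter, regard the combination as a sum of tensors \<open>z\<^sub>n\<close> with \<open>n\<close> factors. The operator on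
  sequences shifts to the right, so a word of length \<open>n\<close> begins with \<open>n - 1\<close> zeros, and its first other
  entry is \<open>\<lambda>\<^sup>n\<^sup>-\<^sup>1\<close> times the reversed tensor (\<open>std_word_entries\<close>). For the least \<open>n\<close> that occurs, this
  entry of the combination is \<open>\<lambda>\<^sup>n\<^sup>-\<^sup>1\<close> times the reversal of \<open>z\<^sub>n\<close>. As \<open>\<lambda>\<close> is not a zero divisor,
  \<open>z\<^sub>n\<close> is zero in the limit, hence is zero already as a tensor, because \<open>x \<mapsto> x \<otimes> 1\<close> is split by
  the multiplication of the last two factors (\<open>transit_zero_kernel\<close>). Since words are multilinear, the
  part of length \<open>n\<close> then contributes nothing in either algebra, and induction finishes
  (\<open>std_word_kernel\<close>).

  It remains to see that the tensor powers, their direct limit and the algebra of sequences are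
  algebras. Quotients and limits inherit the axioms from the algebras that map to them
  (\<open>algebraI_locally\<close>), and the vanishing of a tensor is only exploited through multilinear maps,
  which kill the tensor ideal (\<open>tensor_ideal_kernel\<close>).\<close>

section \<open>Finitely supported functions and linear extension\<close>

definition fin_funs :: "('c, 'k) ring_scheme \<Rightarrow> 'x set \<Rightarrow> ('x \<Rightarrow> 'c) set"
  where "fin_funs C X = {f. range f \<subseteq> carrier C \<and> finite (supp C f) \<and> supp C f \<subseteq> X}"

definition lin_ext ::
  "('c, 'k) ring_scheme \<Rightarrow> ('c, 'b, 'm) module_scheme \<Rightarrow> ('x \<Rightarrow> 'b) \<Rightarrow> ('x \<Rightarrow> 'c) \<Rightarrow> 'b"
  where "lin_ext C M w f = (\<Oplus>\<^bsub>M\<^esub>x\<in>supp C f. f x \<odot>\<^bsub>M\<^esub> w x)"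

lemma fin_funsD:
  assumes "f \<in> fin_funs C X"
  shows "f x \<in> carrier C" "finite (supp C f)" "supp C f \<subseteq> X"
  using assms by (auto simp: fin_funs_def)

context cring
begin

lemma fin_funs_zero: "(\<lambda>_. \<zero>) \<in> fin_funs R X"
  by (auto simp: fin_funs_def supp_def)

lemma fin_funs_basis: "x \<in> X \<Longrightarrow> basis_elt R x \<in> fin_funs R X"
proof -
  have "supp R (basis_elt R x) \<subseteq> {x}"
    by (auto simp: supp_def basis_elt_def)
  then show "x \<in> X \<Longrightarrow> basis_elt R x \<in> fin_funs R X"
    by (auto simp: fin_funs_def basis_elt_def dest: finite_subset)
qed

lemma fin_funs_add:
  assumes "f \<in> fin_funs R X" "g \<in> fin_funs R X"
  shows "(\<lambda>x. f x \<oplus> g x) \<in> fin_funs R X"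
proof -
  have "supp R (\<lambda>x. f x \<oplus> g x) \<subseteq> supp R f \<union> supp R g"
    by (auto simp: supp_def)
  then show ?thesis
    using assms by (auto simp: fin_funs_def image_subset_iff dest: finite_subset)
qed

lemma fin_funs_smult:
  assumes "c \<in> carrier R" "f \<in> fin_funs R X"
  shows "(\<lambda>x. c \<otimes> f x) \<in> fin_funs R X"
proof -
  have "supp R (\<lambda>x. c \<otimes> f x) \<subseteq> supp R f"
    using assms by (auto simp: supp_def)
  then show ?thesis
    using assms by (auto simp: fin_funs_def image_subset_iff dest: finite_subset)
qed

lemma fin_funs_restrict:
  assumes "f \<in> fin_funs R X"
  shows "(\<lambda>x. if Q x then f x else \<zero>) \<in> fin_funs R (X \<inter> Collect Q)"
proof -
  have "supp R (\<lambda>x. if Q x then f x else \<zero>) \<subseteq> supp R f \<inter> Collect Q"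
    by (auto simp: supp_def)
  then show ?thesis
    using assms by (auto simp: fin_funs_def image_subset_iff dest: finite_subset)
qed

lemma fin_funs_mono: "f \<in> fin_funs R X \<Longrightarrow> X \<subseteq> Y \<Longrightarrow> f \<in> fin_funs R Y"
  by (auto simp: fin_funs_def)

text \<open>Removing the points of the support one by one exhausts \<open>f\<close> by multiples of basis vectors.
  With this induction, identities between linear maps never involve sums over varying supports.\<close>

lemma fin_funs_induct [consumes 1, case_names zero single add]:
  assumes f: "f \<in> fin_funs R X"
    and zero: "P (\<lambda>_. \<zero>)"
    and single: "\<And>c x. c \<in> carrier R \<Longrightarrow> x \<in> X \<Longrightarrow> P (\<lambda>y. c \<otimes> basis_elt R x y)"
    and add: "\<And>f g. f \<in> fin_funs R X \<Longrightarrow> g \<in> fin_funs R X \<Longrightarrow> P f \<Longrightarrow> P g \<Longrightarrow> P (\<lambda>x. f x \<oplus> g x)"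
  shows "P f"
proof -
  have "P f" if "finite B" "f \<in> fin_funs R X" "supp R f \<subseteq> B" for B f
    using that
  proof (induction B arbitrary: f rule: finite_induct)
    case empty
    then have "f = (\<lambda>_. \<zero>)" by (auto simp: supp_def)
    then show ?case using zero by simp
  next
    case (insert x B)
    show ?case
    proof (cases "x \<in> supp R f")
      case False
      then show ?thesis using insert by auto
    next
      case True
      then have x: "x \<in> X" using insert.prems by (auto dest: fin_funsD)
      let ?g = "\<lambda>y. if y \<noteq> x then f y else \<zero>"
      let ?h = "\<lambda>y. f x \<otimes> basis_elt R x y"
      have fc: "f y \<in> carrier R" for y using insert.prems(1) by (rule fin_funsD)
      have g: "?g \<in> fin_funs R X"
        using fin_funs_mono[OF fin_funs_restrict[OF insert.prems(1), of "\<lambda>y. y \<noteq> x"], of X] by auto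
      have h: "?h \<in> fin_funs R X"
        by (intro fin_funs_smult fin_funs_basis fc x)
      have "supp R ?g \<subseteq> B" using insert.prems(2) by (auto simp: supp_def)
      then have "P (\<lambda>y. ?g y \<oplus> ?h y)"
        by (intro add g h insert.IH single fc x)
      moreover have "(\<lambda>y. ?g y \<oplus> ?h y) = f"
        using fc by (auto simp: basis_elt_def)
      ultimately show ?thesis by simp
    qed
  qed
  then show ?thesis using f fin_funsD(2)[OF f] by blast
qed

end

context module
begin

text \<open>A common superset of several supports makes their linear extensions comparable term by term.\<close>

lemma lin_ext_superset:
  assumes "finite B" "supp R f \<subseteq> B" "range f \<subseteq> carrier R" "w \<in> B \<rightarrow> carrier M"
  shows "lin_ext R M w f = (\<Oplus>\<^bsub>M\<^esub>x\<in>B. f x \<odot>\<^bsub>M\<^esub> w x)"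
  unfolding lin_ext_def
proof (rule M.add.finprod_mono_neutral_cong_left)
  show "f i \<odot>\<^bsub>M\<^esub> w i = \<zero>\<^bsub>M\<^esub>" if "i \<in> B - supp R f" for i
    using that assms(4) by (auto simp: supp_def Pi_iff)
  show "(\<lambda>x. f x \<odot>\<^bsub>M\<^esub> w x) \<in> B \<rightarrow> carrier M"
    using assms(3,4) by (auto simp: Pi_iff image_subset_iff)
qed (use assms in auto)

lemma lin_ext_closed:
  assumes "f \<in> fin_funs R X" "w \<in> X \<rightarrow> carrier M"
  shows "lin_ext R M w f \<in> carrier M"
  unfolding lin_ext_def
  by (intro M.finsum_closed) (use assms in \<open>auto simp: fin_funs_def Pi_iff image_subset_iff subset_iff\<close>)

lemma lin_ext_zero: "lin_ext R M w (\<lambda>_. \<zero>) = \<zero>\<^bsub>M\<^esub>"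
  by (simp add: lin_ext_def supp_def)

lemma lin_ext_single:
  assumes "c \<in> carrier R" "w x \<in> carrier M"
  shows "lin_ext R M w (\<lambda>y. c \<otimes> basis_elt R x y) = c \<odot>\<^bsub>M\<^esub> w x"
proof -
  have "lin_ext R M w (\<lambda>y. c \<otimes> basis_elt R x y)
      = (\<Oplus>\<^bsub>M\<^esub>z\<in>{x}. (c \<otimes> basis_elt R x z) \<odot>\<^bsub>M\<^esub> w z)"
    by (rule lin_ext_superset) (use assms in \<open>auto simp: supp_def basis_elt_def\<close>)
  then show ?thesis
    using assms by (simp add: basis_elt_def)
qed

lemma lin_ext_basis: "w x \<in> carrier M \<Longrightarrow> lin_ext R M w (basis_elt R x) = w x"
proof -
  have "(\<lambda>y. \<one> \<otimes> basis_elt R x y) = basis_elt R x"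
    by (auto simp: basis_elt_def)
  then show "w x \<in> carrier M \<Longrightarrow> lin_ext R M w (basis_elt R x) = w x"
    using lin_ext_single[of \<one> w x] by simp
qed

lemma lin_ext_add:
  assumes f: "f \<in> fin_funs R X" and g: "g \<in> fin_funs R X" and w: "w \<in> X \<rightarrow> carrier M"
  shows "lin_ext R M w (\<lambda>x. f x \<oplus> g x) = lin_ext R M w f \<oplus>\<^bsub>M\<^esub> lin_ext R M w g"
proof -
  let ?B = "supp R f \<union> supp R g"
  have B: "finite ?B" "w \<in> ?B \<rightarrow> carrier M"
    using f g w by (auto simp: fin_funs_def)
  have 1: "lin_ext R M w h = (\<Oplus>\<^bsub>M\<^esub>x\<in>?B. h x \<odot>\<^bsub>M\<^esub> w x)"
    if "h \<in> fin_funs R X" "supp R h \<subseteq> ?B" for h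
    by (rule lin_ext_superset) (use B that in \<open>auto simp: fin_funs_def\<close>)
  have fc: "f x \<in> carrier R" "g x \<in> carrier R" for x
    using f g by (auto dest: fin_funsD)
  have "supp R (\<lambda>x. f x \<oplus> g x) \<subseteq> ?B" by (auto simp: supp_def)
  from 1[OF fin_funs_add[OF f g] this]
  have "lin_ext R M w (\<lambda>x. f x \<oplus> g x) = (\<Oplus>\<^bsub>M\<^esub>x\<in>?B. (f x \<oplus> g x) \<odot>\<^bsub>M\<^esub> w x)" .
  also have "\<dots> = (\<Oplus>\<^bsub>M\<^esub>x\<in>?B. f x \<odot>\<^bsub>M\<^esub> w x \<oplus>\<^bsub>M\<^esub> g x \<odot>\<^bsub>M\<^esub> w x)"
    using B fc by (intro M.finsum_cong') (auto simp: Pi_iff smult_l_distr)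
  also have "\<dots> = (\<Oplus>\<^bsub>M\<^esub>x\<in>?B. f x \<odot>\<^bsub>M\<^esub> w x) \<oplus>\<^bsub>M\<^esub> (\<Oplus>\<^bsub>M\<^esub>x\<in>?B. g x \<odot>\<^bsub>M\<^esub> w x)"
    using B fc by (intro M.finsum_addf) (auto simp: Pi_iff)
  also have "\<dots> = lin_ext R M w f \<oplus>\<^bsub>M\<^esub> lin_ext R M w g"
    using 1[OF f] 1[OF g] by simp
  finally show ?thesis .
qed

lemma lin_ext_smult:
  assumes c: "c \<in> carrier R" and f: "f \<in> fin_funs R X" and w: "w \<in> X \<rightarrow> carrier M"
  shows "lin_ext R M w (\<lambda>x. c \<otimes> f x) = c \<odot>\<^bsub>M\<^esub> lin_ext R M w f"
  using f
proof (induction rule: fin_funs_induct)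
  case zero
  then show ?case using c by (simp add: lin_ext_zero)
next
  case (single d x)
  then have "(\<lambda>y. c \<otimes> (d \<otimes> basis_elt R x y)) = (\<lambda>y. (c \<otimes> d) \<otimes> basis_elt R x y)"
    using c by (auto simp: basis_elt_def)
  then show ?case
    using single c w lin_ext_single[of "c \<otimes> d" w x] lin_ext_single[of d w x]
    by (auto simp: smult_assoc1 Pi_iff)
next
  case (add f g)
  have "(\<lambda>x. c \<otimes> (f x \<oplus> g x)) = (\<lambda>x. c \<otimes> f x \<oplus> c \<otimes> g x)"
    using c add.hyps by (intro ext R.r_distr) (auto dest: fin_funsD)
  then show ?case
    using add c w
    by (simp add: lin_ext_add[OF fin_funs_smult fin_funs_smult] lin_ext_add smult_r_distr lin_ext_closed)
qed

lemma lin_ext_cong: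
  assumes "f \<in> fin_funs R X" "w' \<in> X \<rightarrow> carrier M" "\<And>x. x \<in> X \<Longrightarrow> w x = w' x"
  shows "lin_ext R M w f = lin_ext R M w' f"
  unfolding lin_ext_def
  by (intro M.finsum_cong') (use assms in \<open>auto simp: fin_funs_def Pi_iff image_subset_iff subset_iff\<close>)

lemma lin_ext_const_zero:
  assumes "f \<in> fin_funs R X" "\<And>x. x \<in> X \<Longrightarrow> w x = \<zero>\<^bsub>M\<^esub>"
  shows "lin_ext R M w f = \<zero>\<^bsub>M\<^esub>"
proof -
  have "lin_ext R M w f = (\<Oplus>\<^bsub>M\<^esub>x\<in>supp R f. \<zero>\<^bsub>M\<^esub>)"
    unfolding lin_ext_def
    by (intro M.finsum_cong') (use assms in \<open>auto simp: fin_funs_def Pi_iff image_subset_iff subset_iff\<close>)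
  then show ?thesis by simp
qed

end

lemma lin_ext_unique:
  assumes "module C M"
    and f: "f \<in> fin_funs C X"
    and w: "w \<in> X \<rightarrow> carrier M"
    and h_zero: "h (\<lambda>_. \<zero>\<^bsub>C\<^esub>) = \<zero>\<^bsub>M\<^esub>"
    and h_basis: "\<And>c x. c \<in> carrier C \<Longrightarrow> x \<in> X \<Longrightarrow> h (\<lambda>y. c \<otimes>\<^bsub>C\<^esub> basis_elt C x y) = c \<odot>\<^bsub>M\<^esub> w x"
    and h_add: "\<And>f g. f \<in> fin_funs C X \<Longrightarrow> g \<in> fin_funs C X \<Longrightarrow>
      h (\<lambda>x. f x \<oplus>\<^bsub>C\<^esub> g x) = h f \<oplus>\<^bsub>M\<^esub> h g"
  shows "h f = lin_ext C M w f"
proof -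
  interpret module C M by fact
  show ?thesis
    using f
  proof (induction rule: fin_funs_induct)
    case zero
    show ?case by (simp add: h_zero lin_ext_zero)
  next
    case (single c x)
    then show ?case using w by (simp add: h_basis lin_ext_single Pi_iff)
  next
    case (add f g)
    then show ?case using w by (simp add: h_add lin_ext_add[where X = X])
  qed
qed

lemma lin_ext_hom:
  assumes "module C M" "module C N"
    and f: "f \<in> fin_funs C X"
    and w: "w \<in> X \<rightarrow> carrier M"
    and h_closed: "h \<in> carrier M \<rightarrow> carrier N"
    and h_add: "\<And>x y. x \<in> carrier M \<Longrightarrow> y \<in> carrier M \<Longrightarrow> h (x \<oplus>\<^bsub>M\<^esub> y) = h x \<oplus>\<^bsub>N\<^esub> h y"
    and h_smult: "\<And>c x. c \<in> carrier C \<Longrightarrow> x \<in> carrier M \<Longrightarrow> h (c \<odot>\<^bsub>M\<^esub> x) = c \<odot>\<^bsub>N\<^esub> h x"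
  shows "h (lin_ext C M w f) = lin_ext C N (\<lambda>x. h (w x)) f"
proof -
  interpret M: module C M by fact
  interpret N: module C N by fact
  show ?thesis
  proof (rule lin_ext_unique[OF \<open>module C N\<close> f])
    have "h \<zero>\<^bsub>M\<^esub> = h (\<zero>\<^bsub>C\<^esub> \<odot>\<^bsub>M\<^esub> \<zero>\<^bsub>M\<^esub>)" by simp
    also have "\<dots> = \<zero>\<^bsub>C\<^esub> \<odot>\<^bsub>N\<^esub> h \<zero>\<^bsub>M\<^esub>" by (rule h_smult) auto
    also have "\<dots> = \<zero>\<^bsub>N\<^esub>" using h_closed by (auto simp: Pi_iff)
    finally show "h (lin_ext C M w (\<lambda>_. \<zero>\<^bsub>C\<^esub>)) = \<zero>\<^bsub>N\<^esub>"
      by (simp add: M.lin_ext_zero)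
  qed (use w h_closed in \<open>auto simp: Pi_iff M.lin_ext_single h_smult M.lin_ext_add[where X = X] h_add M.lin_ext_closed[where X = X]\<close>)
qed

section \<open>The algebra of tuples\<close>

locale tensor_powers = algebra C A
  for C :: "('c, 'k) ring_scheme" (structure) and A :: "('c, 'a, 'm) module_scheme"
begin

abbreviation e :: "'a list \<Rightarrow> 'a list \<Rightarrow> 'c"
  where "e \<equiv> basis_elt C"

abbreviation F :: "nat \<Rightarrow> ('c, 'a list \<Rightarrow> 'c) module"
  where "F \<equiv> free_tuple_algebra C A"

abbreviation T :: "nat \<Rightarrow> ('c, ('a list \<Rightarrow> 'c) set) module"
  where "T \<equiv> tensor_power C A"

abbreviation tuple_mult :: "'a list \<Rightarrow> 'a list \<Rightarrow> 'a list"  (infixl \<open>\<star>\<close> 70)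
  where "xs \<star> ys \<equiv> map2 (mult A) xs ys"

lemma F_simps:
  "carrier (F n) = fin_funs C (tuples A n)"
  "\<one>\<^bsub>F n\<^esub> = e (replicate n \<one>\<^bsub>A\<^esub>)"
  "\<zero>\<^bsub>F n\<^esub> = (\<lambda>_. \<zero>)"
  "f \<oplus>\<^bsub>F n\<^esub> g = (\<lambda>xs. f xs \<oplus> g xs)"
  "c \<odot>\<^bsub>F n\<^esub> f = (\<lambda>xs. c \<otimes> f xs)"
  by (simp_all add: free_tuple_algebra_def fin_funs_def)

lemma tuples_iff: "xs \<in> tuples A n \<longleftrightarrow> length xs = n \<and> (\<forall>i<n. xs ! i \<in> carrier A)"
  by (auto simp: tuples_def subset_iff in_set_conv_nth)

lemma tuple_mult_closed: "xs \<in> tuples A n \<Longrightarrow> ys \<in> tuples A n \<Longrightarrow> xs \<star> ys \<in> tuples A n"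
  by (auto simp: tuples_iff)

lemma tuple_mult_comm: "xs \<in> tuples A n \<Longrightarrow> ys \<in> tuples A n \<Longrightarrow> xs \<star> ys = ys \<star> xs"
  by (rule nth_equalityI) (auto simp: tuples_iff m_comm)

lemma tuple_mult_assoc:
  "xs \<in> tuples A n \<Longrightarrow> ys \<in> tuples A n \<Longrightarrow> zs \<in> tuples A n \<Longrightarrow> xs \<star> ys \<star> zs = xs \<star> (ys \<star> zs)"
  by (rule nth_equalityI) (auto simp: tuples_iff m_assoc)

lemma one_tuple: "replicate n \<one>\<^bsub>A\<^esub> \<in> tuples A n"
  by (auto simp: tuples_iff)

lemma tuple_mult_one: "xs \<in> tuples A n \<Longrightarrow> replicate n \<one>\<^bsub>A\<^esub> \<star> xs = xs"
  by (rule nth_equalityI) (auto simp: tuples_iff)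

lemma e_closed: "xs \<in> tuples A n \<Longrightarrow> e xs \<in> carrier (F n)"
  by (simp add: F_simps R.fin_funs_basis)

text \<open>Padding with zeros turns the sum over matching pairs of tuples into a sum over a product of
  any two finite sets that contain the supports, which can be split and swapped.\<close>

lemma F_mult_eq:
  assumes f: "f \<in> carrier (F n)" and g: "g \<in> carrier (F n)"
    and "finite B" "supp C f \<subseteq> B" "finite D" "supp C g \<subseteq> D"
  shows "(f \<otimes>\<^bsub>F n\<^esub> g) zs
    = (\<Oplus>p\<in>B \<times> D. if fst p \<star> snd p = zs then f (fst p) \<otimes> g (snd p) else \<zero>)"
proof -
  have fc: "f xs \<in> carrier C" "g xs \<in> carrier C" for xs
    using f g by (auto simp: F_simps dest: fin_funsD)
  have "(f \<otimes>\<^bsub>F n\<^esub> g) zs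
    = (\<Oplus>p\<in>{(xs, ys). xs \<in> supp C f \<and> ys \<in> supp C g \<and> xs \<star> ys = zs}. f (fst p) \<otimes> g (snd p))"
    by (simp add: free_tuple_algebra_def)
  also have "\<dots> = (\<Oplus>p\<in>B \<times> D. if fst p \<star> snd p = zs then f (fst p) \<otimes> g (snd p) else \<zero>)"
    by (rule R.add.finprod_mono_neutral_cong_left) (use assms fc in \<open>auto simp: supp_def\<close>)
  finally show ?thesis .
qed

lemma F_mult_closed:
  assumes f: "f \<in> carrier (F n)" and g: "g \<in> carrier (F n)"
  shows "f \<otimes>\<^bsub>F n\<^esub> g \<in> carrier (F n)"
proof -
  have fc: "f xs \<in> carrier C" "g xs \<in> carrier C" for xs
    using f g by (auto simp: F_simps dest: fin_funsD)
  have fin: "finite (supp C f)" "finite (supp C g)"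
    and sub: "supp C f \<subseteq> tuples A n" "supp C g \<subseteq> tuples A n"
    using f g by (auto simp: F_simps dest: fin_funsD)
  note eq = F_mult_eq[OF f g fin(1) subset_refl fin(2) subset_refl]
  let ?Z = "(\<lambda>p. fst p \<star> snd p) ` (supp C f \<times> supp C g)"
  have "(f \<otimes>\<^bsub>F n\<^esub> g) zs \<in> carrier C" for zs
    unfolding eq by (rule R.finsum_closed) (use fc in auto)
  moreover have "(f \<otimes>\<^bsub>F n\<^esub> g) zs = \<zero>" if "zs \<notin> ?Z" for zs
  proof -
    have "(f \<otimes>\<^bsub>F n\<^esub> g) zs = (\<Oplus>p\<in>supp C f \<times> supp C g. \<zero>)"
      unfolding eq by (rule R.finsum_cong') (use that in auto)
    then show ?thesis by simp
  qed
  then have "supp C (f \<otimes>\<^bsub>F n\<^esub> g) \<subseteq> ?Z" by (auto simp: supp_def)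
  moreover have "finite ?Z" "?Z \<subseteq> tuples A n"
    using fin sub by (auto intro!: tuple_mult_closed)
  ultimately show ?thesis
    by (auto simp: F_simps fin_funs_def dest: finite_subset)
qed

lemma F_mult_comm:
  assumes f: "f \<in> carrier (F n)" and g: "g \<in> carrier (F n)"
  shows "f \<otimes>\<^bsub>F n\<^esub> g = g \<otimes>\<^bsub>F n\<^esub> f"
proof
  fix zs
  have fc: "f xs \<in> carrier C" "g xs \<in> carrier C" for xs
    using f g by (auto simp: F_simps dest: fin_funsD)
  have fin: "finite (supp C f)" "finite (supp C g)"
    and sub: "supp C f \<subseteq> tuples A n" "supp C g \<subseteq> tuples A n"
    using f g by (auto simp: F_simps dest: fin_funsD)
  let ?h = "\<lambda>p. if fst p \<star> snd p = zs then g (fst p) \<otimes> f (snd p) else \<zero>"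
  have "(g \<otimes>\<^bsub>F n\<^esub> f) zs = (\<Oplus>p\<in>prod.swap ` (supp C f \<times> supp C g). ?h p)"
    by (simp add: F_mult_eq[OF g f fin(2) subset_refl fin(1) subset_refl] product_swap)
  also have "\<dots> = (\<Oplus>p\<in>supp C f \<times> supp C g. ?h (prod.swap p))"
    by (rule R.finsum_reindex) (use fc in auto)
  also have "\<dots> = (\<Oplus>p\<in>supp C f \<times> supp C g. if fst p \<star> snd p = zs then f (fst p) \<otimes> g (snd p) else \<zero>)"
    by (rule R.finsum_cong')
      (use fc sub tuple_mult_comm R.m_comm in \<open>auto simp: subset_iff\<close>)
  also have "\<dots> = (f \<otimes>\<^bsub>F n\<^esub> g) zs"
    by (rule F_mult_eq[OF f g fin(1) subset_refl fin(2) subset_refl, symmetric])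
  finally show "(f \<otimes>\<^bsub>F n\<^esub> g) zs = (g \<otimes>\<^bsub>F n\<^esub> f) zs" ..
qed

lemma F_add_closed:
  "f \<in> carrier (F n) \<Longrightarrow> g \<in> carrier (F n) \<Longrightarrow> f \<oplus>\<^bsub>F n\<^esub> g \<in> carrier (F n)"
  by (simp add: F_simps R.fin_funs_add)

lemma F_smult_closed:
  "c \<in> carrier C \<Longrightarrow> f \<in> carrier (F n) \<Longrightarrow> c \<odot>\<^bsub>F n\<^esub> f \<in> carrier (F n)"
  by (simp add: F_simps R.fin_funs_smult)

lemma F_l_distr:
  assumes f: "f \<in> carrier (F n)" and f': "f' \<in> carrier (F n)" and g: "g \<in> carrier (F n)"
  shows "(f \<oplus>\<^bsub>F n\<^esub> f') \<otimes>\<^bsub>F n\<^esub> g = f \<otimes>\<^bsub>F n\<^esub> g \<oplus>\<^bsub>F n\<^esub> f' \<otimes>\<^bsub>F n\<^esub> g"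
proof
  fix zs
  have fc: "f xs \<in> carrier C" "f' xs \<in> carrier C" "g xs \<in> carrier C" for xs
    using f f' g by (auto simp: F_simps dest: fin_funsD)
  let ?B = "supp C f \<union> supp C f'"
  let ?p = "\<lambda>h p. if fst p \<star> snd p = zs then h (fst p) \<otimes> g (snd p) else \<zero>"
  have fin: "finite ?B" "finite (supp C g)"
    using f f' g by (auto simp: F_simps dest: fin_funsD)
  have eq: "(h \<otimes>\<^bsub>F n\<^esub> g) zs = (\<Oplus>p\<in>?B \<times> supp C g. ?p h p)"
    if "h \<in> carrier (F n)" "supp C h \<subseteq> ?B" for h
    by (rule F_mult_eq[OF that(1) g fin(1) that(2) fin(2) subset_refl])
  have "((f \<oplus>\<^bsub>F n\<^esub> f') \<otimes>\<^bsub>F n\<^esub> g) zs = (\<Oplus>p\<in>?B \<times> supp C g. ?p (f \<oplus>\<^bsub>F n\<^esub> f') p)"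
    by (rule eq) (use f f' in \<open>auto simp: F_add_closed, auto simp: F_simps supp_def\<close>)
  also have "\<dots> = (\<Oplus>p\<in>?B \<times> supp C g. ?p f p \<oplus> ?p f' p)"
    by (rule R.finsum_cong') (use fc in \<open>auto simp: F_simps R.l_distr\<close>)
  also have "\<dots> = (\<Oplus>p\<in>?B \<times> supp C g. ?p f p) \<oplus> (\<Oplus>p\<in>?B \<times> supp C g. ?p f' p)"
    by (rule R.finsum_addf) (use fc in auto)
  also have "\<dots> = (f \<otimes>\<^bsub>F n\<^esub> g \<oplus>\<^bsub>F n\<^esub> f' \<otimes>\<^bsub>F n\<^esub> g) zs"
    using eq[OF f] eq[OF f'] by (simp add: F_simps)
  finally show "((f \<oplus>\<^bsub>F n\<^esub> f') \<otimes>\<^bsub>F n\<^esub> g) zs = (f \<otimes>\<^bsub>F n\<^esub> g \<oplus>\<^bsub>F n\<^esub> f' \<otimes>\<^bsub>F n\<^esub> g) zs" .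
qed

lemma F_abelian_group: "abelian_group (F n)"
proof (rule abelian_groupI)
  fix f assume f: "f \<in> carrier (F n)"
  show "\<exists>g\<in>carrier (F n). g \<oplus>\<^bsub>F n\<^esub> f = \<zero>\<^bsub>F n\<^esub>"
  proof
    show "(\<lambda>xs. \<ominus> \<one> \<otimes> f xs) \<in> carrier (F n)"
      using f by (simp add: F_simps R.fin_funs_smult)
    have "f xs \<in> carrier C" for xs using f by (auto simp: F_simps dest: fin_funsD)
    then show "(\<lambda>xs. \<ominus> \<one> \<otimes> f xs) \<oplus>\<^bsub>F n\<^esub> f = \<zero>\<^bsub>F n\<^esub>"
      by (simp add: F_simps R.l_minus R.l_neg)
  qed
qed (auto simp: F_simps R.fin_funs_add R.fin_funs_zero fin_funsD(1) R.a_ac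
    intro!: ext)

lemma F_r_distr:
  assumes "f \<in> carrier (F n)" "g \<in> carrier (F n)" "g' \<in> carrier (F n)"
  shows "f \<otimes>\<^bsub>F n\<^esub> (g \<oplus>\<^bsub>F n\<^esub> g') = f \<otimes>\<^bsub>F n\<^esub> g \<oplus>\<^bsub>F n\<^esub> f \<otimes>\<^bsub>F n\<^esub> g'"
  using assms F_l_distr[of g n g' f]
  by (simp add: F_mult_comm[of f] F_add_closed)

lemma F_l_null: "f \<in> carrier (F n) \<Longrightarrow> \<zero>\<^bsub>F n\<^esub> \<otimes>\<^bsub>F n\<^esub> f = \<zero>\<^bsub>F n\<^esub>"
  by (simp add: free_tuple_algebra_def supp_def)

lemma F_r_null: "f \<in> carrier (F n) \<Longrightarrow> f \<otimes>\<^bsub>F n\<^esub> \<zero>\<^bsub>F n\<^esub> = \<zero>\<^bsub>F n\<^esub>"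
  by (simp add: free_tuple_algebra_def supp_def)

lemma F_single_mult:
  assumes "c \<in> carrier C" "d \<in> carrier C" "xs \<in> tuples A n" "ys \<in> tuples A n"
  shows "(c \<odot>\<^bsub>F n\<^esub> e xs) \<otimes>\<^bsub>F n\<^esub> (d \<odot>\<^bsub>F n\<^esub> e ys) = (c \<otimes> d) \<odot>\<^bsub>F n\<^esub> e (xs \<star> ys)"
proof
  fix zs
  have "((c \<odot>\<^bsub>F n\<^esub> e xs) \<otimes>\<^bsub>F n\<^esub> (d \<odot>\<^bsub>F n\<^esub> e ys)) zs
    = (\<Oplus>p\<in>{xs} \<times> {ys}. if fst p \<star> snd p = zs
        then (c \<odot>\<^bsub>F n\<^esub> e xs) (fst p) \<otimes> (d \<odot>\<^bsub>F n\<^esub> e ys) (snd p) else \<zero>)"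
    by (rule F_mult_eq)
      (use assms in \<open>auto intro!: F_smult_closed e_closed, auto simp: supp_def F_simps basis_elt_def split: if_splits\<close>)
  then show "((c \<odot>\<^bsub>F n\<^esub> e xs) \<otimes>\<^bsub>F n\<^esub> (d \<odot>\<^bsub>F n\<^esub> e ys)) zs = ((c \<otimes> d) \<odot>\<^bsub>F n\<^esub> e (xs \<star> ys)) zs"
    using assms by (simp add: F_simps basis_elt_def)
qed

lemma F_induct [consumes 1, case_names zero single add]:
  assumes "f \<in> carrier (F n)"
    and "P \<zero>\<^bsub>F n\<^esub>"
    and "\<And>c xs. c \<in> carrier C \<Longrightarrow> xs \<in> tuples A n \<Longrightarrow> P (c \<odot>\<^bsub>F n\<^esub> e xs)"
    and "\<And>f g. f \<in> carrier (F n) \<Longrightarrow> g \<in> carrier (F n) \<Longrightarrow> P f \<Longrightarrow> P g \<Longrightarrow> P (f \<oplus>\<^bsub>F n\<^esub> g)"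
  shows "P f"
  using R.fin_funs_induct[of f "tuples A n" P] assms unfolding F_simps by blast

text \<open>Both sides are trilinear, so this is associativity for tuples once the three factors are
  multiples of basis vectors.\<close>

lemma F_mult_assoc:
  assumes f: "f \<in> carrier (F n)" and g: "g \<in> carrier (F n)" and h: "h \<in> carrier (F n)"
  shows "f \<otimes>\<^bsub>F n\<^esub> g \<otimes>\<^bsub>F n\<^esub> h = f \<otimes>\<^bsub>F n\<^esub> (g \<otimes>\<^bsub>F n\<^esub> h)"
  using f
proof (induction rule: F_induct)
  case zero
  show ?case using g h by (simp add: F_l_null F_mult_closed)
next
  case (add f f')
  then show ?case using g h by (simp add: F_l_distr F_mult_closed)
next
  case f: (single c xs)
  then have fc: "c \<odot>\<^bsub>F n\<^esub> e xs \<in> carrier (F n)" by (intro F_smult_closed e_closed)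
  show ?case
    using g
  proof (induction rule: F_induct)
    case zero
    show ?case using fc h by (simp add: F_l_null F_r_null)
  next
    case (add g g')
    then show ?case using fc h by (simp add: F_l_distr F_r_distr F_mult_closed)
  next
    case g: (single d ys)
    then have gc: "d \<odot>\<^bsub>F n\<^esub> e ys \<in> carrier (F n)" by (intro F_smult_closed e_closed)
    show ?case
      using h
    proof (induction rule: F_induct)
      case zero
      show ?case using fc gc by (simp add: F_r_null F_mult_closed)
    next
      case (add h h')
      then show ?case using fc gc by (simp add: F_r_distr F_mult_closed)
    next
      case (single b zs)
      then show ?case
        using f g by (simp add: F_single_mult tuple_mult_closed tuple_mult_assoc R.m_assoc)
    qed
  qed
qed

lemma F_single_one: "xs \<in> tuples A n \<Longrightarrow> \<one> \<odot>\<^bsub>F n\<^esub> e xs = e xs"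
  by (auto simp: F_simps basis_elt_def)

lemma F_l_one: "f \<in> carrier (F n) \<Longrightarrow> \<one>\<^bsub>F n\<^esub> \<otimes>\<^bsub>F n\<^esub> f = f"
proof (induction rule: F_induct)
  case zero
  show ?case by (rule F_r_null) (simp add: F_simps R.fin_funs_basis one_tuple)
next
  case (single c xs)
  have "(\<one> \<odot>\<^bsub>F n\<^esub> e (replicate n \<one>\<^bsub>A\<^esub>)) \<otimes>\<^bsub>F n\<^esub> (c \<odot>\<^bsub>F n\<^esub> e xs) = c \<odot>\<^bsub>F n\<^esub> e xs"
    using single by (simp only: F_single_mult one_tuple tuple_mult_one R.one_closed R.l_one)
  then show ?case
    by (simp add: F_single_one one_tuple F_simps(2))
next
  case (add f g)
  then show ?case
    by (simp add: F_r_distr F_simps(1,2) R.fin_funs_basis one_tuple)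
qed

lemma F_cring: "cring (F n)"
proof (rule cringI)
  show "abelian_group (F n)" by (rule F_abelian_group)
  have "\<one>\<^bsub>F n\<^esub> \<in> carrier (F n)" by (simp add: F_simps R.fin_funs_basis one_tuple)
  then show "comm_monoid (F n)"
    by (intro comm_monoidI F_mult_closed F_mult_assoc F_mult_comm F_l_one)
qed (rule F_l_distr)

lemma F_smult_assoc:
  assumes c: "c \<in> carrier C" and f: "f \<in> carrier (F n)" and g: "g \<in> carrier (F n)"
  shows "(c \<odot>\<^bsub>F n\<^esub> f) \<otimes>\<^bsub>F n\<^esub> g = c \<odot>\<^bsub>F n\<^esub> (f \<otimes>\<^bsub>F n\<^esub> g)"
proof
  fix zs
  have fc: "f xs \<in> carrier C" "g xs \<in> carrier C" for xs
    using f g by (auto simp: F_simps dest: fin_funsD)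
  have fin: "finite (supp C f)" "finite (supp C g)"
    using f g by (auto simp: F_simps dest: fin_funsD)
  have "((c \<odot>\<^bsub>F n\<^esub> f) \<otimes>\<^bsub>F n\<^esub> g) zs = (\<Oplus>p\<in>supp C f \<times> supp C g. if fst p \<star> snd p = zs
        then (c \<odot>\<^bsub>F n\<^esub> f) (fst p) \<otimes> g (snd p) else \<zero>)"
    by (rule F_mult_eq) (use c f g fin in \<open>auto simp: F_smult_closed, auto simp: supp_def F_simps\<close>)
  also have "\<dots> = (\<Oplus>p\<in>supp C f \<times> supp C g. c \<otimes> (if fst p \<star> snd p = zs
        then f (fst p) \<otimes> g (snd p) else \<zero>))"
    by (rule R.finsum_cong') (use c fc in \<open>auto simp: F_simps R.m_assoc\<close>)
  also have "\<dots> = c \<otimes> (\<Oplus>p\<in>supp C f \<times> supp C g. if fst p \<star> snd p = zs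
        then f (fst p) \<otimes> g (snd p) else \<zero>)"
    by (rule R.finsum_rdistr[symmetric]) (use c fc fin in auto)
  also have "\<dots> = (c \<odot>\<^bsub>F n\<^esub> (f \<otimes>\<^bsub>F n\<^esub> g)) zs"
    by (simp add: F_simps F_mult_eq[OF f g fin(1) subset_refl fin(2) subset_refl])
  finally show "((c \<odot>\<^bsub>F n\<^esub> f) \<otimes>\<^bsub>F n\<^esub> g) zs = (c \<odot>\<^bsub>F n\<^esub> (f \<otimes>\<^bsub>F n\<^esub> g)) zs" .
qed

lemma F_algebra: "algebra C (F n)"
proof (rule algebraI[OF R_cring F_cring])
qed (auto simp: F_smult_closed F_smult_assoc,
    auto simp: F_simps fin_funsD(1) R.l_distr R.r_distr R.m_assoc intro!: ext)

end

section \<open>Algebra homomorphisms and quotient algebras\<close>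

lemma alg_homI:
  assumes "\<And>x. x \<in> carrier A \<Longrightarrow> h x \<in> carrier B"
    and "\<And>x y. x \<in> carrier A \<Longrightarrow> y \<in> carrier A \<Longrightarrow> h (x \<otimes>\<^bsub>A\<^esub> y) = h x \<otimes>\<^bsub>B\<^esub> h y"
    and "\<And>x y. x \<in> carrier A \<Longrightarrow> y \<in> carrier A \<Longrightarrow> h (x \<oplus>\<^bsub>A\<^esub> y) = h x \<oplus>\<^bsub>B\<^esub> h y"
    and "h \<one>\<^bsub>A\<^esub> = \<one>\<^bsub>B\<^esub>"
    and "\<And>c x. c \<in> carrier C \<Longrightarrow> x \<in> carrier A \<Longrightarrow> h (c \<odot>\<^bsub>A\<^esub> x) = c \<odot>\<^bsub>B\<^esub> h x"
  shows "h \<in> alg_hom C A B"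
  unfolding alg_hom_def using assms by (intro CollectI conjI ballI ring_hom_memI)

lemma alg_homD:
  assumes "h \<in> alg_hom C A B"
  shows "x \<in> carrier A \<Longrightarrow> h x \<in> carrier B"
    and "x \<in> carrier A \<Longrightarrow> y \<in> carrier A \<Longrightarrow> h (x \<otimes>\<^bsub>A\<^esub> y) = h x \<otimes>\<^bsub>B\<^esub> h y"
    and "x \<in> carrier A \<Longrightarrow> y \<in> carrier A \<Longrightarrow> h (x \<oplus>\<^bsub>A\<^esub> y) = h x \<oplus>\<^bsub>B\<^esub> h y"
    and "h \<one>\<^bsub>A\<^esub> = \<one>\<^bsub>B\<^esub>"
    and "c \<in> carrier C \<Longrightarrow> x \<in> carrier A \<Longrightarrow> h (c \<odot>\<^bsub>A\<^esub> x) = c \<odot>\<^bsub>B\<^esub> h x"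
proof -
  have h: "h \<in> ring_hom A B" using assms by (simp add: alg_hom_def)
  show "x \<in> carrier A \<Longrightarrow> h x \<in> carrier B" by (rule ring_hom_memE(1)[OF h])
  show "x \<in> carrier A \<Longrightarrow> y \<in> carrier A \<Longrightarrow> h (x \<otimes>\<^bsub>A\<^esub> y) = h x \<otimes>\<^bsub>B\<^esub> h y"
    by (rule ring_hom_memE(2)[OF h])
  show "x \<in> carrier A \<Longrightarrow> y \<in> carrier A \<Longrightarrow> h (x \<oplus>\<^bsub>A\<^esub> y) = h x \<oplus>\<^bsub>B\<^esub> h y"
    by (rule ring_hom_memE(3)[OF h])
  show "h \<one>\<^bsub>A\<^esub> = \<one>\<^bsub>B\<^esub>" by (rule ring_hom_memE(4)[OF h])
  show "c \<in> carrier C \<Longrightarrow> x \<in> carrier A \<Longrightarrow> h (c \<odot>\<^bsub>A\<^esub> x) = c \<odot>\<^bsub>B\<^esub> h x"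
    using assms unfolding alg_hom_def by blast
qed

lemma alg_hom_zero:
  assumes "algebra C A" "algebra C B" "h \<in> alg_hom C A B"
  shows "h \<zero>\<^bsub>A\<^esub> = \<zero>\<^bsub>B\<^esub>"
proof -
  interpret A: algebra C A by fact
  interpret B: algebra C B by fact
  have "h (\<zero>\<^bsub>C\<^esub> \<odot>\<^bsub>A\<^esub> \<zero>\<^bsub>A\<^esub>) = \<zero>\<^bsub>C\<^esub> \<odot>\<^bsub>B\<^esub> h \<zero>\<^bsub>A\<^esub>"
    by (rule alg_homD(5)[OF assms(3)]) auto
  then show ?thesis using alg_homD(1)[OF assms(3)] by simp
qed

text \<open>The axioms of an algebra speak about three elements at a time, so they can be checked in
  algebras that map to the given structure, as soon as any three elements come from one of them.
  Both quotients and directed unions of quotients are covered.\<close>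

lemma algebraI_locally:
  fixes Q :: "('c, 'q, 'm) module_scheme"
  assumes C: "cring C" and zero: "\<zero>\<^bsub>Q\<^esub> \<in> carrier Q"
    and cover: "\<And>x y z. x \<in> carrier Q \<Longrightarrow> y \<in> carrier Q \<Longrightarrow> z \<in> carrier Q \<Longrightarrow>
      \<exists>(B :: ('c, 'f, 'n) module_scheme) q. algebra C B \<and> q \<in> alg_hom C B Q \<and> q \<zero>\<^bsub>B\<^esub> = \<zero>\<^bsub>Q\<^esub> \<and>
        {x, y, z} \<subseteq> q ` carrier B"
  shows "algebra C Q"
proof -
  have ex: thesis if xyz: "x \<in> carrier Q" "y \<in> carrier Q" "z \<in> carrier Q"
    and goal: "\<And>(B :: ('c, 'f, 'n) module_scheme) q u v w. algebra C B \<Longrightarrow> q \<in> alg_hom C B Q \<Longrightarrow>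
      q \<zero>\<^bsub>B\<^esub> = \<zero>\<^bsub>Q\<^esub> \<Longrightarrow> u \<in> carrier B \<Longrightarrow> v \<in> carrier B \<Longrightarrow> w \<in> carrier B \<Longrightarrow>
      q u = x \<Longrightarrow> q v = y \<Longrightarrow> q w = z \<Longrightarrow> thesis" for x y z thesis
  proof -
    obtain B :: "('c, 'f, 'n) module_scheme" and q
      where "algebra C B" "q \<in> alg_hom C B Q" "q \<zero>\<^bsub>B\<^esub> = \<zero>\<^bsub>Q\<^esub>" "{x, y, z} \<subseteq> q ` carrier B"
      using cover[OF xyz] by blast
    moreover from this(4) have "x \<in> q ` carrier B" "y \<in> q ` carrier B" "z \<in> q ` carrier B"
      by simp_all
    ultimately show thesis by (elim imageE) (rule goal, auto)
  qed
  have one: "\<one>\<^bsub>Q\<^esub> \<in> carrier Q"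
  proof (rule ex[OF zero zero zero])
    fix B :: "('c, 'f, 'n) module_scheme" and q
    assume "algebra C B" and q: "q \<in> alg_hom C B Q"
    interpret B: algebra C B by fact
    show ?thesis using alg_homD(1)[OF q, of "\<one>\<^bsub>B\<^esub>"] by (simp add: alg_homD(4)[OF q])
  qed
  have 3: "x \<otimes>\<^bsub>Q\<^esub> y \<in> carrier Q \<and> x \<oplus>\<^bsub>Q\<^esub> y \<in> carrier Q
      \<and> x \<otimes>\<^bsub>Q\<^esub> y = y \<otimes>\<^bsub>Q\<^esub> x \<and> x \<oplus>\<^bsub>Q\<^esub> y = y \<oplus>\<^bsub>Q\<^esub> x
      \<and> (x \<otimes>\<^bsub>Q\<^esub> y) \<otimes>\<^bsub>Q\<^esub> z = x \<otimes>\<^bsub>Q\<^esub> (y \<otimes>\<^bsub>Q\<^esub> z)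
      \<and> (x \<oplus>\<^bsub>Q\<^esub> y) \<oplus>\<^bsub>Q\<^esub> z = x \<oplus>\<^bsub>Q\<^esub> (y \<oplus>\<^bsub>Q\<^esub> z)
      \<and> (x \<oplus>\<^bsub>Q\<^esub> y) \<otimes>\<^bsub>Q\<^esub> z = x \<otimes>\<^bsub>Q\<^esub> z \<oplus>\<^bsub>Q\<^esub> y \<otimes>\<^bsub>Q\<^esub> z
      \<and> \<one>\<^bsub>Q\<^esub> \<otimes>\<^bsub>Q\<^esub> x = x \<and> \<zero>\<^bsub>Q\<^esub> \<oplus>\<^bsub>Q\<^esub> x = x \<and> (\<exists>y\<in>carrier Q. y \<oplus>\<^bsub>Q\<^esub> x = \<zero>\<^bsub>Q\<^esub>)"
    if "x \<in> carrier Q" "y \<in> carrier Q" "z \<in> carrier Q" for x y z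
  proof (rule ex[OF that])
    fix B :: "('c, 'f, 'n) module_scheme" and q u v w
    assume "algebra C B" and q: "q \<in> alg_hom C B Q" and q0: "q \<zero>\<^bsub>B\<^esub> = \<zero>\<^bsub>Q\<^esub>"
      and uvw: "u \<in> carrier B" "v \<in> carrier B" "w \<in> carrier B"
      and eq: "q u = x" "q v = y" "q w = z"
    interpret B: algebra C B by fact
    note hom = alg_homD(2-3)[OF q, symmetric] alg_homD(4)[OF q, symmetric] q0[symmetric]
    have "q (\<ominus>\<^bsub>B\<^esub> u) \<in> carrier Q" "q (\<ominus>\<^bsub>B\<^esub> u) \<oplus>\<^bsub>Q\<^esub> x = \<zero>\<^bsub>Q\<^esub>"
      using uvw by (simp_all add: eq[symmetric] hom alg_homD(1)[OF q] B.M.l_neg)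
    then have "\<exists>y\<in>carrier Q. y \<oplus>\<^bsub>Q\<^esub> x = \<zero>\<^bsub>Q\<^esub>" by blast
    moreover have "(u \<oplus>\<^bsub>B\<^esub> v) \<otimes>\<^bsub>B\<^esub> w = u \<otimes>\<^bsub>B\<^esub> w \<oplus>\<^bsub>B\<^esub> v \<otimes>\<^bsub>B\<^esub> w"
      using uvw by (intro B.l_distr)
    ultimately show ?thesis
      using uvw unfolding eq[symmetric]
      by (simp add: hom alg_homD(1)[OF q] B.m_ac B.M.a_ac)
  qed
  have 2: "a \<odot>\<^bsub>Q\<^esub> x \<in> carrier Q \<and> (a \<oplus>\<^bsub>C\<^esub> b) \<odot>\<^bsub>Q\<^esub> x = a \<odot>\<^bsub>Q\<^esub> x \<oplus>\<^bsub>Q\<^esub> b \<odot>\<^bsub>Q\<^esub> x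
      \<and> a \<odot>\<^bsub>Q\<^esub> (x \<oplus>\<^bsub>Q\<^esub> y) = a \<odot>\<^bsub>Q\<^esub> x \<oplus>\<^bsub>Q\<^esub> a \<odot>\<^bsub>Q\<^esub> y
      \<and> (a \<otimes>\<^bsub>C\<^esub> b) \<odot>\<^bsub>Q\<^esub> x = a \<odot>\<^bsub>Q\<^esub> (b \<odot>\<^bsub>Q\<^esub> x) \<and> \<one>\<^bsub>C\<^esub> \<odot>\<^bsub>Q\<^esub> x = x
      \<and> (a \<odot>\<^bsub>Q\<^esub> x) \<otimes>\<^bsub>Q\<^esub> y = a \<odot>\<^bsub>Q\<^esub> (x \<otimes>\<^bsub>Q\<^esub> y)"
    if "a \<in> carrier C" "b \<in> carrier C" "x \<in> carrier Q" "y \<in> carrier Q" for a b x y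
  proof (rule ex[OF that(3,4) zero])
    fix B :: "('c, 'f, 'n) module_scheme" and q u v
    assume "algebra C B" and q: "q \<in> alg_hom C B Q"
      and uv: "u \<in> carrier B" "v \<in> carrier B" and eq: "q u = x" "q v = y"
    interpret B: algebra C B by fact
    note hom = alg_homD(2,3,5)[OF q, symmetric]
    show ?thesis
      using uv that(1,2) unfolding eq[symmetric]
      by (auto simp: hom alg_homD(1)[OF q] B.smult_l_distr B.smult_r_distr B.smult_assoc1
          B.smult_assoc2)
  qed
  have bin: "x \<otimes>\<^bsub>Q\<^esub> y \<in> carrier Q" "x \<oplus>\<^bsub>Q\<^esub> y \<in> carrier Q"
      "x \<otimes>\<^bsub>Q\<^esub> y = y \<otimes>\<^bsub>Q\<^esub> x" "x \<oplus>\<^bsub>Q\<^esub> y = y \<oplus>\<^bsub>Q\<^esub> x"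
    if "x \<in> carrier Q" "y \<in> carrier Q" for x y
    using 3[OF that zero] by blast+
  have un: "\<one>\<^bsub>Q\<^esub> \<otimes>\<^bsub>Q\<^esub> x = x" "\<zero>\<^bsub>Q\<^esub> \<oplus>\<^bsub>Q\<^esub> x = x"
      "\<exists>y\<in>carrier Q. y \<oplus>\<^bsub>Q\<^esub> x = \<zero>\<^bsub>Q\<^esub>"
    if "x \<in> carrier Q" for x
    using 3[OF that zero zero] by blast+
  have tern: "(x \<otimes>\<^bsub>Q\<^esub> y) \<otimes>\<^bsub>Q\<^esub> z = x \<otimes>\<^bsub>Q\<^esub> (y \<otimes>\<^bsub>Q\<^esub> z)"
      "(x \<oplus>\<^bsub>Q\<^esub> y) \<oplus>\<^bsub>Q\<^esub> z = x \<oplus>\<^bsub>Q\<^esub> (y \<oplus>\<^bsub>Q\<^esub> z)"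
      "(x \<oplus>\<^bsub>Q\<^esub> y) \<otimes>\<^bsub>Q\<^esub> z = x \<otimes>\<^bsub>Q\<^esub> z \<oplus>\<^bsub>Q\<^esub> y \<otimes>\<^bsub>Q\<^esub> z"
    if "x \<in> carrier Q" "y \<in> carrier Q" "z \<in> carrier Q" for x y z
    using 3[OF that] by blast+
  have "abelian_group Q"
    by (rule abelian_groupI) (fact zero bin un tern)+
  moreover have "comm_monoid Q"
    by (rule comm_monoidI) (fact one bin un tern)+
  ultimately have "cring Q"
    by (rule cringI) (fact tern)
  moreover have "a \<odot>\<^bsub>Q\<^esub> x \<in> carrier Q" "\<one>\<^bsub>C\<^esub> \<odot>\<^bsub>Q\<^esub> x = x"
    if "a \<in> carrier C" "x \<in> carrier Q" for a x
    using 2[OF that(1) that(1) that(2) zero] by blast+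
  moreover have "(a \<oplus>\<^bsub>C\<^esub> b) \<odot>\<^bsub>Q\<^esub> x = a \<odot>\<^bsub>Q\<^esub> x \<oplus>\<^bsub>Q\<^esub> b \<odot>\<^bsub>Q\<^esub> x"
      "(a \<otimes>\<^bsub>C\<^esub> b) \<odot>\<^bsub>Q\<^esub> x = a \<odot>\<^bsub>Q\<^esub> (b \<odot>\<^bsub>Q\<^esub> x)"
    if "a \<in> carrier C" "b \<in> carrier C" "x \<in> carrier Q" for a b x
    using 2[OF that zero] by blast+
  moreover have "a \<odot>\<^bsub>Q\<^esub> (x \<oplus>\<^bsub>Q\<^esub> y) = a \<odot>\<^bsub>Q\<^esub> x \<oplus>\<^bsub>Q\<^esub> a \<odot>\<^bsub>Q\<^esub> y"
      "(a \<odot>\<^bsub>Q\<^esub> x) \<otimes>\<^bsub>Q\<^esub> y = a \<odot>\<^bsub>Q\<^esub> (x \<otimes>\<^bsub>Q\<^esub> y)"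
    if "a \<in> carrier C" "x \<in> carrier Q" "y \<in> carrier Q" for a x y
    using 2[OF that(1) that(1) that(2,3)] by blast+
  moreover have "\<one>\<^bsub>C\<^esub> \<in> carrier C" using C by (rule cring.cring_simprules)
  ultimately show ?thesis
    by (intro algebraI[OF C]) assumption+
qed

text \<open>Scalar multiplication is well defined on cosets because scalars act through multiplication by
  the ring elements \<open>c \<odot> \<one>\<close>, under which ideals are stable.\<close>

lemma quot_algebra:
  fixes B :: "('c, 'x, 'm) module_scheme"
  assumes "algebra C B" "ideal I B"
  shows "algebra C (quot_algebra B I)"
    and "(\<lambda>x. I +>\<^bsub>B\<^esub> x) \<in> alg_hom C B (quot_algebra B I)"
    and "carrier (quot_algebra B I) = (\<lambda>x. I +>\<^bsub>B\<^esub> x) ` carrier B"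
    and "\<zero>\<^bsub>quot_algebra B I\<^esub> = I"
proof -
  interpret algebra C B by fact
  interpret ideal I B by fact
  let ?q = "\<lambda>x. I +>\<^bsub>B\<^esub> x" and ?Q = "quot_algebra B I"
  show carr: "carrier ?Q = ?q ` carrier B"
    by (auto simp: quot_algebra_def FactRing_simps)
  show zero: "\<zero>\<^bsub>?Q\<^esub> = I"
    by (simp add: quot_algebra_def FactRing_def)
  show hom: "?q \<in> alg_hom C B ?Q"
  proof (rule alg_homI)
    fix c x assume c: "c \<in> carrier C" and x: "x \<in> carrier B"
    have same: "?q (c \<odot>\<^bsub>B\<^esub> y) = ?q (c \<odot>\<^bsub>B\<^esub> x)" if y: "y \<in> ?q x" for y
    proof -
      have yB: "y \<in> carrier B"
        using a_r_coset_subset_G[OF a_subset x] y by blast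
      have "?q x = ?q y" using y x by (rule a_repr_independence')
      then have I: "y \<ominus>\<^bsub>B\<^esub> x \<in> I"
        using quotient_eq_iff_same_a_r_cos[OF ideal_axioms yB x] by blast
      have "c \<odot>\<^bsub>B\<^esub> y \<ominus>\<^bsub>B\<^esub> c \<odot>\<^bsub>B\<^esub> x = (c \<odot>\<^bsub>B\<^esub> \<one>\<^bsub>B\<^esub>) \<otimes>\<^bsub>B\<^esub> (y \<ominus>\<^bsub>B\<^esub> x)"
        using c x yB by (simp add: smult_assoc2 a_minus_def smult_r_distr smult_r_minus)
      also have "\<dots> \<in> I" using c by (intro I_l_closed I) auto
      finally show ?thesis
        using quotient_eq_iff_same_a_r_cos[OF ideal_axioms smult_closed[OF c yB] smult_closed[OF c x]]
        by simp
    qed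
    have "x \<in> ?q x" using x by (rule a_rcos_self)
    then have "?q (c \<odot>\<^bsub>B\<^esub> x) = (\<Union>y\<in>?q x. ?q (c \<odot>\<^bsub>B\<^esub> y))"
      using same by blast
    then show "?q (c \<odot>\<^bsub>B\<^esub> x) = c \<odot>\<^bsub>?Q\<^esub> ?q x"
      by (simp add: quot_algebra_def)
  qed (simp_all add: carr, simp_all add: quot_algebra_def FactRing_def rcoset_mult_add a_rcos_sum)
  show "algebra C ?Q"
  proof (rule algebraI_locally[OF R_cring])
    have "I = ?q \<zero>\<^bsub>B\<^esub>"
      by (simp add: a_coset_add_zero[OF a_subset])
    then show "\<zero>\<^bsub>?Q\<^esub> \<in> carrier ?Q" unfolding zero carr by blast
    show "\<exists>(B' :: ('c, 'x, 'm) module_scheme) q. algebra C B' \<and> q \<in> alg_hom C B' ?Q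
        \<and> q \<zero>\<^bsub>B'\<^esub> = \<zero>\<^bsub>?Q\<^esub> \<and> {x, y, z} \<subseteq> q ` carrier B'"
      if "x \<in> carrier ?Q" "y \<in> carrier ?Q" "z \<in> carrier ?Q" for x y z
      using that \<open>algebra C B\<close> hom
      by (intro exI[of _ B] exI[of _ ?q]) (auto simp: carr zero a_coset_add_zero[OF a_subset])
  qed
qed

section \<open>Multilinear maps and the tensor ideal\<close>

definition multilinear ::
  "('c, 'k) ring_scheme \<Rightarrow> ('c, 'a, 'm) module_scheme \<Rightarrow> nat \<Rightarrow> ('c, 'b, 'n) module_scheme \<Rightarrow>
    ('a list \<Rightarrow> 'b) \<Rightarrow> bool"
  where "multilinear C A n M w \<longleftrightarrow> w \<in> tuples A n \<rightarrow> carrier M \<and>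
    (\<forall>xs\<in>tuples A n. \<forall>i<n. \<forall>a\<in>carrier A.
      (\<forall>b\<in>carrier A. w (xs[i := a \<oplus>\<^bsub>A\<^esub> b]) = w (xs[i := a]) \<oplus>\<^bsub>M\<^esub> w (xs[i := b])) \<and>
      (\<forall>c\<in>carrier C. w (xs[i := c \<odot>\<^bsub>A\<^esub> a]) = c \<odot>\<^bsub>M\<^esub> w (xs[i := a])))"

lemma multilinearI:
  assumes "\<And>xs. xs \<in> tuples A n \<Longrightarrow> w xs \<in> carrier M"
    and "\<And>xs i a b. xs \<in> tuples A n \<Longrightarrow> i < n \<Longrightarrow> a \<in> carrier A \<Longrightarrow> b \<in> carrier A \<Longrightarrow>
      w (xs[i := a \<oplus>\<^bsub>A\<^esub> b]) = w (xs[i := a]) \<oplus>\<^bsub>M\<^esub> w (xs[i := b])"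
    and "\<And>xs i c a. xs \<in> tuples A n \<Longrightarrow> i < n \<Longrightarrow> c \<in> carrier C \<Longrightarrow> a \<in> carrier A \<Longrightarrow>
      w (xs[i := c \<odot>\<^bsub>A\<^esub> a]) = c \<odot>\<^bsub>M\<^esub> w (xs[i := a])"
  shows "multilinear C A n M w"
  unfolding multilinear_def
  by (intro conjI ballI allI impI funcsetI assms)

lemma multilinearD:
  assumes "multilinear C A n M w" "xs \<in> tuples A n"
  shows "w xs \<in> carrier M"
    and "i < n \<Longrightarrow> a \<in> carrier A \<Longrightarrow> b \<in> carrier A \<Longrightarrow>
      w (xs[i := a \<oplus>\<^bsub>A\<^esub> b]) = w (xs[i := a]) \<oplus>\<^bsub>M\<^esub> w (xs[i := b])"
    and "i < n \<Longrightarrow> c \<in> carrier C \<Longrightarrow> a \<in> carrier A \<Longrightarrow>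
      w (xs[i := c \<odot>\<^bsub>A\<^esub> a]) = c \<odot>\<^bsub>M\<^esub> w (xs[i := a])"
  using assms unfolding multilinear_def by blast+

context tensor_powers
begin

lemma lin_ext_F_add:
  assumes "module C M" "w \<in> tuples A n \<rightarrow> carrier M" "f \<in> carrier (F n)" "g \<in> carrier (F n)"
  shows "lin_ext C M w (f \<oplus>\<^bsub>F n\<^esub> g) = lin_ext C M w f \<oplus>\<^bsub>M\<^esub> lin_ext C M w g"
  using assms module.lin_ext_add[of C M f "tuples A n" g w] by (simp add: F_simps)

lemma lin_ext_F_smult:
  assumes "module C M" "w \<in> tuples A n \<rightarrow> carrier M" "c \<in> carrier C" "f \<in> carrier (F n)"
  shows "lin_ext C M w (c \<odot>\<^bsub>F n\<^esub> f) = c \<odot>\<^bsub>M\<^esub> lin_ext C M w f"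
  using assms module.lin_ext_smult[of C M c f "tuples A n" w] by (simp add: F_simps)

lemma lin_ext_F_mult_basis:
  assumes "module C M" "w \<in> tuples A n \<rightarrow> carrier M" "f \<in> carrier (F n)" "xs \<in> tuples A n"
  shows "lin_ext C M w (e xs \<otimes>\<^bsub>F n\<^esub> f) = lin_ext C M (\<lambda>ys. w (xs \<star> ys)) f"
proof (rule lin_ext_unique[OF \<open>module C M\<close>])
  interpret M: module C M by fact
  show "f \<in> fin_funs C (tuples A n)" using assms by (simp add: F_simps)
  show "(\<lambda>ys. w (xs \<star> ys)) \<in> tuples A n \<rightarrow> carrier M"
    using assms by (auto simp: Pi_iff intro!: tuple_mult_closed)
  have e: "e xs \<in> carrier (F n)" using assms by (intro e_closed)
  show "lin_ext C M w (e xs \<otimes>\<^bsub>F n\<^esub> (\<lambda>_. \<zero>)) = \<zero>\<^bsub>M\<^esub>"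
    using F_r_null[OF e] by (simp add: F_simps M.lin_ext_zero)
  show "lin_ext C M w (e xs \<otimes>\<^bsub>F n\<^esub> (\<lambda>ys. c \<otimes> e zs ys)) = c \<odot>\<^bsub>M\<^esub> w (xs \<star> zs)"
    if "c \<in> carrier C" "zs \<in> tuples A n" for c zs
  proof -
    have "e xs \<otimes>\<^bsub>F n\<^esub> (\<lambda>ys. c \<otimes> e zs ys) = (\<lambda>ys. c \<otimes> e (xs \<star> zs) ys)"
      using F_single_mult[of \<one> c xs n zs] F_single_one[of xs n] that assms
      by (simp add: F_simps)
    then show ?thesis
      using that assms M.lin_ext_single[of c w "xs \<star> zs"] tuple_mult_closed
      by (simp add: Pi_iff)
  qed
  show "lin_ext C M w (e xs \<otimes>\<^bsub>F n\<^esub> (\<lambda>x. f x \<oplus> g x))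
      = lin_ext C M w (e xs \<otimes>\<^bsub>F n\<^esub> f) \<oplus>\<^bsub>M\<^esub> lin_ext C M w (e xs \<otimes>\<^bsub>F n\<^esub> g)"
    if "f \<in> fin_funs C (tuples A n)" "g \<in> fin_funs C (tuples A n)" for f g
    using F_r_distr[of "e xs" n f g] that e F_mult_closed assms(2) M.lin_ext_add[where X = "tuples A n"]
    by (simp add: F_simps)
qed

lemma lin_ext_F_mult_zero:
  assumes "module C M" "w \<in> tuples A n \<rightarrow> carrier M" "f \<in> carrier (F n)" "g \<in> carrier (F n)"
    and zero: "\<And>xs. xs \<in> tuples A n \<Longrightarrow> lin_ext C M (\<lambda>ys. w (xs \<star> ys)) f = \<zero>\<^bsub>M\<^esub>"
  shows "lin_ext C M w (g \<otimes>\<^bsub>F n\<^esub> f) = \<zero>\<^bsub>M\<^esub>"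
proof -
  interpret M: module C M by fact
  show ?thesis
    using \<open>g \<in> carrier (F n)\<close>
  proof (induction rule: F_induct)
    case zero
    show ?case using F_l_null[OF \<open>f \<in> carrier (F n)\<close>] by (simp add: F_simps M.lin_ext_zero)
  next
    case (single c xs)
    then have "lin_ext C M w ((c \<odot>\<^bsub>F n\<^esub> e xs) \<otimes>\<^bsub>F n\<^esub> f) = c \<odot>\<^bsub>M\<^esub> lin_ext C M w (e xs \<otimes>\<^bsub>F n\<^esub> f)"
      using assms(1-3) F_mult_closed[OF e_closed \<open>f \<in> carrier (F n)\<close>]
      by (simp add: F_smult_assoc e_closed lin_ext_F_smult)
    then show ?case
      using assms single by (simp add: lin_ext_F_mult_basis)
  next
    case (add g h)
    then show ?case
      using assms(1-3) by (simp add: F_l_distr F_mult_closed lin_ext_F_add)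
  qed
qed

lemma lin_ext_F_uminus:
  assumes "module C M" "w \<in> tuples A n \<rightarrow> carrier M" "f \<in> carrier (F n)"
  shows "lin_ext C M w (\<ominus>\<^bsub>F n\<^esub> f) = \<ominus>\<^bsub>M\<^esub> lin_ext C M w f"
proof -
  interpret M: module C M by fact
  interpret F: algebra C "F n" by (rule F_algebra)
  have "\<ominus>\<^bsub>F n\<^esub> f = (\<ominus> \<one>) \<odot>\<^bsub>F n\<^esub> f"
    using assms by (simp add: F.smult_l_minus)
  moreover have "lin_ext C M w f \<in> carrier M"
    using assms by (intro M.lin_ext_closed[where X = "tuples A n"]) (auto simp: F_simps)
  ultimately show ?thesis
    using assms by (simp add: lin_ext_F_smult M.smult_l_minus)
qed

lemma lin_ext_F_minus:
  assumes "module C M" "w \<in> tuples A n \<rightarrow> carrier M" "f \<in> carrier (F n)" "g \<in> carrier (F n)"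
  shows "lin_ext C M w (f \<ominus>\<^bsub>F n\<^esub> g) = lin_ext C M w f \<ominus>\<^bsub>M\<^esub> lin_ext C M w g"
proof -
  interpret F: algebra C "F n" by (rule F_algebra)
  show ?thesis
    using assms by (simp add: a_minus_def lin_ext_F_add lin_ext_F_uminus)
qed

lemma tuples_update: "xs \<in> tuples A n \<Longrightarrow> a \<in> carrier A \<Longrightarrow> xs[i := a] \<in> tuples A n"
  unfolding tuples_def using set_update_subset_insert[of xs i a] by auto

lemma multilinear_rels_closed: "multilinear_rels C A n \<subseteq> carrier (F n)"
proof -
  interpret F: algebra C "F n" by (rule F_algebra)
  show ?thesis
    unfolding multilinear_rels_def Let_def
    by (intro subsetI, elim UnE CollectE exE conjE)
      (simp_all add: e_closed tuples_update)
qed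

lemma tensor_ideal: "ideal (tensor_ideal C A n) (F n)"
proof -
  interpret F: algebra C "F n" by (rule F_algebra)
  show ?thesis
    unfolding tensor_ideal_def by (rule F.genideal_ideal[OF multilinear_rels_closed])
qed

lemma tensor_ideal_closed: "f \<in> tensor_ideal C A n \<Longrightarrow> f \<in> carrier (F n)"
  by (rule ideal.Icarr[OF tensor_ideal])

lemma multilinear_rels_kernel:
  assumes "module C M" "multilinear C A n M w" "f \<in> multilinear_rels C A n"
  shows "lin_ext C M w f = \<zero>\<^bsub>M\<^esub>"
proof -
  interpret M: module C M by fact
  interpret F: algebra C "F n" by (rule F_algebra)
  have w: "w \<in> tuples A n \<rightarrow> carrier M" using assms(2) by (simp add: multilinear_def)
  have e: "lin_ext C M w (e xs) = w xs" if "xs \<in> tuples A n" for xs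
    using that w by (simp add: M.lin_ext_basis Pi_iff)
  note lin = lin_ext_F_minus[OF \<open>module C M\<close> w] e_closed tuples_update e
    lin_ext_F_add[OF \<open>module C M\<close> w] lin_ext_F_smult[OF \<open>module C M\<close> w]
  have cl: "w xs \<in> carrier M" if "xs \<in> tuples A n" for xs using w that by auto
  consider (add) xs i a b where "xs \<in> tuples A n" "i < n" "a \<in> carrier A" "b \<in> carrier A"
      "f = e (xs[i := a \<oplus>\<^bsub>A\<^esub> b]) \<ominus>\<^bsub>F n\<^esub> (e (xs[i := a]) \<oplus>\<^bsub>F n\<^esub> e (xs[i := b]))"
    | (smult) xs i c a where "xs \<in> tuples A n" "i < n" "c \<in> carrier C" "a \<in> carrier A"
      "f = e (xs[i := c \<odot>\<^bsub>A\<^esub> a]) \<ominus>\<^bsub>F n\<^esub> (c \<odot>\<^bsub>F n\<^esub> e (xs[i := a]))"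
    using assms(3) unfolding multilinear_rels_def Let_def by blast
  then show ?thesis
  proof cases
    case add
    then show ?thesis
      using multilinearD(2)[OF assms(2)] cl[OF tuples_update[of xs n]]
      by (simp add: lin M.minus_eq M.r_neg)
  next
    case smult
    then show ?thesis
      using multilinearD(3)[OF assms(2)] cl[OF tuples_update[of xs n]]
      by (simp add: lin M.minus_eq M.r_neg)
  qed
qed

text \<open>Multiplication by a fixed tuple acts linearly on each entry.\<close>

lemma multilinear_translate:
  assumes w: "multilinear C A n M w" and xs: "xs \<in> tuples A n"
  shows "multilinear C A n M (\<lambda>ys. w (xs \<star> ys))"
proof -
  have upd: "xs \<star> ys[i := a] = (xs \<star> ys)[i := xs ! i \<otimes>\<^bsub>A\<^esub> a]"
    if "ys \<in> tuples A n" "i < n" for ys i a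
    using that xs by (intro nth_equalityI) (auto simp: tuples_iff nth_list_update)
  have "xs ! i \<in> carrier A" if "i < n" for i using xs that by (auto simp: tuples_iff)
  moreover have "a \<otimes>\<^bsub>A\<^esub> (c \<odot>\<^bsub>A\<^esub> b) = c \<odot>\<^bsub>A\<^esub> (a \<otimes>\<^bsub>A\<^esub> b)"
    if "a \<in> carrier A" "b \<in> carrier A" "c \<in> carrier C" for a b c
    using that smult_assoc2[of c b a] by (simp add: m_comm)
  ultimately show ?thesis
    using xs w
    by (intro multilinearI)
      (auto simp: upd r_distr multilinearD(2,3)[OF w] tuple_mult_closed intro!: multilinearD(1)[OF w])
qed

text \<open>The functions whose multiples are all killed by \<open>w\<close> form an ideal, and this ideal contains the
  relations because each translate of \<open>w\<close> is multilinear, too. This is the part of the universal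
  property of the tensor power that says that \<open>w\<close> factors through it.\<close>

lemma tensor_ideal_kernel:
  assumes M: "module C M" and w: "multilinear C A n M w" and f: "f \<in> tensor_ideal C A n"
  shows "lin_ext C M w f = \<zero>\<^bsub>M\<^esub>"
proof -
  interpret M: module C M by fact
  interpret F: algebra C "F n" by (rule F_algebra)
  let ?t = "\<lambda>xs ys. w (xs \<star> ys)"
  let ?K = "{f \<in> carrier (F n). \<forall>xs\<in>tuples A n. lin_ext C M (?t xs) f = \<zero>\<^bsub>M\<^esub>}"
  have t: "?t xs \<in> tuples A n \<rightarrow> carrier M" if "xs \<in> tuples A n" for xs
    using multilinear_translate[OF w that] by (simp add: multilinear_def)
  have mult: "lin_ext C M (?t xs) (g \<otimes>\<^bsub>F n\<^esub> f) = \<zero>\<^bsub>M\<^esub>"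
    if "f \<in> ?K" "g \<in> carrier (F n)" "xs \<in> tuples A n" for f g xs
  proof (rule lin_ext_F_mult_zero[OF M t])
    fix ys assume ys: "ys \<in> tuples A n"
    have "lin_ext C M (\<lambda>zs. ?t xs (ys \<star> zs)) f = lin_ext C M (?t (xs \<star> ys)) f"
      by (rule M.lin_ext_cong[of _ "tuples A n"])
        (use that ys t[OF tuple_mult_closed, of xs ys] in \<open>auto simp: F_simps tuple_mult_assoc\<close>)
    then show "lin_ext C M (\<lambda>zs. ?t xs (ys \<star> zs)) f = \<zero>\<^bsub>M\<^esub>"
      using that ys by (simp add: tuple_mult_closed)
  qed (use that in auto)
  have "ideal ?K (F n)"
  proof (rule idealI)
    show "ring (F n)" by (rule F.ring_axioms)
    show "subgroup ?K (add_monoid (F n))"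
    proof (rule F.add.subgroupI)
      show "?K \<noteq> {}"
        using F.M.zero_closed M.lin_ext_zero by (auto simp: F_simps)
      show "\<ominus>\<^bsub>F n\<^esub> f \<in> ?K" if "f \<in> ?K" for f
        using that lin_ext_F_uminus[OF M t] by auto
      show "f \<oplus>\<^bsub>F n\<^esub> g \<in> ?K" if "f \<in> ?K" "g \<in> ?K" for f g
        using that lin_ext_F_add[OF M t] by auto
    qed auto
    show "g \<otimes>\<^bsub>F n\<^esub> f \<in> ?K" if "f \<in> ?K" "g \<in> carrier (F n)" for f g
      using mult[OF that] that by auto
    then show "f \<otimes>\<^bsub>F n\<^esub> g \<in> ?K" if "f \<in> ?K" "g \<in> carrier (F n)" for f g
      using that F.m_comm[of f g] by auto
  qed
  moreover have "multilinear_rels C A n \<subseteq> ?K"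
    using multilinear_rels_closed multilinear_rels_kernel[OF M multilinear_translate[OF w]] by blast
  ultimately have "f \<in> ?K"
    using f F.genideal_minimal unfolding tensor_ideal_def by blast
  then have "lin_ext C M (?t (replicate n \<one>\<^bsub>A\<^esub>)) f = \<zero>\<^bsub>M\<^esub>"
    using one_tuple by blast
  moreover have "lin_ext C M (?t (replicate n \<one>\<^bsub>A\<^esub>)) f = lin_ext C M w f"
    by (rule M.lin_ext_cong[of _ "tuples A n"])
      (use \<open>f \<in> ?K\<close> w in \<open>auto simp: F_simps tuple_mult_one multilinear_def\<close>)
  ultimately show ?thesis by simp
qed

end

section \<open>Tensor powers and their transition maps\<close>

lemma transit_shift: "transit \<tau> (Suc m) d (\<tau> m x) = transit \<tau> m (Suc d) x"
  by (induction d) auto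

context tensor_powers
begin

abbreviation cls :: "nat \<Rightarrow> ('a list \<Rightarrow> 'c) \<Rightarrow> ('a list \<Rightarrow> 'c) set"
  where "cls n f \<equiv> tensor_ideal C A n +>\<^bsub>F n\<^esub> f"

lemma T_algebra: "algebra C (T n)"
  unfolding tensor_power_def by (rule quot_algebra[OF F_algebra tensor_ideal])

lemma T_module: "module C (T n)"
  by (rule algebra.module[OF T_algebra])

lemma cls_hom: "cls n \<in> alg_hom C (F n) (T n)"
  unfolding tensor_power_def by (rule quot_algebra[OF F_algebra tensor_ideal])

lemma carrier_T: "carrier (T n) = cls n ` carrier (F n)"
  unfolding tensor_power_def by (rule quot_algebra[OF F_algebra tensor_ideal])

lemma cls_eq_iff:
  assumes "f \<in> carrier (F n)" "g \<in> carrier (F n)"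
  shows "cls n f = cls n g \<longleftrightarrow> f \<ominus>\<^bsub>F n\<^esub> g \<in> tensor_ideal C A n"
proof -
  interpret F: algebra C "F n" by (rule F_algebra)
  show ?thesis using F.quotient_eq_iff_same_a_r_cos[OF tensor_ideal assms] by blast
qed

lemma cls_eq_zero_iff:
  assumes "f \<in> carrier (F n)"
  shows "cls n f = \<zero>\<^bsub>T n\<^esub> \<longleftrightarrow> f \<in> tensor_ideal C A n"
proof -
  interpret F: algebra C "F n" by (rule F_algebra)
  have "cls n f = \<zero>\<^bsub>T n\<^esub> \<longleftrightarrow> cls n f = cls n \<zero>\<^bsub>F n\<^esub>"
    by (simp add: alg_hom_zero[OF F_algebra T_algebra cls_hom])
  then show ?thesis using assms by (simp add: cls_eq_iff F.minus_eq)
qed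

lemma pure_tensor_eq: "xs \<in> tuples A n \<Longrightarrow> pure_tensor C A xs = cls n (e xs)"
  by (auto simp: pure_tensor_def tuples_def)

lemma pure_tensor_closed: "xs \<in> tuples A n \<Longrightarrow> pure_tensor C A xs \<in> carrier (T n)"
  by (simp add: pure_tensor_eq alg_homD(1)[OF cls_hom] e_closed)

lemma pure_tensor_mult:
  assumes "xs \<in> tuples A n" "ys \<in> tuples A n"
  shows "pure_tensor C A xs \<otimes>\<^bsub>T n\<^esub> pure_tensor C A ys = pure_tensor C A (xs \<star> ys)"
proof -
  have "e xs \<otimes>\<^bsub>F n\<^esub> e ys = e (xs \<star> ys)"
    using F_single_mult[of \<one> \<one> xs n ys] assms by (simp add: F_single_one tuple_mult_closed)
  then show ?thesis
    using assms alg_homD(2)[OF cls_hom e_closed e_closed, of xs n ys]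
    by (simp add: pure_tensor_eq[where n = n] tuple_mult_closed)
qed

lemma pure_tensor_one: "pure_tensor C A (replicate n \<one>\<^bsub>A\<^esub>) = \<one>\<^bsub>T n\<^esub>"
  using alg_homD(4)[OF cls_hom, of n] by (simp add: pure_tensor_eq[OF one_tuple] F_simps(2))

lemma pure_tensor_multilinear: "multilinear C A n (T n) (pure_tensor C A)"
proof (rule multilinearI)
  interpret F: algebra C "F n" by (rule F_algebra)
  have rel: "f \<in> multilinear_rels C A n \<Longrightarrow> f \<in> tensor_ideal C A n" for f
    unfolding tensor_ideal_def using F.genideal_self[OF multilinear_rels_closed] by blast
  fix xs i a assume xs: "xs \<in> tuples A n" and i: "i < n" and a: "a \<in> carrier A"
  note cl = e_closed[OF tuples_update[OF xs]]
  show "pure_tensor C A (xs[i := a \<oplus>\<^bsub>A\<^esub> b])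
      = pure_tensor C A (xs[i := a]) \<oplus>\<^bsub>T n\<^esub> pure_tensor C A (xs[i := b])" if b: "b \<in> carrier A" for b
  proof -
    have "e (xs[i := a \<oplus>\<^bsub>A\<^esub> b]) \<ominus>\<^bsub>F n\<^esub> (e (xs[i := a]) \<oplus>\<^bsub>F n\<^esub> e (xs[i := b])) \<in> tensor_ideal C A n"
      using xs i a b by (intro rel) (auto simp: multilinear_rels_def Let_def)
    then have "cls n (e (xs[i := a \<oplus>\<^bsub>A\<^esub> b])) = cls n (e (xs[i := a]) \<oplus>\<^bsub>F n\<^esub> e (xs[i := b]))"
      using a b cl by (simp add: cls_eq_iff)
    then show ?thesis
      using xs a b cl by (simp add: pure_tensor_eq[where n = n] tuples_update alg_homD(3)[OF cls_hom])
  qed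
  show "pure_tensor C A (xs[i := c \<odot>\<^bsub>A\<^esub> a]) = c \<odot>\<^bsub>T n\<^esub> pure_tensor C A (xs[i := a])"
    if c: "c \<in> carrier C" for c
  proof -
    have "e (xs[i := c \<odot>\<^bsub>A\<^esub> a]) \<ominus>\<^bsub>F n\<^esub> (c \<odot>\<^bsub>F n\<^esub> e (xs[i := a])) \<in> tensor_ideal C A n"
      using xs i a c by (intro rel) (auto simp: multilinear_rels_def Let_def)
    then have "cls n (e (xs[i := c \<odot>\<^bsub>A\<^esub> a])) = cls n (c \<odot>\<^bsub>F n\<^esub> e (xs[i := a]))"
      using a c cl by (simp add: cls_eq_iff)
    then show ?thesis
      using xs a c cl by (simp add: pure_tensor_eq[where n = n] tuples_update alg_homD(5)[OF cls_hom])
  qed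
qed (rule pure_tensor_closed)

lemma lin_ext_linear:
  assumes "module C M" "f \<in> carrier (F n)" "w \<in> tuples A n \<rightarrow> carrier M"
    and closed: "\<And>f. f \<in> carrier (F n) \<Longrightarrow> h f \<in> carrier M"
    and add: "\<And>f g. f \<in> carrier (F n) \<Longrightarrow> g \<in> carrier (F n) \<Longrightarrow> h (f \<oplus>\<^bsub>F n\<^esub> g) = h f \<oplus>\<^bsub>M\<^esub> h g"
    and smult: "\<And>c f. c \<in> carrier C \<Longrightarrow> f \<in> carrier (F n) \<Longrightarrow> h (c \<odot>\<^bsub>F n\<^esub> f) = c \<odot>\<^bsub>M\<^esub> h f"
    and basis: "\<And>xs. xs \<in> tuples A n \<Longrightarrow> h (e xs) = w xs"
  shows "h f = lin_ext C M w f"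
proof (rule lin_ext_unique[where X = "tuples A n"])
  interpret M: module C M by fact
  interpret F: algebra C "F n" by (rule F_algebra)
  show "module C M" by fact
  show "f \<in> fin_funs C (tuples A n)" using assms(2) by (simp add: F_simps)
  show "w \<in> tuples A n \<rightarrow> carrier M" by fact
  show "h (\<lambda>_. \<zero>) = \<zero>\<^bsub>M\<^esub>"
  proof -
    have "\<zero> \<odot>\<^bsub>F n\<^esub> \<zero>\<^bsub>F n\<^esub> = \<zero>\<^bsub>F n\<^esub>" by simp
    then have "h \<zero>\<^bsub>F n\<^esub> = \<zero>\<^bsub>M\<^esub>"
      using smult[of \<zero> "\<zero>\<^bsub>F n\<^esub>"] closed[of "\<zero>\<^bsub>F n\<^esub>"] by simp
    then show ?thesis by (simp only: F_simps(3))
  qed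
  show "h (\<lambda>ys. c \<otimes> e xs ys) = c \<odot>\<^bsub>M\<^esub> w xs" if "c \<in> carrier C" "xs \<in> tuples A n" for c xs
    using smult[OF that(1) e_closed[OF that(2)]] basis[OF that(2)] by (simp add: F_simps(5))
  show "h (\<lambda>x. f x \<oplus> g x) = h f \<oplus>\<^bsub>M\<^esub> h g"
    if "f \<in> fin_funs C (tuples A n)" "g \<in> fin_funs C (tuples A n)" for f g
    using add[of f g] that by (simp add: F_simps)
qed

lemma lin_ext_pure_tensor:
  "f \<in> carrier (F n) \<Longrightarrow> lin_ext C (T n) (pure_tensor C A) f = cls n f"
  by (rule lin_ext_linear[OF T_module, symmetric])
    (auto simp: alg_homD[OF cls_hom] pure_tensor_eq e_closed)

lemma append_one_linear:
  shows "append_one C A (f \<oplus>\<^bsub>F n\<^esub> g) = append_one C A f \<oplus>\<^bsub>F (Suc n)\<^esub> append_one C A g"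
    and "c \<in> carrier C \<Longrightarrow> append_one C A (c \<odot>\<^bsub>F n\<^esub> f) = c \<odot>\<^bsub>F (Suc n)\<^esub> append_one C A f"
  by (auto simp: append_one_def F_simps)

lemma append_one_basis: "append_one C A (e xs) = e (xs @ [\<one>\<^bsub>A\<^esub>])"
proof
  fix ys
  show "append_one C A (e xs) ys = e (xs @ [\<one>\<^bsub>A\<^esub>]) ys"
    by (cases ys rule: rev_cases) (auto simp: append_one_def basis_elt_def)
qed

lemma tuples_append_one: "xs \<in> tuples A n \<Longrightarrow> xs @ [\<one>\<^bsub>A\<^esub>] \<in> tuples A (Suc n)"
  by (auto simp: tuples_def)

lemma append_one_closed: "f \<in> carrier (F n) \<Longrightarrow> append_one C A f \<in> carrier (F (Suc n))"
proof (induction rule: F_induct)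
  case zero
  have "append_one C A \<zero>\<^bsub>F n\<^esub> = \<zero>\<^bsub>F (Suc n)\<^esub>"
    by (auto simp: append_one_def F_simps)
  then show ?case by (simp add: F_simps R.fin_funs_zero)
next
  case (single c xs)
  then show ?case
    using F_smult_closed[OF _ e_closed[OF tuples_append_one]]
    by (simp add: append_one_linear append_one_basis)
next
  case (add f g)
  then show ?case by (simp add: append_one_linear F_add_closed)
qed

lemma append_one_hom: "append_one C A \<in> alg_hom C (F n) (F (Suc n))"
proof (rule alg_homI)
  interpret F: algebra C "F n" by (rule F_algebra)
  interpret F': algebra C "F (Suc n)" by (rule F_algebra)
  have append_zero: "append_one C A \<zero>\<^bsub>F n\<^esub> = \<zero>\<^bsub>F (Suc n)\<^esub>"
    by (auto simp: append_one_def F_simps)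
  show "append_one C A (f \<otimes>\<^bsub>F n\<^esub> g) = append_one C A f \<otimes>\<^bsub>F (Suc n)\<^esub> append_one C A g"
    if "f \<in> carrier (F n)" "g \<in> carrier (F n)" for f g
    using that(1)
  proof (induction rule: F_induct)
    case zero
    then show ?case using that(2) by (simp add: append_zero append_one_closed)
  next
    case (add f f')
    then show ?case using that(2) by (simp add: append_one_linear append_one_closed F.l_distr F'.l_distr)
  next
    case f: (single c xs)
    then have fc: "c \<odot>\<^bsub>F n\<^esub> e xs \<in> carrier (F n)" by (intro F_smult_closed e_closed)
    show ?case
      using that(2)
    proof (induction rule: F_induct)
      case zero
      then show ?case using fc by (simp add: append_zero append_one_closed)
    next
      case (add g g')
      then show ?case using fc by (simp add: append_one_linear append_one_closed F.r_distr F'.r_distr)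
    next
      case (single d ys)
      then have "(xs @ [\<one>\<^bsub>A\<^esub>]) \<star> (ys @ [\<one>\<^bsub>A\<^esub>]) = xs \<star> ys @ [\<one>\<^bsub>A\<^esub>]"
        using f by (simp add: tuples_def)
      then show ?case
        using f single
        by (simp add: F_single_mult append_one_linear append_one_basis tuples_append_one)
    qed
  qed
  show "append_one C A \<one>\<^bsub>F n\<^esub> = \<one>\<^bsub>F (Suc n)\<^esub>"
    by (simp add: F_simps append_one_basis replicate_append_same)
qed (simp_all add: append_one_linear append_one_closed)

text \<open>Modulo the ideal, \<^const>\<open>append_one\<close> is the linear extension of the multilinear map
  \<open>xs \<mapsto> xs @ [\<one>]\<close>, so that the universal property of the tensor power applies.\<close>

lemma append_one_tensor_ideal:
  assumes f: "f \<in> tensor_ideal C A n"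
  shows "append_one C A f \<in> tensor_ideal C A (Suc n)"
proof -
  let ?w = "\<lambda>xs. pure_tensor C A (xs @ [\<one>\<^bsub>A\<^esub>])"
  have fc: "f \<in> carrier (F n)" using f by (rule tensor_ideal_closed)
  have "multilinear C A n (T (Suc n)) ?w"
  proof (rule multilinearI)
    fix xs i a assume xs: "xs \<in> tuples A n" and i: "i < n" and a: "a \<in> carrier A"
    note xs' = tuples_append_one[OF xs] and len = xs[unfolded tuples_def]
    have upd: "xs[i := b] @ [\<one>\<^bsub>A\<^esub>] = (xs @ [\<one>\<^bsub>A\<^esub>])[i := b]" for b
      using i len by (simp add: list_update_append)
    show "?w (xs[i := a \<oplus>\<^bsub>A\<^esub> b]) = ?w (xs[i := a]) \<oplus>\<^bsub>T (Suc n)\<^esub> ?w (xs[i := b])"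
      if "b \<in> carrier A" for b
      unfolding upd by (rule multilinearD(2)[OF pure_tensor_multilinear xs']) (use i a that in auto)
    show "?w (xs[i := c \<odot>\<^bsub>A\<^esub> a]) = c \<odot>\<^bsub>T (Suc n)\<^esub> ?w (xs[i := a])"
      if "c \<in> carrier C" for c
      unfolding upd by (rule multilinearD(3)[OF pure_tensor_multilinear xs']) (use i a that in auto)
  qed (intro pure_tensor_closed tuples_append_one)
  from tensor_ideal_kernel[OF T_module this f]
  have "lin_ext C (T (Suc n)) ?w f = \<zero>\<^bsub>T (Suc n)\<^esub>" .
  moreover have "cls (Suc n) (append_one C A f) = lin_ext C (T (Suc n)) ?w f"
    by (rule lin_ext_linear[OF T_module fc])
      (auto simp: alg_homD[OF cls_hom] append_one_closed append_one_linear append_one_basis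
        pure_tensor_eq[OF tuples_append_one] e_closed tuples_append_one)
  ultimately show ?thesis using cls_eq_zero_iff[OF append_one_closed[OF fc]] by simp
qed

lemma tensor_one_cls:
  assumes f: "f \<in> carrier (F n)"
  shows "tensor_one C A n (cls n f) = cls (Suc n) (append_one C A f)"
proof -
  interpret F: algebra C "F n" by (rule F_algebra)
  interpret F': algebra C "F (Suc n)" by (rule F_algebra)
  interpret I: ideal "tensor_ideal C A n" "F n" by (rule tensor_ideal)
  have "cls (Suc n) (append_one C A g) = cls (Suc n) (append_one C A f)" if g: "g \<in> cls n f" for g
  proof -
    have gc: "g \<in> carrier (F n)" using F.a_r_coset_subset_G[OF I.a_subset f] g by blast
    have "cls n f = cls n g" using g f by (rule I.a_repr_independence')
    then have "append_one C A (g \<ominus>\<^bsub>F n\<^esub> f) \<in> tensor_ideal C A (Suc n)"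
      using cls_eq_iff[OF gc f] by (intro append_one_tensor_ideal) simp
    moreover have "\<ominus>\<^bsub>F n\<^esub> f = (\<ominus> \<one>) \<odot>\<^bsub>F n\<^esub> f"
      using f by (simp add: F.smult_l_minus)
    then have "append_one C A (g \<ominus>\<^bsub>F n\<^esub> f) = append_one C A g \<ominus>\<^bsub>F (Suc n)\<^esub> append_one C A f"
      using append_one_closed[OF f]
      by (simp add: F.minus_eq F'.minus_eq append_one_linear F'.smult_l_minus)
    ultimately show ?thesis using cls_eq_iff f gc append_one_closed by simp
  qed
  moreover have "f \<in> cls n f" using f by (rule I.a_rcos_self)
  ultimately have "(\<Union>g\<in>cls n f. cls (Suc n) (append_one C A g)) = cls (Suc n) (append_one C A f)"
    by blast
  then show ?thesis by (simp only: tensor_one_def)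
qed

lemma tensor_one_hom: "tensor_one C A n \<in> alg_hom C (T n) (T (Suc n))"
proof (rule alg_homI)
  interpret F: algebra C "F n" by (rule F_algebra)
  note h = alg_homD[OF cls_hom] and h1 = alg_homD[OF append_one_hom]
  show "tensor_one C A n \<one>\<^bsub>T n\<^esub> = \<one>\<^bsub>T (Suc n)\<^esub>"
    by (simp add: h(4)[symmetric] tensor_one_cls h1(4))
  fix x assume "x \<in> carrier (T n)"
  then obtain f where f: "f \<in> carrier (F n)" "x = cls n f" by (auto simp: carrier_T)
  show "tensor_one C A n x \<in> carrier (T (Suc n))"
    using f by (simp add: tensor_one_cls h(1) append_one_closed)
  show "tensor_one C A n (c \<odot>\<^bsub>T n\<^esub> x) = c \<odot>\<^bsub>T (Suc n)\<^esub> tensor_one C A n x"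
    if "c \<in> carrier C" for c
  proof -
    have "tensor_one C A n (c \<odot>\<^bsub>T n\<^esub> x) = cls (Suc n) (append_one C A (c \<odot>\<^bsub>F n\<^esub> f))"
      using f that by (simp add: h(5)[symmetric] tensor_one_cls)
    then show ?thesis using f that by (simp add: tensor_one_cls append_one_closed h1(5) h(5))
  qed
  fix y assume "y \<in> carrier (T n)"
  then obtain g where g: "g \<in> carrier (F n)" "y = cls n g" by (auto simp: carrier_T)
  have "tensor_one C A n (x \<otimes>\<^bsub>T n\<^esub> y) = cls (Suc n) (append_one C A (f \<otimes>\<^bsub>F n\<^esub> g))"
    using f g by (simp add: h(2)[symmetric] tensor_one_cls)
  then show "tensor_one C A n (x \<otimes>\<^bsub>T n\<^esub> y) = tensor_one C A n x \<otimes>\<^bsub>T (Suc n)\<^esub> tensor_one C A n y"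
    using f g by (simp add: tensor_one_cls append_one_closed h1(2) h(2))
  have "tensor_one C A n (x \<oplus>\<^bsub>T n\<^esub> y) = cls (Suc n) (append_one C A (f \<oplus>\<^bsub>F n\<^esub> g))"
    using f g by (simp add: h(3)[symmetric] tensor_one_cls)
  then show "tensor_one C A n (x \<oplus>\<^bsub>T n\<^esub> y) = tensor_one C A n x \<oplus>\<^bsub>T (Suc n)\<^esub> tensor_one C A n y"
    using f g by (simp add: tensor_one_cls append_one_closed h1(3) h(3))
qed

text \<open>The multilinear counterpart of the retraction of \<open>x \<mapsto> x \<otimes> \<one>\<close> that multiplies the last two
  factors; it needs at least one factor before the last one, whence the two successors.\<close>

lemma merge_last_multilinear:
  assumes w: "multilinear C A (Suc n) M w"
  defines "v \<equiv> \<lambda>zs. w ((take (Suc n) zs)[n := zs ! n \<otimes>\<^bsub>A\<^esub> zs ! Suc n])"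
  shows "multilinear C A (Suc (Suc n)) M v"
    and "xs \<in> tuples A (Suc n) \<Longrightarrow> v (xs @ [\<one>\<^bsub>A\<^esub>]) = w xs"
proof -
  have take: "take (Suc n) zs \<in> tuples A (Suc n)" if "zs \<in> tuples A (Suc (Suc n))" for zs
    using that by (auto simp: tuples_iff)
  show "v (xs @ [\<one>\<^bsub>A\<^esub>]) = w xs" if "xs \<in> tuples A (Suc n)"
  proof -
    have "(take (Suc n) (xs @ [\<one>\<^bsub>A\<^esub>]))[n := (xs @ [\<one>\<^bsub>A\<^esub>]) ! n \<otimes>\<^bsub>A\<^esub> (xs @ [\<one>\<^bsub>A\<^esub>]) ! Suc n] = xs"
      using that by (auto simp: tuples_iff nth_append)
    then show ?thesis by (simp add: v_def)
  qed
  have two: "zs ! n \<in> carrier A" "zs ! Suc n \<in> carrier A" if "zs \<in> tuples A (Suc (Suc n))" for zs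
    using that by (auto simp: tuples_iff)
  have upd: "v (zs[i := a]) =
      (if i < n then w ((take (Suc n) zs)[n := zs ! n \<otimes>\<^bsub>A\<^esub> zs ! Suc n, i := a])
       else w ((take (Suc n) zs)[n := a \<otimes>\<^bsub>A\<^esub> zs ! (if i = n then Suc n else n)]))"
    if zs: "zs \<in> tuples A (Suc (Suc n))" and i: "i < Suc (Suc n)" and a: "a \<in> carrier A" for zs i a
  proof -
    consider "i < n" | "i = n" | "i = Suc n" using i by linarith
    then show ?thesis
      using zs a two[OF zs]
      by cases (auto simp: v_def tuples_iff take_update_swap list_update_swap list_update_beyond m_comm)
  qed
  show "multilinear C A (Suc (Suc n)) M v"
  proof (rule multilinearI)
    fix zs assume zs: "zs \<in> tuples A (Suc (Suc n))"
    show "v zs \<in> carrier M"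
      unfolding v_def by (intro multilinearD(1)[OF w] tuples_update take zs m_closed two)
    fix i a assume i: "i < Suc (Suc n)" and a: "a \<in> carrier A"
    have t: "(take (Suc n) zs)[n := zs ! n \<otimes>\<^bsub>A\<^esub> zs ! Suc n] \<in> tuples A (Suc n)"
      by (intro tuples_update take zs m_closed two)
    have j: "zs ! (if i = n then Suc n else n) \<in> carrier A"
      using two[OF zs] by auto
    show "v (zs[i := a \<oplus>\<^bsub>A\<^esub> b]) = v (zs[i := a]) \<oplus>\<^bsub>M\<^esub> v (zs[i := b])" if b: "b \<in> carrier A" for b
      using a b j multilinearD(2)[OF w t, of i a b]
        multilinearD(2)[OF w take[OF zs], of n] by (simp add: upd zs i l_distr)
    show "v (zs[i := c \<odot>\<^bsub>A\<^esub> a]) = c \<odot>\<^bsub>M\<^esub> v (zs[i := a])" if c: "c \<in> carrier C" for c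
      using a c j multilinearD(3)[OF w t, of i c a]
        multilinearD(3)[OF w take[OF zs], of n] by (simp add: upd zs i smult_assoc2)
  qed
qed

text \<open>This is the injectivity of the composed transition maps, tested by multilinear maps: \<open>w\<close> extends
  to longer tuples by multiplying the superfluous entries into the last one kept, and the extension
  has the same value on a tensor moved up by factors \<open>\<one>\<close>.\<close>

lemma transit_zero_kernel:
  assumes M: "module C M"
    and "multilinear C A (Suc n) M w" "f \<in> carrier (F (Suc n))"
    and "transit (tensor_one C A) (Suc n) d (cls (Suc n) f) = \<zero>\<^bsub>T (Suc n + d)\<^esub>"
  shows "lin_ext C M w f = \<zero>\<^bsub>M\<^esub>"
  using assms(2-4)
proof (induction d arbitrary: n f w)
  case 0
  then show ?case using tensor_ideal_kernel[OF M] by (simp add: cls_eq_zero_iff)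
next
  case (Suc d)
  interpret M: module C M by fact
  let ?v = "\<lambda>zs. w ((take (Suc n) zs)[n := zs ! n \<otimes>\<^bsub>A\<^esub> zs ! Suc n])"
  note v = merge_last_multilinear[OF Suc.prems(1)]
  have "lin_ext C M ?v (append_one C A f) = \<zero>\<^bsub>M\<^esub>"
  proof (rule Suc.IH)
    show "transit (tensor_one C A) (Suc (Suc n)) d (cls (Suc (Suc n)) (append_one C A f))
        = \<zero>\<^bsub>T (Suc (Suc n) + d)\<^esub>"
      using Suc.prems(2,3) by (simp add: tensor_one_cls[symmetric] transit_shift del: transit.simps(2))
  qed (use v Suc.prems append_one_closed in auto)
  moreover have "lin_ext C M ?v (append_one C A f) = lin_ext C M w f"
  proof (rule lin_ext_linear[OF M])
    have v': "?v \<in> tuples A (Suc (Suc n)) \<rightarrow> carrier M"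
      using v(1) by (simp add: multilinear_def)
    show "lin_ext C M ?v (append_one C A f) \<in> carrier M" if "f \<in> carrier (F (Suc n))" for f
      using append_one_closed[OF that] v'
      by (intro M.lin_ext_closed[where X = "tuples A (Suc (Suc n))"]) (auto simp: F_simps)
    show "lin_ext C M ?v (append_one C A (f \<oplus>\<^bsub>F (Suc n)\<^esub> g))
        = lin_ext C M ?v (append_one C A f) \<oplus>\<^bsub>M\<^esub> lin_ext C M ?v (append_one C A g)"
      if "f \<in> carrier (F (Suc n))" "g \<in> carrier (F (Suc n))" for f g
      unfolding append_one_linear using that by (intro lin_ext_F_add M v' append_one_closed)
    show "lin_ext C M ?v (append_one C A (c \<odot>\<^bsub>F (Suc n)\<^esub> f)) = c \<odot>\<^bsub>M\<^esub> lin_ext C M ?v (append_one C A f)"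
      if "c \<in> carrier C" "f \<in> carrier (F (Suc n))" for c f
      unfolding append_one_linear(2)[OF that(1)] using that
      by (intro lin_ext_F_smult M v' append_one_closed)
    show "lin_ext C M ?v (append_one C A (e xs)) = w xs" if "xs \<in> tuples A (Suc n)" for xs
      using that v(2)[OF that] v' tuples_append_one[OF that]
      by (subst append_one_basis, subst M.lin_ext_basis) (auto simp: Pi_iff)
  qed (use Suc.prems in \<open>auto simp: multilinear_def\<close>)
  ultimately show ?case by simp
qed

end

section \<open>Sequential direct limits\<close>

locale direct_system =
  fixes C :: "('c, 'k) ring_scheme"
    and M :: "nat \<Rightarrow> ('c, 'x, 'm) module_scheme"
    and \<tau> :: "nat \<Rightarrow> 'x \<Rightarrow> 'x"
  assumes stage_algebra: "algebra C (M n)"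
    and step_hom: "\<tau> n \<in> alg_hom C (M n) (M (Suc n))"
begin

abbreviation lim :: "nat \<Rightarrow> 'x \<Rightarrow> (nat \<times> 'x) set"
  where "lim \<equiv> limit_class M \<tau>"

abbreviation L :: "('c, (nat \<times> 'x) set) module"
  where "L \<equiv> direct_limit M \<tau>"

lemma transit_hom: "transit \<tau> m d \<in> alg_hom C (M m) (M (m + d))"
proof (induction d)
  case 0
  show ?case by (rule alg_homI) auto
next
  case (Suc d)
  note h = alg_homD[OF Suc] and k = alg_homD[OF step_hom[of "m + d"]]
  show ?case by (rule alg_homI) (simp_all add: h k)
qed

lemma transit_closed: "x \<in> carrier (M m) \<Longrightarrow> transit \<tau> m d x \<in> carrier (M (m + d))"
  by (rule alg_homD(1)[OF transit_hom])

lemma transit_add: "transit \<tau> m (d + d') x = transit \<tau> (m + d) d' (transit \<tau> m d x)"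
  by (induction d') (auto simp: add.assoc)

lemma transit_eq_later:
  assumes "transit \<tau> m d x = transit \<tau> n d' y" "m + d = n + d'"
  shows "transit \<tau> m (d + k) x = transit \<tau> n (d' + k) y"
  using assms by (simp add: transit_add)

lemma limit_rel_iff:
  "((m, x), (n, y)) \<in> limit_rel M \<tau> \<longleftrightarrow> m \<ge> 1 \<and> n \<ge> 1 \<and> x \<in> carrier (M m) \<and> y \<in> carrier (M n) \<and>
    (\<exists>d d'. m + d = n + d' \<and> transit \<tau> m d x = transit \<tau> n d' y)"
  by (simp add: limit_rel_def)

lemma limit_rel_equiv: "equiv (SIGMA n:{1..}. carrier (M n)) (limit_rel M \<tau>)"
proof (rule equivI)
  show "limit_rel M \<tau> \<subseteq> (SIGMA n:{1..}. carrier (M n)) \<times> (SIGMA n:{1..}. carrier (M n))"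
    by (auto simp: limit_rel_iff)
  show "refl_on (SIGMA n:{1..}. carrier (M n)) (limit_rel M \<tau>)"
    by (rule refl_onI) (auto simp: limit_rel_iff)
  show "sym (limit_rel M \<tau>)"
  proof (rule symI, clarify)
    fix m x n y assume "((m, x), (n, y)) \<in> limit_rel M \<tau>"
    then show "((n, y), (m, x)) \<in> limit_rel M \<tau>"
      unfolding limit_rel_iff by metis
  qed
  show "trans (limit_rel M \<tau>)"
  proof (rule transI, clarify)
    fix m x n y p z
    assume 1: "((m, x), (n, y)) \<in> limit_rel M \<tau>" and 2: "((n, y), (p, z)) \<in> limit_rel M \<tau>"
    from 1 obtain d d' where d: "m + d = n + d'" "transit \<tau> m d x = transit \<tau> n d' y"
      unfolding limit_rel_iff by blast
    from 2 obtain b b' where b: "n + b = p + b'" "transit \<tau> n b y = transit \<tau> p b' z"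
      unfolding limit_rel_iff by blast
    have "transit \<tau> m (d + b) x = transit \<tau> n (d' + b) y"
      by (rule transit_eq_later) (use d in auto)
    also have "\<dots> = transit \<tau> n (b + d') y" by (simp add: add.commute)
    also have "\<dots> = transit \<tau> p (b' + d') z"
      by (rule transit_eq_later) (use b in auto)
    finally have "transit \<tau> m (d + b) x = transit \<tau> p (b' + d') z" .
    moreover have "m + (d + b) = p + (b' + d')" using d b by linarith
    ultimately show "((m, x), (p, z)) \<in> limit_rel M \<tau>"
      using 1 2 unfolding limit_rel_iff by blast
  qed
qed

lemma lim_eq_iff:
  assumes "m \<ge> 1" "n \<ge> 1" "x \<in> carrier (M m)" "y \<in> carrier (M n)"
  shows "lim m x = lim n y \<longleftrightarrow> (\<exists>d d'. m + d = n + d' \<and> transit \<tau> m d x = transit \<tau> n d' y)"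
  using eq_equiv_class_iff[OF limit_rel_equiv, of "(m, x)" "(n, y)"] assms
  by (simp add: limit_class_def limit_rel_iff)

lemma lim_transit:
  assumes "n \<ge> 1" "x \<in> carrier (M n)"
  shows "lim (n + d) (transit \<tau> n d x) = lim n x"
proof (subst lim_eq_iff)
  have "n + d + 0 = n + d \<and> transit \<tau> (n + d) 0 (transit \<tau> n d x) = transit \<tau> n d x" by simp
  then show "\<exists>k k'. n + d + k = n + k' \<and> transit \<tau> (n + d) k (transit \<tau> n d x) = transit \<tau> n k' x"
    by blast
qed (use assms transit_closed in auto)

lemma carrier_L: "carrier L = (\<Union>n\<in>{1..}. lim n ` carrier (M n))"
  by (auto simp: direct_limit_def quotient_def limit_class_def)

lemma lim_closed: "n \<ge> 1 \<Longrightarrow> x \<in> carrier (M n) \<Longrightarrow> lim n x \<in> carrier L"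
  by (auto simp: carrier_L)

lemma in_lim_iff:
  "(m, y) \<in> lim n x \<longleftrightarrow> m \<ge> 1 \<and> n \<ge> 1 \<and> x \<in> carrier (M n) \<and> y \<in> carrier (M m) \<and> lim m y = lim n x"
proof
  assume "(m, y) \<in> lim n x"
  then have "((n, x), (m, y)) \<in> limit_rel M \<tau>" by (simp add: limit_class_def)
  moreover from equiv_class_eq[OF limit_rel_equiv this] have "lim n x = lim m y"
    by (simp add: limit_class_def)
  ultimately show "m \<ge> 1 \<and> n \<ge> 1 \<and> x \<in> carrier (M n) \<and> y \<in> carrier (M m) \<and> lim m y = lim n x"
    by (simp add: limit_rel_iff)
next
  assume *: "m \<ge> 1 \<and> n \<ge> 1 \<and> x \<in> carrier (M n) \<and> y \<in> carrier (M m) \<and> lim m y = lim n x"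
  then have "m \<ge> 1" "y \<in> carrier (M m)" by auto
  then have "(m, y) \<in> lim m y" by (auto simp: limit_class_def limit_rel_iff)
  then show "(m, y) \<in> lim n x" using * by simp
qed

lemma common_stage:
  assumes "finite Y" "Y \<subseteq> carrier L"
  shows "\<exists>n\<ge>1. Y \<subseteq> lim n ` carrier (M n)"
  using assms
proof (induction rule: finite_induct)
  case empty
  show ?case by auto
next
  case (insert a Y)
  then obtain n where n: "n \<ge> 1" "Y \<subseteq> lim n ` carrier (M n)" by auto
  obtain m x where m: "m \<ge> 1" "x \<in> carrier (M m)" "a = lim m x"
    using insert.prems by (auto simp: carrier_L)
  have "lim k z \<in> lim (k + d) ` carrier (M (k + d))" if "k \<ge> 1" "z \<in> carrier (M k)" for k z d
    using that
    by (intro image_eqI[where x = "transit \<tau> k d z"]) (simp_all add: lim_transit transit_closed)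
  note later = this
  have "a \<in> lim (n + m) ` carrier (M (n + m))"
    using later[OF m(1,2), of n] m(3) by (simp add: add.commute)
  moreover have "Y \<subseteq> lim (n + m) ` carrier (M (n + m))"
    using n(2) later[OF n(1), of _ m] by blast
  ultimately show ?case using n(1) by (intro exI[of _ "n + m"]) auto
qed

text \<open>All pairs of representatives of two classes agree at some later stage, and \<open>f\<close> commutes with
  moving to later stages. Hence the union in the definition runs over a single class.\<close>

lemma limit_binop_lim:
  assumes n: "n \<ge> 1" and x: "x \<in> carrier (M n)" and y: "y \<in> carrier (M n)"
    and closed: "\<And>m u v. u \<in> carrier (M m) \<Longrightarrow> v \<in> carrier (M m) \<Longrightarrow> f m u v \<in> carrier (M m)"
    and hom: "\<And>m d u v. u \<in> carrier (M m) \<Longrightarrow> v \<in> carrier (M m) \<Longrightarrow>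
      transit \<tau> m d (f m u v) = f (m + d) (transit \<tau> m d u) (transit \<tau> m d v)"
  shows "limit_binop M \<tau> f (lim n x) (lim n y) = lim n (f n x y)"
proof -
  have same: "lim m (f m u v) = lim n (f n x y)"
    if m: "m \<ge> 1" "u \<in> carrier (M m)" "v \<in> carrier (M m)" and eq: "lim m u = lim n x" "lim m v = lim n y"
    for m u v
  proof -
    obtain d d' where d: "m + d = n + d'" "transit \<tau> m d u = transit \<tau> n d' x"
      using eq(1) lim_eq_iff[OF m(1) n m(2) x] by blast
    obtain b b' where b: "m + b = n + b'" "transit \<tau> m b v = transit \<tau> n b' y"
      using eq(2) lim_eq_iff[OF m(1) n m(3) y] by blast
    have stage: "m + (d + b) = n + (d' + b)" "d' + b = b' + d" using d(1) b(1) by linarith+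
    have u: "transit \<tau> m (d + b) u = transit \<tau> n (d' + b) x"
      by (rule transit_eq_later) (use d in auto)
    have "transit \<tau> m (b + d) v = transit \<tau> n (b' + d) y"
      by (rule transit_eq_later) (use b in auto)
    then have v: "transit \<tau> m (d + b) v = transit \<tau> n (d' + b) y"
      by (simp only: stage(2) add.commute[of b d])
    have "transit \<tau> m (d + b) (f m u v) = transit \<tau> n (d' + b) (f n x y)"
      by (simp only: hom m x y u v stage(1))
    then show ?thesis
      using stage(1) m n x y closed by (subst lim_eq_iff) blast+
  qed
  have "lim (k + d) (f (k + d) (transit \<tau> k d u) (transit \<tau> l e v)) = lim n (f n x y)"
    if "(k, u) \<in> lim n x" "(l, v) \<in> lim n y" "k + d = l + e" for k u l v d e
  proof -
    have u: "k \<ge> 1" "u \<in> carrier (M k)" "lim k u = lim n x"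
      and v: "l \<ge> 1" "v \<in> carrier (M l)" "lim l v = lim n y"
      using that(1,2) by (simp_all add: in_lim_iff)
    show ?thesis
    proof (rule same)
      show "1 \<le> k + d" using u(1) by simp
      show "transit \<tau> k d u \<in> carrier (M (k + d))" using u(2) by (rule transit_closed)
      show "transit \<tau> l e v \<in> carrier (M (k + d))"
        unfolding that(3) using v(2) by (rule transit_closed)
      show "lim (k + d) (transit \<tau> k d u) = lim n x"
        using lim_transit[OF u(1,2)] u(3) by simp
      show "lim (k + d) (transit \<tau> l e v) = lim n y"
        unfolding that(3) using lim_transit[OF v(1,2)] v(3) by simp
    qed
  qed
  note all_same = this
  let ?S = "{lim (k + d) (f (k + d) (transit \<tau> k d u) (transit \<tau> l e v)) | k u l v d e.
        (k, u) \<in> lim n x \<and> (l, v) \<in> lim n y \<and> k + d = l + e}"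
  have "(n, x) \<in> lim n x" "(n, y) \<in> lim n y" using n x y by (simp_all add: in_lim_iff)
  then have "lim (n + 0) (f (n + 0) (transit \<tau> n 0 x) (transit \<tau> n 0 y)) \<in> ?S"
    by blast
  moreover have "X = lim n (f n x y)" if "X \<in> ?S" for X
  proof -
    from that obtain k u l v d e where "(k, u) \<in> lim n x" "(l, v) \<in> lim n y" "k + d = l + e"
      "X = lim (k + d) (f (k + d) (transit \<tau> k d u) (transit \<tau> l e v))"
      by blast
    then show ?thesis using all_same by simp
  qed
  ultimately have "?S = {lim n (f n x y)}" by blast
  then show ?thesis by (simp only: limit_binop_def cSup_singleton)
qed

lemma lim_mult:
  assumes "n \<ge> 1" "x \<in> carrier (M n)" "y \<in> carrier (M n)"
  shows "lim n x \<otimes>\<^bsub>L\<^esub> lim n y = lim n (x \<otimes>\<^bsub>M n\<^esub> y)"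
proof -
  have "limit_binop M \<tau> (\<lambda>n. mult (M n)) (lim n x) (lim n y) = lim n (x \<otimes>\<^bsub>M n\<^esub> y)"
  proof (rule limit_binop_lim)
    fix m d u v assume uv: "u \<in> carrier (M m)" "v \<in> carrier (M m)"
    interpret algebra C "M m" by (rule stage_algebra)
    show "u \<otimes>\<^bsub>M m\<^esub> v \<in> carrier (M m)" using uv by simp
    show "transit \<tau> m d (u \<otimes>\<^bsub>M m\<^esub> v) = transit \<tau> m d u \<otimes>\<^bsub>M (m + d)\<^esub> transit \<tau> m d v"
      using uv by (rule alg_homD(2)[OF transit_hom])
  qed (use assms in auto)
  then show ?thesis by (simp add: direct_limit_def)
qed

lemma lim_add:
  assumes "n \<ge> 1" "x \<in> carrier (M n)" "y \<in> carrier (M n)"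
  shows "lim n x \<oplus>\<^bsub>L\<^esub> lim n y = lim n (x \<oplus>\<^bsub>M n\<^esub> y)"
proof -
  have "limit_binop M \<tau> (\<lambda>n. add (M n)) (lim n x) (lim n y) = lim n (x \<oplus>\<^bsub>M n\<^esub> y)"
  proof (rule limit_binop_lim)
    fix m d u v assume uv: "u \<in> carrier (M m)" "v \<in> carrier (M m)"
    interpret algebra C "M m" by (rule stage_algebra)
    show "u \<oplus>\<^bsub>M m\<^esub> v \<in> carrier (M m)" using uv by simp
    show "transit \<tau> m d (u \<oplus>\<^bsub>M m\<^esub> v) = transit \<tau> m d u \<oplus>\<^bsub>M (m + d)\<^esub> transit \<tau> m d v"
      using uv by (rule alg_homD(3)[OF transit_hom])
  qed (use assms in auto)
  then show ?thesis by (simp add: direct_limit_def)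
qed

lemma lim_smult:
  assumes n: "n \<ge> 1" and c: "c \<in> carrier C" and x: "x \<in> carrier (M n)"
  shows "c \<odot>\<^bsub>L\<^esub> lim n x = lim n (c \<odot>\<^bsub>M n\<^esub> x)"
proof -
  have "lim m (c \<odot>\<^bsub>M m\<^esub> y) = lim n (c \<odot>\<^bsub>M n\<^esub> x)" if "(m, y) \<in> lim n x" for m y
  proof -
    have m: "m \<ge> 1" "y \<in> carrier (M m)" and eq: "lim m y = lim n x"
      using that by (simp_all add: in_lim_iff)
    obtain d d' where d: "m + d = n + d'" "transit \<tau> m d y = transit \<tau> n d' x"
      using eq lim_eq_iff[OF m(1) n m(2) x] by blast
    have "transit \<tau> m d (c \<odot>\<^bsub>M m\<^esub> y) = transit \<tau> n d' (c \<odot>\<^bsub>M n\<^esub> x)"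
      by (simp only: alg_homD(5)[OF transit_hom c] m x d)
    moreover have "c \<odot>\<^bsub>M m\<^esub> y \<in> carrier (M m)" "c \<odot>\<^bsub>M n\<^esub> x \<in> carrier (M n)"
      using m x c by (simp_all add: module.smult_closed[OF algebra.module[OF stage_algebra]])
    ultimately show ?thesis using d m n by (subst lim_eq_iff) blast+
  qed
  moreover have "(n, x) \<in> lim n x" using n x by (auto simp: in_lim_iff)
  ultimately have "(\<Union>(m, y)\<in>lim n x. lim m (c \<odot>\<^bsub>M m\<^esub> y)) = lim n (c \<odot>\<^bsub>M n\<^esub> x)"
    by blast
  then show ?thesis by (simp add: direct_limit_def)
qed

lemma transit_zero: "transit \<tau> m d \<zero>\<^bsub>M m\<^esub> = \<zero>\<^bsub>M (m + d)\<^esub>"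
  by (rule alg_hom_zero[OF stage_algebra stage_algebra transit_hom])

lemma stage_zero_closed: "\<zero>\<^bsub>M n\<^esub> \<in> carrier (M n)" and stage_one_closed: "\<one>\<^bsub>M n\<^esub> \<in> carrier (M n)"
proof -
  interpret algebra C "M n" by (rule stage_algebra)
  show "\<zero>\<^bsub>M n\<^esub> \<in> carrier (M n)" "\<one>\<^bsub>M n\<^esub> \<in> carrier (M n)" by auto
qed

lemma lim_zero: "n \<ge> 1 \<Longrightarrow> lim n \<zero>\<^bsub>M n\<^esub> = \<zero>\<^bsub>L\<^esub>"
  using lim_transit[of 1 "\<zero>\<^bsub>M 1\<^esub>" "n - 1"] transit_zero[of 1 "n - 1"]
  by (simp add: direct_limit_def stage_zero_closed)

lemma lim_one: "n \<ge> 1 \<Longrightarrow> lim n \<one>\<^bsub>M n\<^esub> = \<one>\<^bsub>L\<^esub>"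
  using lim_transit[of 1 "\<one>\<^bsub>M 1\<^esub>" "n - 1"] alg_homD(4)[OF transit_hom, of 1 "n - 1"]
  by (simp add: direct_limit_def stage_one_closed)

lemma lim_hom: "n \<ge> 1 \<Longrightarrow> lim n \<in> alg_hom C (M n) L"
  by (rule alg_homI) (simp_all add: lim_closed lim_mult lim_add lim_smult lim_one)

lemma limit_algebra: "algebra C L"
proof (rule algebraI_locally)
  interpret algebra C "M 1" by (rule stage_algebra)
  show "cring C" by (rule R_cring)
  show "\<zero>\<^bsub>L\<^esub> \<in> carrier L" using lim_closed[of 1, OF _ stage_zero_closed] lim_zero[of 1] by simp
  fix x y z assume "x \<in> carrier L" "y \<in> carrier L" "z \<in> carrier L"
  then have "{x, y, z} \<subseteq> carrier L" by simp
  then obtain n where n: "n \<ge> 1" "{x, y, z} \<subseteq> lim n ` carrier (M n)"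
    using common_stage[of "{x, y, z}"] by blast
  show "\<exists>(B :: ('c, 'x, 'm) module_scheme) q. algebra C B \<and> q \<in> alg_hom C B L
      \<and> q \<zero>\<^bsub>B\<^esub> = \<zero>\<^bsub>L\<^esub> \<and> {x, y, z} \<subseteq> q ` carrier B"
    by (intro exI[of _ "M n"] exI[of _ "lim n"] conjI stage_algebra lim_hom lim_zero n)
qed

lemma lim_eq_zeroD:
  assumes n: "n \<ge> 1" and x: "x \<in> carrier (M n)" and eq: "lim n x = \<zero>\<^bsub>L\<^esub>"
  obtains d where "transit \<tau> n d x = \<zero>\<^bsub>M (n + d)\<^esub>"
proof -
  have "lim n x = lim n \<zero>\<^bsub>M n\<^esub>" using eq lim_zero[OF n] by simp
  then obtain d d' where "n + d = n + d'" "transit \<tau> n d x = transit \<tau> n d' \<zero>\<^bsub>M n\<^esub>"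
    using lim_eq_iff[OF n n x stage_zero_closed] by blast
  then show ?thesis using that by (simp add: transit_zero)
qed

end

section \<open>Baxter algebras of sequences and Baxter subalgebras\<close>

lemma seq_algebra_algebra:
  assumes "algebra C B"
  shows "algebra C (seq_algebra B)"
proof -
  interpret algebra C B by fact
  have "abelian_group (seq_algebra B)"
  proof (rule abelian_groupI)
    fix s assume "s \<in> carrier (seq_algebra B)"
    then show "\<exists>t\<in>carrier (seq_algebra B). t \<oplus>\<^bsub>seq_algebra B\<^esub> s = \<zero>\<^bsub>seq_algebra B\<^esub>"
      by (intro bexI[of _ "\<lambda>k. \<ominus>\<^bsub>B\<^esub> s k"]) (auto simp: seq_algebra_def M.l_neg)
  qed (auto simp: seq_algebra_def M.a_assoc intro: M.a_comm)
  moreover have "comm_monoid (seq_algebra B)"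
    by (rule comm_monoidI) (auto simp: seq_algebra_def m_assoc intro: m_comm)
  ultimately have "cring (seq_algebra B)"
    by (rule cringI) (auto simp: seq_algebra_def l_distr)
  then show ?thesis
    by (rule algebraI[OF R_cring])
      (auto simp: seq_algebra_def smult_l_distr smult_r_distr smult_assoc1 smult_assoc2)
qed

text \<open>Scalars act as multiplication by \<open>l = lam \<odot> \<one>\<close>. When \<open>k\<close> grows by one, both sides change by
  the same three products, those that contain \<open>x k\<close> or \<open>y k\<close>; the remaining product of the two old
  partial sums is covered by the induction hypothesis.\<close>

lemma (in algebra) partial_sums_baxter:
  assumes lam: "lam \<in> carrier R" and x: "\<And>i::nat. x i \<in> carrier M" and y: "\<And>i. y i \<in> carrier M"
  defines "Q \<equiv> \<lambda>s k. lam \<odot>\<^bsub>M\<^esub> (\<Oplus>\<^bsub>M\<^esub>i\<in>{..<k::nat}. s i)"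
  shows "Q x k \<otimes>\<^bsub>M\<^esub> Q y k
    = Q (\<lambda>i. x i \<otimes>\<^bsub>M\<^esub> Q y i) k \<oplus>\<^bsub>M\<^esub> Q (\<lambda>i. y i \<otimes>\<^bsub>M\<^esub> Q x i) k
      \<oplus>\<^bsub>M\<^esub> lam \<odot>\<^bsub>M\<^esub> Q (\<lambda>i. x i \<otimes>\<^bsub>M\<^esub> y i) k"
proof -
  have Q_closed: "Q s k \<in> carrier M" if "\<And>i. s i \<in> carrier M" for s k
    unfolding Q_def using lam that by (intro smult_closed M.finsum_closed) auto
  have Q_Suc: "Q s (Suc k) = lam \<odot>\<^bsub>M\<^esub> s k \<oplus>\<^bsub>M\<^esub> Q s k" if "\<And>i. s i \<in> carrier M" for s k
    unfolding Q_def lessThan_Suc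
    using lam that by (simp add: M.finsum_insert smult_r_distr M.finsum_closed Pi_iff)
  show ?thesis
  proof (induction k)
    case 0
    show ?case using lam by (simp add: Q_def)
  next
    case (Suc k)
    define l where "l = lam \<odot>\<^bsub>M\<^esub> \<one>\<^bsub>M\<^esub>"
    have l: "l \<in> carrier M" using lam by (simp add: l_def)
    have sm: "lam \<odot>\<^bsub>M\<^esub> z = l \<otimes>\<^bsub>M\<^esub> z" if "z \<in> carrier M" for z
      using that lam by (simp add: l_def smult_assoc2)
    let ?a = "x k" and ?b = "y k" and ?X = "Q x k" and ?Y = "Q y k"
    let ?s = "\<lambda>i. x i \<otimes>\<^bsub>M\<^esub> Q y i" and ?t = "\<lambda>i. y i \<otimes>\<^bsub>M\<^esub> Q x i" and ?u = "\<lambda>i. x i \<otimes>\<^bsub>M\<^esub> y i"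
    have cl: "?a \<in> carrier M" "?b \<in> carrier M" "?X \<in> carrier M" "?Y \<in> carrier M"
      "Q ?s k \<in> carrier M" "Q ?t k \<in> carrier M" "Q ?u k \<in> carrier M"
      using x y by (auto intro!: Q_closed)
    have IH: "?X \<otimes>\<^bsub>M\<^esub> ?Y = Q ?s k \<oplus>\<^bsub>M\<^esub> Q ?t k \<oplus>\<^bsub>M\<^esub> l \<otimes>\<^bsub>M\<^esub> Q ?u k"
      using Suc cl by (simp add: sm)
    have "Q x (Suc k) \<otimes>\<^bsub>M\<^esub> Q y (Suc k) = (l \<otimes>\<^bsub>M\<^esub> ?a \<oplus>\<^bsub>M\<^esub> ?X) \<otimes>\<^bsub>M\<^esub> (l \<otimes>\<^bsub>M\<^esub> ?b \<oplus>\<^bsub>M\<^esub> ?Y)"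
      using x y cl by (simp add: Q_Suc sm)
    also have "\<dots> = l \<otimes>\<^bsub>M\<^esub> ?a \<otimes>\<^bsub>M\<^esub> (l \<otimes>\<^bsub>M\<^esub> ?b) \<oplus>\<^bsub>M\<^esub> l \<otimes>\<^bsub>M\<^esub> (?a \<otimes>\<^bsub>M\<^esub> ?Y)
        \<oplus>\<^bsub>M\<^esub> l \<otimes>\<^bsub>M\<^esub> (?b \<otimes>\<^bsub>M\<^esub> ?X) \<oplus>\<^bsub>M\<^esub> ?X \<otimes>\<^bsub>M\<^esub> ?Y"
      using l cl by (simp add: l_distr r_distr m_ac M.a_ac)
    also have "\<dots> = (l \<otimes>\<^bsub>M\<^esub> (?a \<otimes>\<^bsub>M\<^esub> ?Y) \<oplus>\<^bsub>M\<^esub> Q ?s k) \<oplus>\<^bsub>M\<^esub> (l \<otimes>\<^bsub>M\<^esub> (?b \<otimes>\<^bsub>M\<^esub> ?X) \<oplus>\<^bsub>M\<^esub> Q ?t k)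
        \<oplus>\<^bsub>M\<^esub> l \<otimes>\<^bsub>M\<^esub> (l \<otimes>\<^bsub>M\<^esub> (?a \<otimes>\<^bsub>M\<^esub> ?b) \<oplus>\<^bsub>M\<^esub> Q ?u k)"
      unfolding IH using l cl by (simp add: l_distr r_distr m_ac M.a_ac)
    also have "\<dots> = Q ?s (Suc k) \<oplus>\<^bsub>M\<^esub> Q ?t (Suc k) \<oplus>\<^bsub>M\<^esub> lam \<odot>\<^bsub>M\<^esub> Q ?u (Suc k)"
      using x y cl l by (simp add: Q_Suc Q_closed sm)
    finally show ?case .
  qed
qed

lemma seq_baxter_algebra:
  assumes "algebra C B" and lam: "lam \<in> carrier C"
  shows "baxter_algebra C (seq_algebra B) lam (\<lambda>s k. lam \<odot>\<^bsub>B\<^esub> (\<Oplus>\<^bsub>B\<^esub>i\<in>{..<k}. s i))"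
    (is "baxter_algebra C ?S lam ?Q")
proof -
  interpret algebra C B by fact
  show ?thesis
  proof (intro baxter_algebra.intro seq_algebra_algebra baxter_algebra_axioms.intro)
    fix x y assume x: "x \<in> carrier ?S" and y: "y \<in> carrier ?S"
    have xy: "x i \<in> carrier B" "y i \<in> carrier B" for i
      using x y by (auto simp: seq_algebra_def)
    show "?Q x \<in> carrier ?S"
      using lam xy by (auto simp: seq_algebra_def intro!: M.finsum_closed)
    show "?Q (x \<oplus>\<^bsub>?S\<^esub> y) = ?Q x \<oplus>\<^bsub>?S\<^esub> ?Q y"
      using lam xy by (auto simp: seq_algebra_def M.finsum_addf smult_r_distr M.finsum_closed Pi_iff)
    show "?Q x \<otimes>\<^bsub>?S\<^esub> ?Q y = ?Q (x \<otimes>\<^bsub>?S\<^esub> ?Q y) \<oplus>\<^bsub>?S\<^esub> ?Q (y \<otimes>\<^bsub>?S\<^esub> ?Q x)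
        \<oplus>\<^bsub>?S\<^esub> lam \<odot>\<^bsub>?S\<^esub> ?Q (x \<otimes>\<^bsub>?S\<^esub> y)"
      using partial_sums_baxter[OF lam, of x y] xy by (simp add: seq_algebra_def)
  next
    fix c x assume c: "c \<in> carrier C" and x: "x \<in> carrier ?S"
    have xc: "x i \<in> carrier B" for i using x by (auto simp: seq_algebra_def)
    have "lam \<odot>\<^bsub>B\<^esub> (c \<odot>\<^bsub>B\<^esub> z) = c \<odot>\<^bsub>B\<^esub> (lam \<odot>\<^bsub>B\<^esub> z)" if "z \<in> carrier B" for z
      using lam c that by (simp add: smult_assoc1[symmetric] R.m_comm)
    then show "?Q (c \<odot>\<^bsub>?S\<^esub> x) = c \<odot>\<^bsub>?S\<^esub> ?Q x"
      using lam c xc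
      by (auto simp: seq_algebra_def finsum_smult_ldistr[symmetric] Pi_iff M.finsum_closed)
  qed (use assms in auto)
qed

context baxter_algebra
begin

lemma smult_minus_one: "x \<in> carrier R \<Longrightarrow> \<ominus>\<^bsub>R\<^esub> x = (\<ominus>\<^bsub>C\<^esub> \<one>\<^bsub>C\<^esub>) \<odot>\<^bsub>R\<^esub> x"
  by (simp add: smult_l_minus)

lemma baxter_subalgebraI:
  assumes "H \<subseteq> carrier R" "\<one>\<^bsub>R\<^esub> \<in> H"
    and "\<And>x y. x \<in> H \<Longrightarrow> y \<in> H \<Longrightarrow> x \<otimes>\<^bsub>R\<^esub> y \<in> H"
    and "\<And>x y. x \<in> H \<Longrightarrow> y \<in> H \<Longrightarrow> x \<oplus>\<^bsub>R\<^esub> y \<in> H"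
    and smult: "\<And>c x. c \<in> carrier C \<Longrightarrow> x \<in> H \<Longrightarrow> c \<odot>\<^bsub>R\<^esub> x \<in> H"
    and P: "\<And>x. x \<in> H \<Longrightarrow> P x \<in> H"
  shows "baxter_subalgebra C R P H"
proof -
  have "\<ominus>\<^bsub>R\<^esub> x \<in> H" if "x \<in> H" for x
    using that assms(1) smult[of "\<ominus>\<^bsub>C\<^esub> \<one>\<^bsub>C\<^esub>" x] by (subst smult_minus_one) auto
  then have "subring H R"
    using assms(1-4) by (intro subringI) auto
  then show ?thesis using smult P by (auto simp: baxter_subalgebra_def)
qed

lemma baxter_generated_subalgebra:
  assumes "X \<subseteq> carrier R"
  shows "baxter_subalgebra C R P (baxter_generated C R P X)"
proof -
  let ?\<H> = "{H. baxter_subalgebra C R P H \<and> X \<subseteq> H}"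
  have "carrier R \<in> ?\<H>"
    using assms carrier_is_subring by (auto simp: baxter_subalgebra_def P_closed)
  then have "subring (\<Inter>?\<H>) R"
    by (intro subring_Inter) (auto simp: baxter_subalgebra_def)
  then show ?thesis
    by (simp add: baxter_generated_def) (auto simp: baxter_subalgebra_def)
qed

lemma baxter_generated_subset: "X \<subseteq> baxter_generated C R P X"
  by (auto simp: baxter_generated_def)

lemma baxter_generated_minimal:
  "baxter_subalgebra C R P H \<Longrightarrow> X \<subseteq> H \<Longrightarrow> baxter_generated C R P X \<subseteq> H"
  by (auto simp: baxter_generated_def)

lemma baxter_subalgebraD:
  assumes "baxter_subalgebra C R P H"
  shows "H \<subseteq> carrier R" "\<one>\<^bsub>R\<^esub> \<in> H" "\<zero>\<^bsub>R\<^esub> \<in> H"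
    and "x \<in> H \<Longrightarrow> y \<in> H \<Longrightarrow> x \<otimes>\<^bsub>R\<^esub> y \<in> H"
    and "x \<in> H \<Longrightarrow> y \<in> H \<Longrightarrow> x \<oplus>\<^bsub>R\<^esub> y \<in> H"
    and "c \<in> carrier C \<Longrightarrow> x \<in> H \<Longrightarrow> c \<odot>\<^bsub>R\<^esub> x \<in> H"
    and "x \<in> H \<Longrightarrow> P x \<in> H"
  using assms subringE[of H R] by (auto simp: baxter_subalgebra_def)

lemma baxter_subalgebra_baxter:
  assumes H: "baxter_subalgebra C R P H"
  shows "baxter_algebra C (R\<lparr>carrier := H\<rparr>) lam P"
proof -
  note D = baxter_subalgebraD[OF H] and sub = subsetD[OF baxter_subalgebraD(1)[OF H]]
  have "subcring H R"
    using H by (intro subcringI') (simp add: baxter_subalgebra_def)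
  then have cr: "cring (R\<lparr>carrier := H\<rparr>)"
    using subcring_iff[OF D(1)] by simp
  have alg: "algebra C (R\<lparr>carrier := H\<rparr>)"
    using D(4-6)
    by (intro algebraI[OF R_cring cr])
      (simp_all add: sub smult_l_distr smult_r_distr smult_assoc1 smult_assoc2)
  show ?thesis
    using D(7)
    by (intro baxter_algebra.intro alg baxter_algebra_axioms.intro weight_closed)
      (simp_all add: sub P_add P_smult baxter)
qed

end

text \<open>The equalizer of two Baxter homomorphisms is a Baxter subalgebra, so it is everything as soon as
  it contains the generators.\<close>

lemma baxter_hom_unique:
  assumes B: "baxter_algebra C B lam P" and R: "baxter_algebra C R lam Q"
    and X: "X \<subseteq> carrier B"
    and h: "h \<in> baxter_hom C (B\<lparr>carrier := baxter_generated C B P X\<rparr>) P R Q"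
    and h': "h' \<in> baxter_hom C (B\<lparr>carrier := baxter_generated C B P X\<rparr>) P R Q"
    and eq: "\<And>x. x \<in> X \<Longrightarrow> h x = h' x"
    and x: "x \<in> baxter_generated C B P X"
  shows "h x = h' x"
proof -
  interpret B: baxter_algebra C B lam P by fact
  let ?H = "baxter_generated C B P X"
  let ?E = "{x \<in> ?H. h x = h' x}"
  note D = B.baxter_subalgebraD[OF B.baxter_generated_subalgebra[OF X]]
  have hom: "h \<in> alg_hom C (B\<lparr>carrier := ?H\<rparr>) R" "h' \<in> alg_hom C (B\<lparr>carrier := ?H\<rparr>) R"
    and P: "\<And>x. x \<in> ?H \<Longrightarrow> h (P x) = Q (h x)" "\<And>x. x \<in> ?H \<Longrightarrow> h' (P x) = Q (h' x)"
    using h h' by (auto simp: baxter_hom_def)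
  note a = alg_homD[OF hom(1), simplified] and a' = alg_homD[OF hom(2), simplified]
  have "baxter_subalgebra C B P ?E"
    by (rule B.baxter_subalgebraI) (use D in \<open>auto simp: a(2-5) a'(2-5) P\<close>)
  moreover have "X \<subseteq> ?E" using eq B.baxter_generated_subset by auto
  ultimately show ?thesis using B.baxter_generated_minimal x by blast
qed

section \<open>Words in a Baxter algebra\<close>

text \<open>The value of \<open>a\<^sub>1 \<otimes> \<dots> \<otimes> a\<^sub>n\<close> in a Baxter algebra, namely
  \<open>f a\<^sub>1 \<cdot> P (f a\<^sub>2 \<cdot> P (\<dots> P (f a\<^sub>n)))\<close>.\<close>

fun word :: "('c, 'r, 'm) module_scheme \<Rightarrow> ('r \<Rightarrow> 'r) \<Rightarrow> ('a \<Rightarrow> 'r) \<Rightarrow> 'a list \<Rightarrow> 'r"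
  where
    "word R P f [] = \<one>\<^bsub>R\<^esub>"
  | "word R P f [a] = f a"
  | "word R P f (a # b # xs) = f a \<otimes>\<^bsub>R\<^esub> P (word R P f (b # xs))"

definition nonempty_words :: "('c, 'a, 'm) module_scheme \<Rightarrow> 'a list set"
  where "nonempty_words A = {xs. xs \<noteq> [] \<and> set xs \<subseteq> carrier A}"

lemma word_Cons: "xs \<noteq> [] \<Longrightarrow> word R P f (a # xs) = f a \<otimes>\<^bsub>R\<^esub> P (word R P f xs)"
  by (cases xs) auto

locale baxter_map = baxter_algebra C R lam P + A: algebra C A
  for C :: "('c, 'k) ring_scheme" and R :: "('c, 'r, 'm) module_scheme" and lam P
    and A :: "('c, 'a, 'n) module_scheme" +
  fixes f :: "'a \<Rightarrow> 'r"
  assumes f: "f \<in> alg_hom C A R"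
begin

abbreviation "wd \<equiv> word R P f"

lemmas f_closed = alg_homD(1)[OF f]

lemma wd_closed: "set xs \<subseteq> carrier A \<Longrightarrow> wd xs \<in> carrier R"
proof (induction xs)
  case (Cons a xs)
  then show ?case by (cases "xs = []") (simp_all add: word_Cons f_closed P_closed)
qed simp

lemma wd_one: "xs \<in> nonempty_words A \<Longrightarrow> wd (\<one>\<^bsub>A\<^esub> # xs) = P (wd xs)"
  by (simp add: word_Cons nonempty_words_def alg_homD(4)[OF f] P_closed wd_closed)

lemma wd_add:
  assumes "set xs \<subseteq> carrier A" "i < length xs" "a \<in> carrier A" "b \<in> carrier A"
  shows "wd (xs[i := a \<oplus>\<^bsub>A\<^esub> b]) = wd (xs[i := a]) \<oplus>\<^bsub>R\<^esub> wd (xs[i := b])"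
  using assms
proof (induction xs arbitrary: i)
  case Nil
  then show ?case by simp
next
  case (Cons x xs)
  show ?case
  proof (cases "xs = []")
    case True
    then show ?thesis using Cons.prems by (simp add: alg_homD(3)[OF f])
  next
    case ne: False
    have cl: "set (xs[j := c]) \<subseteq> carrier A" if "c \<in> carrier A" for j c
      using Cons.prems(1) that set_update_subset_insert[of xs j c] by auto
    show ?thesis
    proof (cases i)
      case 0
      have "P (wd xs) \<in> carrier R" using Cons.prems by (intro P_closed wd_closed) auto
      then show ?thesis
        using 0 ne Cons.prems by (simp add: word_Cons alg_homD(3)[OF f] l_distr f_closed)
    next
      case (Suc j)
      then have "wd (xs[j := a \<oplus>\<^bsub>A\<^esub> b]) = wd (xs[j := a]) \<oplus>\<^bsub>R\<^esub> wd (xs[j := b])"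
        using Cons by auto
      then show ?thesis
        using Suc ne Cons.prems cl
        by (simp add: word_Cons P_add P_closed wd_closed r_distr f_closed)
    qed
  qed
qed

lemma wd_smult:
  assumes "set xs \<subseteq> carrier A" "i < length xs" "c \<in> carrier C" "a \<in> carrier A"
  shows "wd (xs[i := c \<odot>\<^bsub>A\<^esub> a]) = c \<odot>\<^bsub>R\<^esub> wd (xs[i := a])"
  using assms
proof (induction xs arbitrary: i)
  case Nil
  then show ?case by simp
next
  case (Cons x xs)
  show ?case
  proof (cases "xs = []")
    case True
    then show ?thesis using Cons.prems by (simp add: alg_homD(5)[OF f])
  next
    case ne: False
    have cl: "set (xs[j := a]) \<subseteq> carrier A" for j
      using Cons.prems set_update_subset_insert[of xs j a] by auto
    show ?thesis
    proof (cases i)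
      case 0
      have "P (wd xs) \<in> carrier R" using Cons.prems by (intro P_closed wd_closed) auto
      then show ?thesis
        using 0 ne Cons.prems by (simp add: word_Cons alg_homD(5)[OF f] smult_assoc2 f_closed)
    next
      case (Suc j)
      then have IH: "wd (xs[j := c \<odot>\<^bsub>A\<^esub> a]) = c \<odot>\<^bsub>R\<^esub> wd (xs[j := a])"
        using Cons by auto
      have "f x \<otimes>\<^bsub>R\<^esub> (c \<odot>\<^bsub>R\<^esub> z) = c \<odot>\<^bsub>R\<^esub> (f x \<otimes>\<^bsub>R\<^esub> z)" if "z \<in> carrier R" for z
        using that Cons.prems smult_assoc2[of c z "f x"] by (simp add: m_comm f_closed)
      then show ?thesis
        using Suc ne Cons.prems cl IH
        by (simp add: word_Cons P_smult P_closed wd_closed)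
    qed
  qed
qed

lemma wd_multilinear: "multilinear C A n R wd"
  by (rule multilinearI) (auto simp: tuples_def wd_closed wd_add wd_smult)

text \<open>The mixable shuffle product: the Baxter identity rewrites a product of two words into words
  and \<open>P\<close>-images of products of shorter total length. Writing \<open>P (wd ys)\<close> as
  \<open>wd (\<one> # ys)\<close> keeps the right-hand side within products of words.\<close>

lemma wd_mult:
  assumes a: "a \<in> carrier A" and b: "b \<in> carrier A" and xs: "xs \<in> nonempty_words A" and ys: "ys \<in> nonempty_words A"
  shows "wd (a # xs) \<otimes>\<^bsub>R\<^esub> wd (b # ys) =
    f (a \<otimes>\<^bsub>A\<^esub> b) \<otimes>\<^bsub>R\<^esub> P (wd xs \<otimes>\<^bsub>R\<^esub> wd (\<one>\<^bsub>A\<^esub> # ys)) \<oplus>\<^bsub>R\<^esub>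
    f (a \<otimes>\<^bsub>A\<^esub> b) \<otimes>\<^bsub>R\<^esub> P (wd ys \<otimes>\<^bsub>R\<^esub> wd (\<one>\<^bsub>A\<^esub> # xs)) \<oplus>\<^bsub>R\<^esub>
    lam \<odot>\<^bsub>R\<^esub> (f (a \<otimes>\<^bsub>A\<^esub> b) \<otimes>\<^bsub>R\<^esub> P (wd xs \<otimes>\<^bsub>R\<^esub> wd ys))"
proof -
  let ?x = "wd xs" and ?y = "wd ys"
  have cl: "?x \<in> carrier R" "?y \<in> carrier R" "f a \<in> carrier R" "f b \<in> carrier R"
    using a b xs ys by (auto simp: nonempty_words_def wd_closed f_closed)
  note Pcl = P_closed[OF cl(1)] P_closed[OF cl(2)]
  have "wd (a # xs) \<otimes>\<^bsub>R\<^esub> wd (b # ys) = (f a \<otimes>\<^bsub>R\<^esub> P ?x) \<otimes>\<^bsub>R\<^esub> (f b \<otimes>\<^bsub>R\<^esub> P ?y)"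
    using xs ys by (simp add: nonempty_words_def word_Cons)
  also have "\<dots> = (f a \<otimes>\<^bsub>R\<^esub> f b) \<otimes>\<^bsub>R\<^esub> (P ?x \<otimes>\<^bsub>R\<^esub> P ?y)"
    using cl Pcl by (simp add: m_ac)
  also have "\<dots> = f (a \<otimes>\<^bsub>A\<^esub> b) \<otimes>\<^bsub>R\<^esub>
      (P (?x \<otimes>\<^bsub>R\<^esub> P ?y) \<oplus>\<^bsub>R\<^esub> P (?y \<otimes>\<^bsub>R\<^esub> P ?x) \<oplus>\<^bsub>R\<^esub> lam \<odot>\<^bsub>R\<^esub> P (?x \<otimes>\<^bsub>R\<^esub> ?y))"
    using a b cl by (simp add: baxter alg_homD(2)[OF f])
  also have "\<dots> = f (a \<otimes>\<^bsub>A\<^esub> b) \<otimes>\<^bsub>R\<^esub> P (?x \<otimes>\<^bsub>R\<^esub> P ?y) \<oplus>\<^bsub>R\<^esub>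
      f (a \<otimes>\<^bsub>A\<^esub> b) \<otimes>\<^bsub>R\<^esub> P (?y \<otimes>\<^bsub>R\<^esub> P ?x) \<oplus>\<^bsub>R\<^esub>
      lam \<odot>\<^bsub>R\<^esub> (f (a \<otimes>\<^bsub>A\<^esub> b) \<otimes>\<^bsub>R\<^esub> P (?x \<otimes>\<^bsub>R\<^esub> ?y))"
  proof -
    have fab: "f (a \<otimes>\<^bsub>A\<^esub> b) \<in> carrier R" using a b by (intro f_closed) simp
    have "f (a \<otimes>\<^bsub>A\<^esub> b) \<otimes>\<^bsub>R\<^esub> (lam \<odot>\<^bsub>R\<^esub> z) = lam \<odot>\<^bsub>R\<^esub> (f (a \<otimes>\<^bsub>A\<^esub> b) \<otimes>\<^bsub>R\<^esub> z)"
      if "z \<in> carrier R" for z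
      using that fab weight_closed smult_assoc2[of lam z "f (a \<otimes>\<^bsub>A\<^esub> b)"] by (simp add: m_comm)
    then show ?thesis
      using fab cl Pcl weight_closed by (simp add: r_distr P_closed)
  qed
  finally show ?thesis by (simp add: wd_one xs ys)
qed

lemma wd_mult_single:
  assumes a: "a \<in> carrier A" and b: "b \<in> carrier A" and "set ys \<subseteq> carrier A"
  shows "wd [a] \<otimes>\<^bsub>R\<^esub> wd (b # ys) = wd ((a \<otimes>\<^bsub>A\<^esub> b) # ys)"
proof (cases "ys = []")
  case True
  then show ?thesis using a b by (simp add: alg_homD(2)[OF f])
next
  case False
  then show ?thesis
    using assms by (simp add: word_Cons alg_homD(2)[OF f] m_assoc f_closed P_closed wd_closed)
qed

lemma lin_ext_wd_closed: "h \<in> fin_funs C (nonempty_words A) \<Longrightarrow> lin_ext C R wd h \<in> carrier R"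
  by (rule lin_ext_closed) (auto simp: nonempty_words_def wd_closed)

end

section \<open>Homomorphisms out of a generated Baxter algebra\<close>

locale baxter_map_pair =
  B: baxter_map C B lam P A f + R: baxter_map C R lam Q A g
  for C :: "('c, 'k) ring_scheme" and B :: "('c, 'b, 'l) module_scheme"
    and R :: "('c, 'r, 'm) module_scheme" and lam P Q
    and A :: "('c, 'a, 'n) module_scheme" and f g
begin

text \<open>The pairs of values that the linear combinations of words take in the two algebras. It is the
  candidate for the graph of the homomorphism that extends \<open>f a \<mapsto> g a\<close>.\<close>

definition graph :: "('b \<times> 'r) set"
  where "graph = (\<lambda>h. (lin_ext C B B.wd h, lin_ext C R R.wd h)) ` fin_funs C (nonempty_words A)"

lemma graph_closed: "(s, r) \<in> graph \<Longrightarrow> s \<in> carrier B \<and> r \<in> carrier R"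
  by (auto simp: graph_def B.lin_ext_wd_closed R.lin_ext_wd_closed)

lemma wd_funs: "B.wd \<in> nonempty_words A \<rightarrow> carrier B" "R.wd \<in> nonempty_words A \<rightarrow> carrier R"
  by (auto simp: nonempty_words_def B.wd_closed R.wd_closed)

lemma graph_add:
  assumes "(s, r) \<in> graph" "(s', r') \<in> graph"
  shows "(s \<oplus>\<^bsub>B\<^esub> s', r \<oplus>\<^bsub>R\<^esub> r') \<in> graph"
proof -
  obtain h h' where "h \<in> fin_funs C (nonempty_words A)" "h' \<in> fin_funs C (nonempty_words A)"
    "s = lin_ext C B B.wd h" "r = lin_ext C R R.wd h"
    "s' = lin_ext C B B.wd h'" "r' = lin_ext C R R.wd h'"
    using assms by (auto simp: graph_def)
  then show ?thesis
    unfolding graph_def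
    by (intro image_eqI[where x = "\<lambda>x. h x \<oplus>\<^bsub>C\<^esub> h' x"])
      (simp_all add: B.lin_ext_add[OF _ _ wd_funs(1)] R.lin_ext_add[OF _ _ wd_funs(2)] B.R.fin_funs_add)
qed

lemma graph_smult:
  assumes "c \<in> carrier C" "(s, r) \<in> graph"
  shows "(c \<odot>\<^bsub>B\<^esub> s, c \<odot>\<^bsub>R\<^esub> r) \<in> graph"
proof -
  obtain h where "h \<in> fin_funs C (nonempty_words A)" "s = lin_ext C B B.wd h" "r = lin_ext C R R.wd h"
    using assms(2) by (auto simp: graph_def)
  then show ?thesis
    using assms(1) unfolding graph_def
    by (intro image_eqI[where x = "\<lambda>x. c \<otimes>\<^bsub>C\<^esub> h x"])
      (simp_all add: B.lin_ext_smult[OF _ _ wd_funs(1)] R.lin_ext_smult[OF _ _ wd_funs(2)]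
        B.R.fin_funs_smult)
qed

lemma graph_word: "xs \<in> nonempty_words A \<Longrightarrow> (B.wd xs, R.wd xs) \<in> graph"
  unfolding graph_def
  by (rule image_eqI[where x = "basis_elt C xs"])
    (use wd_funs in \<open>auto simp: B.lin_ext_basis R.lin_ext_basis B.R.fin_funs_basis Pi_iff\<close>)

lemma graph_zero: "(\<zero>\<^bsub>B\<^esub>, \<zero>\<^bsub>R\<^esub>) \<in> graph"
  unfolding graph_def
  by (rule image_eqI[where x = "\<lambda>_. \<zero>\<^bsub>C\<^esub>"])
    (simp_all add: B.lin_ext_zero R.lin_ext_zero B.R.fin_funs_zero)

lemma graph_induct [consumes 1, case_names zero word add]:
  assumes "(s, r) \<in> graph"
    and "K \<zero>\<^bsub>B\<^esub> \<zero>\<^bsub>R\<^esub>"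
    and "\<And>c xs. c \<in> carrier C \<Longrightarrow> xs \<in> nonempty_words A \<Longrightarrow> K (c \<odot>\<^bsub>B\<^esub> B.wd xs) (c \<odot>\<^bsub>R\<^esub> R.wd xs)"
    and "\<And>s r s' r'. (s, r) \<in> graph \<Longrightarrow> (s', r') \<in> graph \<Longrightarrow> K s r \<Longrightarrow> K s' r' \<Longrightarrow>
      K (s \<oplus>\<^bsub>B\<^esub> s') (r \<oplus>\<^bsub>R\<^esub> r')"
  shows "K s r"
proof -
  obtain h where h: "h \<in> fin_funs C (nonempty_words A)" "s = lin_ext C B B.wd h" "r = lin_ext C R R.wd h"
    using assms(1) by (auto simp: graph_def)
  have "K (lin_ext C B B.wd h) (lin_ext C R R.wd h)"
    using h(1)
  proof (induction rule: B.R.fin_funs_induct)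
    case zero
    show ?case using assms(2) by (simp add: B.lin_ext_zero R.lin_ext_zero)
  next
    case (single c x)
    then show ?case using assms(3) wd_funs by (simp add: B.lin_ext_single R.lin_ext_single Pi_iff)
  next
    case (add h h')
    then have "(lin_ext C B B.wd h, lin_ext C R R.wd h) \<in> graph"
      "(lin_ext C B B.wd h', lin_ext C R R.wd h') \<in> graph"
      by (simp_all add: graph_def)
    then show ?case
      using assms(4) add
      by (simp add: B.lin_ext_add[OF _ _ wd_funs(1)] R.lin_ext_add[OF _ _ wd_funs(2)])
  qed
  then show ?thesis using h by simp
qed

lemma graph_prepend:
  assumes a: "a \<in> carrier A" and "(s, r) \<in> graph"
  shows "(f a \<otimes>\<^bsub>B\<^esub> P s, g a \<otimes>\<^bsub>R\<^esub> Q r) \<in> graph"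
  using assms(2)
proof (induction rule: graph_induct)
  case zero
  have "P \<zero>\<^bsub>B\<^esub> = \<zero>\<^bsub>B\<^esub>" using B.P_smult[of "\<zero>\<^bsub>C\<^esub>" "\<zero>\<^bsub>B\<^esub>"] by (simp add: B.P_closed)
  moreover have "Q \<zero>\<^bsub>R\<^esub> = \<zero>\<^bsub>R\<^esub>" using R.P_smult[of "\<zero>\<^bsub>C\<^esub>" "\<zero>\<^bsub>R\<^esub>"] by (simp add: R.P_closed)
  ultimately show ?case using a graph_zero by (simp add: B.f_closed R.f_closed)
next
  case (word c xs)
  then have xs: "xs \<noteq> []" "set xs \<subseteq> carrier A" by (auto simp: nonempty_words_def)
  have "f a \<otimes>\<^bsub>B\<^esub> P (c \<odot>\<^bsub>B\<^esub> B.wd xs) = c \<odot>\<^bsub>B\<^esub> B.wd (a # xs)"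
    using a xs word B.smult_assoc2[of c "P (B.wd xs)" "f a"]
    by (simp add: word_Cons B.P_smult B.wd_closed B.P_closed B.f_closed B.m_comm)
  moreover have "g a \<otimes>\<^bsub>R\<^esub> Q (c \<odot>\<^bsub>R\<^esub> R.wd xs) = c \<odot>\<^bsub>R\<^esub> R.wd (a # xs)"
    using a xs word R.smult_assoc2[of c "Q (R.wd xs)" "g a"]
    by (simp add: word_Cons R.P_smult R.wd_closed R.P_closed R.f_closed R.m_comm)
  moreover have "a # xs \<in> nonempty_words A" using a xs by (simp add: nonempty_words_def)
  ultimately show ?case using graph_smult[OF word(1) graph_word] by simp
next
  case (add s r s' r')
  then have "s \<in> carrier B" "s' \<in> carrier B" "r \<in> carrier R" "r' \<in> carrier R"
    using graph_closed by blast+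
  then show ?case
    using graph_add[OF add(3,4)] a
    by (simp add: B.P_add R.P_add B.r_distr R.r_distr B.P_closed R.P_closed B.f_closed R.f_closed)
qed

text \<open>The three products of words that the mixable shuffle formula leaves inside \<open>P\<close> and \<open>Q\<close> have
  smaller total length, and the formula has the same coefficients in both algebras.\<close>

lemma graph_mult_words:
  assumes "xs \<in> nonempty_words A" "ys \<in> nonempty_words A"
  shows "(B.wd xs \<otimes>\<^bsub>B\<^esub> B.wd ys, R.wd xs \<otimes>\<^bsub>R\<^esub> R.wd ys) \<in> graph"
  using assms
proof (induction "length xs + length ys" arbitrary: xs ys rule: less_induct)
  case less
  obtain a xs' b ys' where eq: "xs = a # xs'" "ys = b # ys'"
    using less.prems by (auto simp: nonempty_words_def neq_Nil_conv)
  have a: "a \<in> carrier A" and b: "b \<in> carrier A" and ab: "a \<otimes>\<^bsub>A\<^esub> b \<in> carrier A"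
    and sets: "set xs' \<subseteq> carrier A" "set ys' \<subseteq> carrier A"
    using less.prems by (auto simp: nonempty_words_def eq)
  consider "xs' = []" | "ys' = []" | "xs' \<in> nonempty_words A" "ys' \<in> nonempty_words A"
    using sets by (auto simp: nonempty_words_def)
  then show ?case
  proof cases
    case 1
    have "(a \<otimes>\<^bsub>A\<^esub> b) # ys' \<in> nonempty_words A" using ab sets by (simp add: nonempty_words_def)
    from graph_word[OF this] show ?thesis
      using B.wd_mult_single[OF a b sets(2)] R.wd_mult_single[OF a b sets(2)] by (simp add: eq 1)
  next
    case 2
    have "(b \<otimes>\<^bsub>A\<^esub> a) # xs' \<in> nonempty_words A" using ab a b sets by (simp add: nonempty_words_def)
    note w = graph_word[OF this]
    have "B.wd xs \<otimes>\<^bsub>B\<^esub> B.wd ys = B.wd ys \<otimes>\<^bsub>B\<^esub> B.wd xs"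
      "R.wd xs \<otimes>\<^bsub>R\<^esub> R.wd ys = R.wd ys \<otimes>\<^bsub>R\<^esub> R.wd xs"
      using less.prems by (auto simp: nonempty_words_def intro!: B.m_comm R.m_comm B.wd_closed R.wd_closed)
    then show ?thesis
      using w B.wd_mult_single[OF b a sets(1)] R.wd_mult_single[OF b a sets(1)] by (simp add: eq 2)
  next
    case 3
    have one: "\<one>\<^bsub>A\<^esub> # zs \<in> nonempty_words A" if "zs \<in> nonempty_words A" for zs
      using that by (simp add: nonempty_words_def)
    have "(B.wd xs' \<otimes>\<^bsub>B\<^esub> B.wd (\<one>\<^bsub>A\<^esub> # ys'), R.wd xs' \<otimes>\<^bsub>R\<^esub> R.wd (\<one>\<^bsub>A\<^esub> # ys')) \<in> graph"
      "(B.wd ys' \<otimes>\<^bsub>B\<^esub> B.wd (\<one>\<^bsub>A\<^esub> # xs'), R.wd ys' \<otimes>\<^bsub>R\<^esub> R.wd (\<one>\<^bsub>A\<^esub> # xs')) \<in> graph"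
      "(B.wd xs' \<otimes>\<^bsub>B\<^esub> B.wd ys', R.wd xs' \<otimes>\<^bsub>R\<^esub> R.wd ys') \<in> graph"
      by (rule less.hyps; use 3 one in \<open>simp add: eq\<close>)+
    from this[THEN graph_prepend[OF ab]]
    show ?thesis
      unfolding eq B.wd_mult[OF a b 3] R.wd_mult[OF a b 3]
      by (intro graph_add graph_smult B.weight_closed)
  qed
qed

lemma graph_mult:
  assumes "(s, r) \<in> graph" "(s', r') \<in> graph"
  shows "(s \<otimes>\<^bsub>B\<^esub> s', r \<otimes>\<^bsub>R\<^esub> r') \<in> graph"
proof -
  have left_word: "((c \<odot>\<^bsub>B\<^esub> B.wd xs) \<otimes>\<^bsub>B\<^esub> s', (c \<odot>\<^bsub>R\<^esub> R.wd xs) \<otimes>\<^bsub>R\<^esub> r') \<in> graph"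
    if c: "c \<in> carrier C" and xs: "xs \<in> nonempty_words A" for c xs
    using assms(2)
  proof (induction rule: graph_induct)
    case zero
    show ?case using c xs wd_funs graph_zero by (simp add: Pi_iff)
  next
    case (word d ys)
    have cl: "B.wd xs \<in> carrier B" "B.wd ys \<in> carrier B" "R.wd xs \<in> carrier R" "R.wd ys \<in> carrier R"
      using wd_funs xs word by auto
    have "(c \<odot>\<^bsub>B\<^esub> B.wd xs) \<otimes>\<^bsub>B\<^esub> (d \<odot>\<^bsub>B\<^esub> B.wd ys) = c \<odot>\<^bsub>B\<^esub> (d \<odot>\<^bsub>B\<^esub> (B.wd xs \<otimes>\<^bsub>B\<^esub> B.wd ys))"
      using c word cl B.smult_assoc2[of d "B.wd ys" "B.wd xs"]
      by (simp add: B.smult_assoc2 B.m_comm)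
    moreover have "(c \<odot>\<^bsub>R\<^esub> R.wd xs) \<otimes>\<^bsub>R\<^esub> (d \<odot>\<^bsub>R\<^esub> R.wd ys) = c \<odot>\<^bsub>R\<^esub> (d \<odot>\<^bsub>R\<^esub> (R.wd xs \<otimes>\<^bsub>R\<^esub> R.wd ys))"
      using c word cl R.smult_assoc2[of d "R.wd ys" "R.wd xs"]
      by (simp add: R.smult_assoc2 R.m_comm)
    ultimately show ?case
      using graph_smult[OF c graph_smult[OF word(1) graph_mult_words[OF xs word(2)]]] by simp
  next
    case (add s r s' r')
    then have "s \<in> carrier B" "s' \<in> carrier B" "r \<in> carrier R" "r' \<in> carrier R"
      using graph_closed by blast+
    then show ?case
      using graph_add[OF add(3,4)] c xs wd_funs
      by (simp add: B.r_distr R.r_distr Pi_iff)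
  qed
  show ?thesis
    using assms(1)
  proof (induction rule: graph_induct)
    case zero
    show ?case using graph_closed[OF assms(2)] graph_zero by simp
  next
    case (word c xs)
    then show ?case by (rule left_word)
  next
    case (add s1 r1 s2 r2)
    then have "s1 \<in> carrier B" "s2 \<in> carrier B" "r1 \<in> carrier R" "r2 \<in> carrier R"
      using graph_closed by blast+
    then show ?case
      using graph_add[OF add(3,4)] graph_closed[OF assms(2)]
      by (simp add: B.l_distr R.l_distr)
  qed
qed

lemma graph_gen: "a \<in> carrier A \<Longrightarrow> (f a, g a) \<in> graph"
  using graph_word[of "[a]"] by (simp add: nonempty_words_def)

lemma graph_one: "(\<one>\<^bsub>B\<^esub>, \<one>\<^bsub>R\<^esub>) \<in> graph"
  using graph_gen[of "\<one>\<^bsub>A\<^esub>"] by (simp add: alg_homD(4)[OF B.f] alg_homD(4)[OF R.f])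

lemma graph_P: "(s, r) \<in> graph \<Longrightarrow> (P s, Q r) \<in> graph"
  using graph_prepend[of "\<one>\<^bsub>A\<^esub>" s r] graph_closed[of s r]
  by (simp add: alg_homD(4)[OF B.f] alg_homD(4)[OF R.f] B.P_closed R.P_closed)

lemma generated_subset_graph: "baxter_generated C B P (f ` carrier A) \<subseteq> fst ` graph"
proof (rule B.baxter_generated_minimal)
  show "baxter_subalgebra C B P (fst ` graph)"
  proof (rule B.baxter_subalgebraI)
    show "fst ` graph \<subseteq> carrier B" using graph_closed by auto
    show "\<one>\<^bsub>B\<^esub> \<in> fst ` graph" using graph_one by force
    show "x \<otimes>\<^bsub>B\<^esub> y \<in> fst ` graph" "x \<oplus>\<^bsub>B\<^esub> y \<in> fst ` graph" if "x \<in> fst ` graph" "y \<in> fst ` graph" for x y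
      using that graph_mult graph_add by force+
    show "c \<odot>\<^bsub>B\<^esub> x \<in> fst ` graph" if "c \<in> carrier C" "x \<in> fst ` graph" for c x
      using that graph_smult by force
    show "P x \<in> fst ` graph" if "x \<in> fst ` graph" for x
      using that graph_P by force
  qed
  show "f ` carrier A \<subseteq> fst ` graph" using graph_gen by force
qed

text \<open>The graph is closed under all operations and covers the subalgebra generated by \<open>f\<close>. So it only
  remains to know that it is single-valued, and by linearity it suffices to look above zero: a linear
  combination of words that vanishes in \<open>B\<close> must vanish in \<open>R\<close>.\<close>

lemma universal_property:
  assumes inj: "\<And>h. h \<in> fin_funs C (nonempty_words A) \<Longrightarrow> lin_ext C B B.wd h = \<zero>\<^bsub>B\<^esub> \<Longrightarrow>
    lin_ext C R R.wd h = \<zero>\<^bsub>R\<^esub>"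
  defines "S \<equiv> B\<lparr>carrier := baxter_generated C B P (f ` carrier A)\<rparr>"
  shows "\<exists>!\<psi>. \<psi> \<in> baxter_hom C S P R Q \<and> \<psi> \<in> extensional (carrier S) \<and>
    (\<forall>a\<in>carrier A. \<psi> (f a) = g a)"
proof -
  let ?H = "baxter_generated C B P (f ` carrier A)"
  have gens: "f ` carrier A \<subseteq> carrier B" using B.f_closed by auto
  note H = B.baxter_subalgebraD[OF B.baxter_generated_subalgebra[OF gens]]
  have single: "r = r'" if "(s, r) \<in> graph" "(s, r') \<in> graph" for s r r'
  proof -
    have cl: "s \<in> carrier B" "r \<in> carrier R" "r' \<in> carrier R" using graph_closed that by blast+
    have "(s \<oplus>\<^bsub>B\<^esub> (\<ominus>\<^bsub>C\<^esub> \<one>\<^bsub>C\<^esub>) \<odot>\<^bsub>B\<^esub> s, r \<oplus>\<^bsub>R\<^esub> (\<ominus>\<^bsub>C\<^esub> \<one>\<^bsub>C\<^esub>) \<odot>\<^bsub>R\<^esub> r') \<in> graph"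
      using that by (intro graph_add graph_smult) auto
    then have "(\<zero>\<^bsub>B\<^esub>, r \<ominus>\<^bsub>R\<^esub> r') \<in> graph"
      using cl by (simp add: B.smult_minus_one[symmetric] R.smult_minus_one[symmetric] B.M.r_neg
          R.M.minus_eq)
    then have "r \<ominus>\<^bsub>R\<^esub> r' = \<zero>\<^bsub>R\<^esub>" using inj by (auto simp: graph_def)
    then show ?thesis using cl by (simp add: R.r_right_minus_eq)
  qed
  define \<psi> where "\<psi> = (\<lambda>s\<in>?H. THE r. (s, r) \<in> graph)"
  have \<psi>: "(s, \<psi> s) \<in> graph" if s: "s \<in> ?H" for s
  proof -
    obtain r where r: "(s, r) \<in> graph" using subsetD[OF generated_subset_graph s] by auto
    then have "(s, THE r. (s, r) \<in> graph) \<in> graph"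
      by (rule theI) (rule single[OF _ r])
    then show ?thesis using s by (simp add: \<psi>_def)
  qed
  have eq: "\<psi> s = r" if "s \<in> ?H" "(s, r) \<in> graph" for s r
    using single[OF \<psi>] that by blast
  have hom: "\<psi> \<in> baxter_hom C S P R Q"
    unfolding baxter_hom_def S_def
  proof (intro CollectI conjI ballI alg_homI; simp)
    show "\<psi> x \<in> carrier R" if "x \<in> ?H" for x
      using graph_closed[OF \<psi>[OF that]] by simp
    show "\<psi> \<one>\<^bsub>B\<^esub> = \<one>\<^bsub>R\<^esub>" using H(2) graph_one by (rule eq)
    show "\<psi> (x \<otimes>\<^bsub>B\<^esub> y) = \<psi> x \<otimes>\<^bsub>R\<^esub> \<psi> y" if "x \<in> ?H" "y \<in> ?H" for x y
      using that by (intro eq H graph_mult \<psi>)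
    show "\<psi> (x \<oplus>\<^bsub>B\<^esub> y) = \<psi> x \<oplus>\<^bsub>R\<^esub> \<psi> y" if "x \<in> ?H" "y \<in> ?H" for x y
      using that by (intro eq H graph_add \<psi>)
    show "\<psi> (c \<odot>\<^bsub>B\<^esub> x) = c \<odot>\<^bsub>R\<^esub> \<psi> x" if "c \<in> carrier C" "x \<in> ?H" for c x
      using that by (intro eq H graph_smult \<psi>)
    show "\<psi> (P x) = Q (\<psi> x)" if "x \<in> ?H" for x
      using that by (intro eq H graph_P \<psi>)
  qed
  have ext: "\<psi> \<in> extensional (carrier S)" by (simp add: \<psi>_def S_def)
  have gen: "\<psi> (f a) = g a" if "a \<in> carrier A" for a
    using that subsetD[OF B.baxter_generated_subset, of "f a" "f ` carrier A"]
    by (intro eq graph_gen) auto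
  show ?thesis
  proof (rule ex1I[of _ \<psi>])
    show "\<psi> \<in> baxter_hom C S P R Q \<and> \<psi> \<in> extensional (carrier S) \<and> (\<forall>a\<in>carrier A. \<psi> (f a) = g a)"
      using hom ext gen by simp
    fix \<psi>'
    assume \<psi>': "\<psi>' \<in> baxter_hom C S P R Q \<and> \<psi>' \<in> extensional (carrier S) \<and>
      (\<forall>a\<in>carrier A. \<psi>' (f a) = g a)"
    have agree: "\<psi>' y = \<psi> y" if "y \<in> f ` carrier A" for y
      using that \<psi>' gen by (elim imageE) simp
    show "\<psi>' = \<psi>"
    proof (rule extensionalityI)
      show "\<psi>' \<in> extensional (carrier S)" "\<psi> \<in> extensional (carrier S)"
        using \<psi>' ext by simp_all
      fix x assume "x \<in> carrier S"
      then have x: "x \<in> ?H" by (simp add: S_def)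
      show "\<psi>' x = \<psi> x"
        by (rule baxter_hom_unique[OF B.baxter_algebra_axioms R.baxter_algebra_axioms gens
              conjunct1[OF \<psi>', unfolded S_def] hom[unfolded S_def] agree x])
    qed
  qed
qed

end

section \<open>Words in the standard Baxter algebra\<close>

lemma lin_ext_rev:
  assumes "module C M" "w \<in> supp C h \<rightarrow> carrier M" "h \<in> fin_funs C X"
  shows "lin_ext C M w h = lin_ext C M (\<lambda>xs. w (rev xs)) (\<lambda>xs. h (rev xs))"
proof -
  interpret module C M by fact
  have supp: "supp C h = rev ` supp C (\<lambda>xs. h (rev xs))"
    by (auto simp: supp_def image_iff) (metis rev_rev_ident)
  have "lin_ext C M w h = (\<Oplus>\<^bsub>M\<^esub>x\<in>rev ` supp C (\<lambda>xs. h (rev xs)). h x \<odot>\<^bsub>M\<^esub> w x)"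
    unfolding lin_ext_def by (subst supp) simp
  also have "\<dots> = (\<Oplus>\<^bsub>M\<^esub>x\<in>supp C (\<lambda>xs. h (rev xs)). h (rev x) \<odot>\<^bsub>M\<^esub> w (rev x))"
    by (rule M.finsum_reindex) (use assms(2,3) supp in \<open>auto simp: Pi_iff dest: fin_funsD(1)\<close>)
  finally show ?thesis by (simp add: lin_ext_def)
qed

context tensor_powers
begin

sublocale dl: direct_system C T "tensor_one C A"
  by (rule direct_system.intro) (rule T_algebra tensor_one_hom)+

abbreviation tensor_class :: "'a list \<Rightarrow> (nat \<times> ('a list \<Rightarrow> 'c) set) set"
  where "tensor_class xs \<equiv> dl.lim (length xs) (pure_tensor C A xs)"

lemma Abar_algebra: "algebra C (Abar C A)"
  unfolding Abar_def by (rule dl.limit_algebra)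

lemma dl_hom: "dl.lim (Suc n) \<in> alg_hom C (T (Suc n)) (Abar C A)"
  unfolding Abar_def by (rule dl.lim_hom) simp

lemma tuples_nonempty: "xs \<in> tuples A (Suc n) \<longleftrightarrow> xs \<in> nonempty_words A \<and> length xs = Suc n"
  by (auto simp: tuples_def nonempty_words_def)

lemma tensor_class_closed: "xs \<in> nonempty_words A \<Longrightarrow> tensor_class xs \<in> carrier (Abar C A)"
proof -
  assume xs: "xs \<in> nonempty_words A"
  then obtain n where "length xs = Suc n" by (cases xs) (auto simp: nonempty_words_def)
  then show ?thesis
    using xs alg_homD(1)[OF dl_hom pure_tensor_closed, of xs n] by (simp add: tuples_nonempty)
qed

lemma tensor_class_append_one:
  assumes "xs \<in> tuples A (Suc n)"
  shows "tensor_class (xs @ [\<one>\<^bsub>A\<^esub>]) = tensor_class xs"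
proof -
  have "tensor_one C A (Suc n) (pure_tensor C A xs) = pure_tensor C A (xs @ [\<one>\<^bsub>A\<^esub>])"
    using assms
    by (simp add: pure_tensor_eq tensor_one_cls e_closed append_one_basis
        pure_tensor_eq[OF tuples_append_one[OF assms]])
  then show ?thesis
    using dl.lim_transit[of "Suc n" "pure_tensor C A xs" 1] assms pure_tensor_closed[OF assms]
    by (simp add: tuples_nonempty)
qed

lemma std_gen_eq: "std_gen C A a k = tensor_class (replicate k \<one>\<^bsub>A\<^esub> @ [a])"
  by (simp add: std_gen_def)

lemma std_gen_tuple: "a \<in> carrier A \<Longrightarrow> replicate k \<one>\<^bsub>A\<^esub> @ [a] \<in> tuples A (Suc k)"
  by (auto simp: tuples_def)

lemma std_gen_hom: "std_gen C A \<in> alg_hom C A (std_seqs C A)"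
proof -
  note h = alg_homD[OF dl_hom]
  have upd: "replicate k \<one>\<^bsub>A\<^esub> @ [a] = (replicate (Suc k) \<one>\<^bsub>A\<^esub>)[k := a]" for k a
    by (simp add: replicate_append_same[symmetric] list_update_append)
  have gen: "std_gen C A a = (\<lambda>k. dl.lim (Suc k) (pure_tensor C A (replicate k \<one>\<^bsub>A\<^esub> @ [a])))" for a
    by (simp add: std_gen_def)
  note p = pure_tensor_closed[OF std_gen_tuple]
  have mult: "pure_tensor C A (replicate k \<one>\<^bsub>A\<^esub> @ [a \<otimes>\<^bsub>A\<^esub> b])
      = pure_tensor C A (replicate k \<one>\<^bsub>A\<^esub> @ [a]) \<otimes>\<^bsub>T (Suc k)\<^esub> pure_tensor C A (replicate k \<one>\<^bsub>A\<^esub> @ [b])"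
    if "a \<in> carrier A" "b \<in> carrier A" for k a b
  proof -
    have "(replicate k \<one>\<^bsub>A\<^esub> @ [a]) \<star> (replicate k \<one>\<^bsub>A\<^esub> @ [b]) = replicate k \<one>\<^bsub>A\<^esub> @ [a \<otimes>\<^bsub>A\<^esub> b]"
      by (rule nth_equalityI) (auto simp: nth_append)
    then show ?thesis using that by (simp add: pure_tensor_mult[OF std_gen_tuple std_gen_tuple])
  qed
  have add: "pure_tensor C A (replicate k \<one>\<^bsub>A\<^esub> @ [a \<oplus>\<^bsub>A\<^esub> b])
      = pure_tensor C A (replicate k \<one>\<^bsub>A\<^esub> @ [a]) \<oplus>\<^bsub>T (Suc k)\<^esub> pure_tensor C A (replicate k \<one>\<^bsub>A\<^esub> @ [b])"
    if "a \<in> carrier A" "b \<in> carrier A" for k a b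
    unfolding upd
    by (rule multilinearD(2)[OF pure_tensor_multilinear one_tuple]) (use that in auto)
  have smult: "pure_tensor C A (replicate k \<one>\<^bsub>A\<^esub> @ [c \<odot>\<^bsub>A\<^esub> a])
      = c \<odot>\<^bsub>T (Suc k)\<^esub> pure_tensor C A (replicate k \<one>\<^bsub>A\<^esub> @ [a])"
    if "c \<in> carrier C" "a \<in> carrier A" for k c a
    unfolding upd
    by (rule multilinearD(3)[OF pure_tensor_multilinear one_tuple]) (use that in auto)
  have one: "pure_tensor C A (replicate k \<one>\<^bsub>A\<^esub> @ [\<one>\<^bsub>A\<^esub>]) = \<one>\<^bsub>T (Suc k)\<^esub>" for k
    using pure_tensor_one[of "Suc k"] by (simp add: replicate_append_same)
  show ?thesis
    by (rule alg_homI)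
      (simp_all add: gen std_seqs_def seq_algebra_def mult add smult one h p)
qed

lemma std_baxter_algebra:
  assumes "lam \<in> carrier C"
  shows "baxter_algebra C (std_seqs C A) lam (std_P C A lam)"
proof -
  have "std_P C A lam = (\<lambda>s k. lam \<odot>\<^bsub>Abar C A\<^esub> (\<Oplus>\<^bsub>Abar C A\<^esub>i\<in>{..<k}. s i))"
    by (intro ext) (simp add: std_P_def)
  then show ?thesis
    unfolding std_seqs_def using seq_baxter_algebra[OF Abar_algebra assms] by simp
qed

abbreviation std_word :: "'c \<Rightarrow> 'a list \<Rightarrow> nat \<Rightarrow> (nat \<times> ('a list \<Rightarrow> 'c) set) set"
  where "std_word lam \<equiv> word (std_seqs C A) (std_P C A lam) (std_gen C A)"

text \<open>An entry of \<open>P'(s)\<close> only involves the strictly earlier entries of \<open>s\<close>. Thus each of the \<open>n\<close>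
  applications of \<open>P'\<close> in a word with \<open>n + 1\<close> letters adds a leading zero, and the first entry after
  these zeros comes from the single choice of positions \<open>n, \<dots>, 1, 0\<close> for the letters, which reverses
  the word.\<close>

lemma std_word_entries:
  assumes lam: "lam \<in> carrier C" and "xs \<in> tuples A (Suc n)"
  shows "(\<forall>k<n. std_word lam xs k = \<zero>\<^bsub>Abar C A\<^esub>) \<and>
    std_word lam xs n = (lam [^] n) \<odot>\<^bsub>Abar C A\<^esub> tensor_class (rev xs)"
  using assms(2)
proof (induction n arbitrary: xs)
  case 0
  interpret Abar: algebra C "Abar C A" by (rule Abar_algebra)
  from 0 obtain a where xs: "xs = [a]" by (auto simp: tuples_def length_Suc_conv)
  then have "tensor_class [a] \<in> carrier (Abar C A)"
    using 0 by (intro tensor_class_closed) (simp add: tuples_nonempty)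
  then show ?case by (simp add: xs std_gen_eq)
next
  case (Suc n)
  interpret Abar: algebra C "Abar C A" by (rule Abar_algebra)
  from Suc.prems obtain a ys where xs: "xs = a # ys" and a: "a \<in> carrier A"
    and ys: "ys \<in> tuples A (Suc n)" "ys \<noteq> []"
    by (auto simp: tuples_def length_Suc_conv)
  let ?W = "std_word lam"
  have rys: "rev ys \<in> tuples A (Suc n)" using ys by (simp add: tuples_def)
  define Y where "Y = tensor_class (rev ys)"
  have IH: "\<forall>k<n. ?W ys k = \<zero>\<^bsub>Abar C A\<^esub>" "?W ys n = (lam [^] n) \<odot>\<^bsub>Abar C A\<^esub> Y"
    unfolding Y_def using Suc.IH[OF ys(1)] by blast+
  have Y: "Y \<in> carrier (Abar C A)"
    unfolding Y_def using rys by (intro tensor_class_closed) (simp add: tuples_nonempty)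
  have gen: "std_gen C A a k \<in> carrier (Abar C A)" for k
    using alg_homD(1)[OF std_gen_hom a] by (simp add: std_seqs_def seq_algebra_def)
  have W: "?W xs k = std_gen C A a k \<otimes>\<^bsub>Abar C A\<^esub> (lam \<odot>\<^bsub>Abar C A\<^esub> (\<Oplus>\<^bsub>Abar C A\<^esub>i\<in>{..<k}. ?W ys i))" for k
    using ys(2) by (simp add: xs word_Cons std_seqs_def seq_algebra_def std_P_def)
  have zeros: "(\<Oplus>\<^bsub>Abar C A\<^esub>i\<in>{..<k}. ?W ys i) = \<zero>\<^bsub>Abar C A\<^esub>" if "k \<le> n" for k
  proof -
    have "(\<Oplus>\<^bsub>Abar C A\<^esub>i\<in>{..<k}. ?W ys i) = (\<Oplus>\<^bsub>Abar C A\<^esub>i\<in>{..<k}. \<zero>\<^bsub>Abar C A\<^esub>)"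
      by (rule Abar.M.finsum_cong') (use IH that in auto)
    then show ?thesis by simp
  qed
  have pw: "lam [^] n \<in> carrier C" using lam by simp
  have "(\<Oplus>\<^bsub>Abar C A\<^esub>i\<in>{..<Suc n}. ?W ys i) = (lam [^] n) \<odot>\<^bsub>Abar C A\<^esub> Y"
  proof -
    have "(\<Oplus>\<^bsub>Abar C A\<^esub>i\<in>{..<Suc n}. ?W ys i)
        = ?W ys n \<oplus>\<^bsub>Abar C A\<^esub> (\<Oplus>\<^bsub>Abar C A\<^esub>i\<in>{..<n}. ?W ys i)"
      unfolding lessThan_Suc
      by (rule Abar.M.finsum_insert) (use IH pw Y in auto)
    then show ?thesis using IH(2) zeros[of n] pw Y by simp
  qed
  then have "?W xs (Suc n)
      = std_gen C A a (Suc n) \<otimes>\<^bsub>Abar C A\<^esub> (lam \<odot>\<^bsub>Abar C A\<^esub> ((lam [^] n) \<odot>\<^bsub>Abar C A\<^esub> Y))"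
    by (simp add: W)
  also have "\<dots> = (lam [^] Suc n) \<odot>\<^bsub>Abar C A\<^esub> (Y \<otimes>\<^bsub>Abar C A\<^esub> std_gen C A a (Suc n))"
  proof -
    have "lam \<odot>\<^bsub>Abar C A\<^esub> ((lam [^] n) \<odot>\<^bsub>Abar C A\<^esub> Y) = (lam [^] Suc n) \<odot>\<^bsub>Abar C A\<^esub> Y"
      using lam pw Y by (simp add: Abar.smult_assoc1[symmetric] R.m_comm)
    then show ?thesis
      using lam Y gen[of "Suc n"] Abar.smult_assoc2[of "lam [^] Suc n" Y "std_gen C A a (Suc n)"]
      by (simp add: Abar.m_comm del: R.nat_pow_Suc)
  qed
  also have "Y \<otimes>\<^bsub>Abar C A\<^esub> std_gen C A a (Suc n) = tensor_class (rev xs)"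
  proof -
    have len: "length ys = Suc n" using ys by (simp add: tuples_def)
    have t: "rev ys @ [\<one>\<^bsub>A\<^esub>] \<in> tuples A (Suc (Suc n))"
      "replicate (Suc n) \<one>\<^bsub>A\<^esub> @ [a] \<in> tuples A (Suc (Suc n))"
      using tuples_append_one[OF rys] std_gen_tuple[OF a] by blast+
    have "replicate (Suc n) \<one>\<^bsub>A\<^esub> \<star> rev ys = rev ys" by (rule tuple_mult_one[OF rys])
    then have unit: "rev ys \<star> replicate (Suc n) \<one>\<^bsub>A\<^esub> = rev ys"
      using tuple_mult_comm[OF rys one_tuple] by simp
    \<comment> \<open>Both factors are moved to stage \<open>n + 2\<close>, where \<open>a\<close> meets the new last factor \<open>\<one>\<close>.\<close>
    have "Y = tensor_class (rev ys @ [\<one>\<^bsub>A\<^esub>])"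
      unfolding Y_def by (rule tensor_class_append_one[OF rys, symmetric])
    then show ?thesis
      using alg_homD(2)[OF dl_hom pure_tensor_closed[OF t(1)] pure_tensor_closed[OF t(2)]]
      using len a by (simp add: std_gen_eq xs pure_tensor_mult[OF t] unit del: replicate.simps)
  qed
  finally have "?W xs (Suc n) = (lam [^] Suc n) \<odot>\<^bsub>Abar C A\<^esub> tensor_class (rev xs)" .
  moreover have "?W xs k = \<zero>\<^bsub>Abar C A\<^esub>" if "k < Suc n" for k
    using that lam gen by (simp add: W zeros)
  ultimately show ?case by blast
qed

lemma multilinear_rev:
  assumes w: "multilinear C A n M w"
  shows "multilinear C A n M (\<lambda>xs. w (rev xs))"
proof (rule multilinearI)
  fix xs assume xs: "xs \<in> tuples A n"
  then have r: "rev xs \<in> tuples A n" and len: "length xs = n" by (auto simp: tuples_def)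
  show "w (rev xs) \<in> carrier M" by (rule multilinearD(1)[OF w r])
  fix i a assume i: "i < n" and a: "a \<in> carrier A"
  have upd: "rev (xs[i := b]) = (rev xs)[n - i - 1 := b]" for b
    using i len by (simp add: rev_update)
  have j: "n - i - 1 < n" using i by simp
  show "w (rev (xs[i := a \<oplus>\<^bsub>A\<^esub> b])) = w (rev (xs[i := a])) \<oplus>\<^bsub>M\<^esub> w (rev (xs[i := b]))"
    if "b \<in> carrier A" for b
    unfolding upd by (rule multilinearD(2)[OF w r j a that])
  show "w (rev (xs[i := c \<odot>\<^bsub>A\<^esub> a])) = c \<odot>\<^bsub>M\<^esub> w (rev (xs[i := a]))" if "c \<in> carrier C" for c
    unfolding upd by (rule multilinearD(3)[OF w r j that a])
qed

text \<open>A combination of tensors with \<open>n + 1\<close> factors that is zero in the limit is zero at some later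
  stage, where the universal property detects it.\<close>

lemma tensor_class_kernel:
  assumes h: "h \<in> carrier (F (Suc n))"
    and zero: "lin_ext C (Abar C A) tensor_class h = \<zero>\<^bsub>Abar C A\<^esub>"
    and M: "module C M" and w: "multilinear C A (Suc n) M w"
  shows "lin_ext C M w h = \<zero>\<^bsub>M\<^esub>"
proof -
  interpret Abar: algebra C "Abar C A" by (rule Abar_algebra)
  have h': "h \<in> fin_funs C (tuples A (Suc n))" using h by (simp add: F_simps)
  have "dl.lim (Suc n) (cls (Suc n) h)
      = dl.lim (Suc n) (lin_ext C (T (Suc n)) (pure_tensor C A) h)"
    by (simp add: lin_ext_pure_tensor[OF h])
  also have "\<dots> = lin_ext C (Abar C A) (\<lambda>xs. dl.lim (Suc n) (pure_tensor C A xs)) h"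
    by (rule lin_ext_hom[OF T_module Abar.module h'])
      (use alg_homD[OF dl_hom] pure_tensor_closed in auto)
  also have "\<dots> = lin_ext C (Abar C A) tensor_class h"
    by (rule Abar.lin_ext_cong[OF h'])
      (auto simp: tuples_nonempty intro: tensor_class_closed)
  finally have "dl.lim (Suc n) (cls (Suc n) h) = \<zero>\<^bsub>dl.L\<^esub>"
    using zero by (simp add: Abar_def)
  moreover have "cls (Suc n) h \<in> carrier (T (Suc n))" using h by (simp add: carrier_T)
  ultimately obtain d where "transit (tensor_one C A) (Suc n) d (cls (Suc n) h) = \<zero>\<^bsub>T (Suc n + d)\<^esub>"
    using dl.lim_eq_zeroD[of "Suc n" "cls (Suc n) h"] by auto
  then show ?thesis by (rule transit_zero_kernel[OF M w h])
qed

lemma smult_power_cancel: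
  fixes n :: nat
  assumes lam: "lam \<in> carrier C"
    and reg: "\<not> zero_divisor (Abar C A) (lam \<odot>\<^bsub>Abar C A\<^esub> \<one>\<^bsub>Abar C A\<^esub>)"
    and Y: "Y \<in> carrier (Abar C A)" and zero: "(lam [^] n) \<odot>\<^bsub>Abar C A\<^esub> Y = \<zero>\<^bsub>Abar C A\<^esub>"
  shows "Y = \<zero>\<^bsub>Abar C A\<^esub>"
  using Y zero
proof (induction n arbitrary: Y)
  case 0
  interpret Abar: algebra C "Abar C A" by (rule Abar_algebra)
  show ?case using 0 by simp
next
  case (Suc n)
  interpret Abar: algebra C "Abar C A" by (rule Abar_algebra)
  have "lam \<odot>\<^bsub>Abar C A\<^esub> Y = \<zero>\<^bsub>Abar C A\<^esub>"
    by (rule Suc.IH) (use Suc.prems lam in \<open>simp_all add: Abar.smult_assoc1[symmetric]\<close>)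
  moreover have "lam \<odot>\<^bsub>Abar C A\<^esub> Y = (lam \<odot>\<^bsub>Abar C A\<^esub> \<one>\<^bsub>Abar C A\<^esub>) \<otimes>\<^bsub>Abar C A\<^esub> Y"
    using lam Suc.prems by (simp add: Abar.smult_assoc2)
  ultimately show ?case
    using reg lam Suc.prems by (auto simp: zero_divisor_def)
qed

text \<open>Triangularity. Let \<open>n + 1\<close> be the least length of a word in \<open>h\<close>. Longer words do not contribute
  to entry \<open>n\<close>, so this entry is \<open>lam\<^sup>n\<close> times the reversal of the part \<open>z\<close> of length \<open>n + 1\<close>, and
  regularity of \<open>lam\<close> makes \<open>z\<close> zero as a tensor. Words being multilinear, \<open>z\<close> contributes nothing in
  \<open>R\<close> or in the algebra of sequences, and the rest of \<open>h\<close> has smaller support.\<close>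

lemma std_word_kernel:
  fixes Q :: "'r \<Rightarrow> 'r" and R :: "('c, 'r, 'n) module_scheme"
  assumes lam: "lam \<in> carrier C"
    and reg: "\<not> zero_divisor (Abar C A) (lam \<odot>\<^bsub>Abar C A\<^esub> \<one>\<^bsub>Abar C A\<^esub>)"
    and R: "baxter_map C R lam Q A g"
    and h: "h \<in> fin_funs C (nonempty_words A)"
    and zero: "lin_ext C (std_seqs C A) (std_word lam) h = \<zero>\<^bsub>std_seqs C A\<^esub>"
  shows "lin_ext C R (word R Q g) h = \<zero>\<^bsub>R\<^esub>"
proof -
  interpret N: baxter_map C R lam Q A g by (rule R)
  interpret S: baxter_map C "std_seqs C A" lam "std_P C A lam" A "std_gen C A"
    by (intro baxter_map.intro baxter_map_axioms.intro std_baxter_algebra lam std_gen_hom algebra_axioms)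
  interpret Abar: algebra C "Abar C A" by (rule Abar_algebra)
  let ?W = "std_word lam"
  have funs: "?W \<in> nonempty_words A \<rightarrow> carrier (std_seqs C A)" "word R Q g \<in> nonempty_words A \<rightarrow> carrier R"
    by (auto simp: nonempty_words_def S.wd_closed N.wd_closed)
  show ?thesis
    using h zero
  proof (induction "card (supp C h)" arbitrary: h rule: less_induct)
    case less
    show ?case
    proof (cases "supp C h = {}")
      case True
      then show ?thesis by (simp add: lin_ext_def)
    next
      case False
      have fin: "finite (supp C h)" and sub: "supp C h \<subseteq> nonempty_words A"
        using less.prems(1) by (auto dest: fin_funsD)
      let ?m = "Min (length ` supp C h)"
      have "?m \<in> length ` supp C h" using fin False by (intro Min_in) auto
      then obtain xs0 where xs0: "?m = length xs0" "xs0 \<in> supp C h" by (rule imageE)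
      then have "xs0 \<noteq> []" using sub by (auto simp: nonempty_words_def)
      then obtain n where len: "length xs0 = Suc n" by (cases xs0) auto
      with xs0(1) have n: "?m = Suc n" by simp
      have least: "Suc n \<le> length xs" if "xs \<in> supp C h" for xs
        using that fin unfolding n[symmetric] by (intro Min_le) auto
      define z where "z = (\<lambda>xs. if length xs = Suc n then h xs else \<zero>)"
      define h' where "h' = (\<lambda>xs. if length xs \<noteq> Suc n then h xs else \<zero>)"
      have hc: "h xs \<in> carrier C" for xs using less.prems(1) by (rule fin_funsD)
      have z: "z \<in> fin_funs C (tuples A (Suc n))"
        unfolding z_def using R.fin_funs_restrict[OF less.prems(1), of "\<lambda>xs. length xs = Suc n"]
        by (rule R.fin_funs_mono) (auto simp: tuples_nonempty)
      have z_words: "z \<in> fin_funs C (nonempty_words A)"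
        using z by (rule R.fin_funs_mono) (auto simp: tuples_nonempty)
      have h': "h' \<in> fin_funs C (nonempty_words A)"
        unfolding h'_def using R.fin_funs_restrict[OF less.prems(1), of "\<lambda>xs. length xs \<noteq> Suc n"]
        by (rule R.fin_funs_mono) auto
      have h'_long: "h' \<in> fin_funs C {xs \<in> nonempty_words A. Suc n < length xs}"
        using h' least by (auto simp: fin_funs_def h'_def supp_def order_less_le)
      have split: "h = (\<lambda>xs. z xs \<oplus> h' xs)"
        using hc by (auto simp: z_def h'_def)
      have entry_closed: "?W xs k \<in> carrier (Abar C A)" if "xs \<in> nonempty_words A" for xs k
        using funs(1) that by (auto simp: std_seqs_def seq_algebra_def Pi_iff)
      have entry: "(lin_ext C (std_seqs C A) ?W q) n = lin_ext C (Abar C A) (\<lambda>xs. ?W xs n) q"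
        if "q \<in> fin_funs C (nonempty_words A)" for q
        by (rule lin_ext_hom[OF S.module_axioms Abar.module that funs(1)])
          (auto simp: std_seqs_def seq_algebra_def)
      \<comment> \<open>The combination \<open>z\<close>, reversed, as an element of the limit; the goal is that it is zero.\<close>
      let ?Y = "lin_ext C (Abar C A) (\<lambda>xs. tensor_class (rev xs)) z"
      have rev_class: "(\<lambda>xs. tensor_class (rev xs)) \<in> tuples A (Suc n) \<rightarrow> carrier (Abar C A)"
        by (rule funcsetI, rule tensor_class_closed) (auto simp: tuples_nonempty nonempty_words_def)
      have pw: "lam [^] n \<in> carrier C" using lam by simp
      have "(lam [^] n) \<odot>\<^bsub>Abar C A\<^esub> ?Y
          = lin_ext C (Abar C A) (\<lambda>xs. (lam [^] n) \<odot>\<^bsub>Abar C A\<^esub> tensor_class (rev xs)) z"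
        by (rule lin_ext_hom[OF Abar.module Abar.module z rev_class])
          (use pw in \<open>auto simp: Abar.smult_r_distr Abar.smult_assoc1[symmetric] R.m_comm\<close>)
      also have "\<dots> = lin_ext C (Abar C A) (\<lambda>xs. ?W xs n) z"
      proof (rule Abar.lin_ext_cong[OF z])
        show "(\<lambda>xs. ?W xs n) \<in> tuples A (Suc n) \<rightarrow> carrier (Abar C A)"
          using entry_closed by (simp add: tuples_nonempty)
        show "(lam [^] n) \<odot>\<^bsub>Abar C A\<^esub> tensor_class (rev xs) = ?W xs n"
          if "xs \<in> tuples A (Suc n)" for xs
          using std_word_entries[OF lam that] by simp
      qed
      also have "\<dots> = lin_ext C (Abar C A) (\<lambda>xs. ?W xs n) h"
      proof -
        have "lin_ext C (Abar C A) (\<lambda>xs. ?W xs n) h' = \<zero>\<^bsub>Abar C A\<^esub>"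
        proof (rule Abar.lin_ext_const_zero[OF h'_long])
          fix xs assume "xs \<in> {xs \<in> nonempty_words A. Suc n < length xs}"
          then have "xs \<in> tuples A (Suc (length xs - 1))" "n < length xs - 1"
            by (auto simp: tuples_nonempty)
          then show "?W xs n = \<zero>\<^bsub>Abar C A\<^esub>" using std_word_entries[OF lam] by blast
        qed
        moreover have "(\<lambda>xs. ?W xs n) \<in> nonempty_words A \<rightarrow> carrier (Abar C A)"
          using entry_closed by simp
        ultimately show ?thesis
          unfolding split[symmetric] using Abar.lin_ext_add[OF z_words h'] Abar.lin_ext_closed[OF z_words]
          by (subst split) simp
      qed
      also have "\<dots> = \<zero>\<^bsub>Abar C A\<^esub>"
        using entry[OF less.prems(1)] less.prems(2) by (simp add: std_seqs_def seq_algebra_def)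
      finally have "?Y = \<zero>\<^bsub>Abar C A\<^esub>"
        by (rule smult_power_cancel[OF lam reg Abar.lin_ext_closed[OF z rev_class]])
      moreover have "?Y = lin_ext C (Abar C A) tensor_class (\<lambda>xs. z (rev xs))"
        using lin_ext_rev[OF Abar.module _ z, of "\<lambda>xs. tensor_class (rev xs)"] rev_class
          fin_funsD(3)[OF z] by (auto simp: Pi_iff)
      ultimately have tz: "lin_ext C (Abar C A) tensor_class (\<lambda>xs. z (rev xs)) = \<zero>\<^bsub>Abar C A\<^esub>"
        by simp
      have zrev: "(\<lambda>xs. z (rev xs)) \<in> carrier (F (Suc n))"
      proof -
        have "supp C (\<lambda>xs. z (rev xs)) = rev ` supp C z"
          by (auto simp: supp_def image_iff) (metis rev_rev_ident)
        then show ?thesis using z by (auto simp: F_simps fin_funs_def tuples_def subset_iff)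
      qed
      \<comment> \<open>This is used for the algebra of sequences and for \<open>R\<close>.\<close>
      have null: "lin_ext C M w z = \<zero>\<^bsub>M\<^esub>"
        if M: "module C M" and w: "multilinear C A (Suc n) M w"
        for M :: "('c, 'x, 'y) module_scheme" and w
      proof -
        have "lin_ext C M w z = lin_ext C M (\<lambda>xs. w (rev xs)) (\<lambda>xs. z (rev xs))"
          by (rule lin_ext_rev[OF M _ z])
            (use w fin_funsD(3)[OF z] in \<open>auto simp: multilinear_def Pi_iff\<close>)
        also have "\<dots> = \<zero>\<^bsub>M\<^esub>"
          by (rule tensor_class_kernel[OF zrev tz M multilinear_rev[OF w]])
        finally show ?thesis .
      qed
      have "lin_ext C (std_seqs C A) ?W h' = \<zero>\<^bsub>std_seqs C A\<^esub>"
        using less.prems(2) S.lin_ext_add[OF z_words h' funs(1)]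
          null[OF S.module_axioms S.wd_multilinear] S.lin_ext_closed[OF h' funs(1)]
        by (simp add: split[symmetric])
      moreover have "card (supp C h') < card (supp C h)"
      proof (rule psubset_card_mono[OF fin])
        show "supp C h' \<subset> supp C h" using xs0(2) len by (auto simp: supp_def h'_def)
      qed
      ultimately have "lin_ext C R (word R Q g) h' = \<zero>\<^bsub>R\<^esub>"
        using less.hyps h' by blast
      then show ?thesis
        using N.lin_ext_add[OF z_words h' funs(2)] null[OF N.module_axioms N.wd_multilinear]
        by (simp add: split[symmetric])
    qed
  qed
qed

end

theorem corollary4p7:
  fixes C :: "('c, 'k) ring_scheme"
    and A :: "('c, 'a, 'm) module_scheme"
    and lam :: 'c
  assumes "cring C"
    and "lam \<in> carrier C"
    and "algebra C A"
    and "\<not> zero_divisor (Abar C A) (lam \<odot>\<^bsub>Abar C A\<^esub> \<one>\<^bsub>Abar C A\<^esub>)"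
  shows "baxter_algebra C (std_baxter C A lam) lam (std_P C A lam)
    \<and> std_gen C A \<in> alg_hom C A (std_baxter C A lam)
    \<and> (\<forall>(R :: ('c, 'r, 'n) module_scheme) P \<phi>.
        baxter_algebra C R lam P \<longrightarrow> \<phi> \<in> alg_hom C A R \<longrightarrow>
        (\<exists>!\<psi>. \<psi> \<in> baxter_hom C (std_baxter C A lam) (std_P C A lam) R P
             \<and> \<psi> \<in> extensional (carrier (std_baxter C A lam))
             \<and> (\<forall>a\<in>carrier A. \<psi> (std_gen C A a) = \<phi> a)))"
proof -
  interpret tensor_powers C A using assms(3) by (rule tensor_powers.intro)
  let ?S = "std_seqs C A" and ?P = "std_P C A lam" and ?t = "std_gen C A"
  interpret S: baxter_map C ?S lam ?P A ?t
    by (intro baxter_map.intro baxter_map_axioms.intro std_baxter_algebra assms std_gen_hom)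
  have gens: "?t ` carrier A \<subseteq> carrier ?S" using S.f_closed by auto
  note sub = S.baxter_generated_subalgebra[OF gens]
  have "baxter_algebra C (std_baxter C A lam) lam ?P"
    unfolding std_baxter_def by (rule S.baxter_subalgebra_baxter[OF sub])
  moreover have "?t \<in> alg_hom C A (std_baxter C A lam)"
  proof -
    have "?t a \<in> baxter_generated C ?S ?P (?t ` carrier A)" if "a \<in> carrier A" for a
      using subsetD[OF S.baxter_generated_subset] that by blast
    then show ?thesis
      unfolding std_baxter_def by (intro alg_homI) (simp_all add: alg_homD(2-5)[OF std_gen_hom])
  qed
  moreover have "\<exists>!\<psi>. \<psi> \<in> baxter_hom C (std_baxter C A lam) ?P R P
      \<and> \<psi> \<in> extensional (carrier (std_baxter C A lam)) \<and> (\<forall>a\<in>carrier A. \<psi> (?t a) = \<phi> a)"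
    if R: "baxter_algebra C R lam P" and \<phi>: "\<phi> \<in> alg_hom C A R"
    for R :: "('c, 'r, 'n) module_scheme" and P \<phi>
  proof -
    have map: "baxter_map C R lam P A \<phi>"
      by (intro baxter_map.intro baxter_map_axioms.intro R \<phi> assms)
    interpret baxter_map_pair C ?S R lam ?P P A ?t \<phi>
      by (intro baxter_map_pair.intro S.baxter_map_axioms map)
    show ?thesis
      unfolding std_baxter_def
      by (rule universal_property) (rule std_word_kernel[OF assms(2,4) map])
  qed
  ultimately show ?thesis by blast
qed

end
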